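(* Let the data set $\mathcal X=\mathcal X_1\cup\dots\cup\mathcal X_L$ of $N$ noisy length-$M$ observations be generated according to the data model described in the context. If $$\min_{k,\ell\in[L]\colon k\neq \ell} d(X^{(k)},X^{(\ell)}) \;>\; 8A(B+\sigma^2)\sqrt{\frac{2\log M}{M}}+2\mu_{\max},$$ then, with probability at least $1-2N/M^2$, the partition $\hat{\mathcal X}_1,\dots,\hat{\mathcal X}_L$ of $\mathcal X$ inferred by the KM algorithm (see context) corresponds to the true partition $\mathcal X_1,\dots,\mathcal X_L$ (i.e., the two partitions coincide up to a relabeling of the clusters).
   Context: Notation: $[n]=\{1,\dots,n\}$, and $\mathrm i$ is the imaginary unit. Data model. There are $L<N$ generative models. For each $\ell\in[L]$, $X^{(\ell)}[m]$, $m\in\mathbb Z$, is a real-valued zero-mean stationary Gaussian process with autocorrelation function (ACF) $r^{(\ell)}$ satisfying $\sum_{m\in\mathbb Z}|r^{(\ell)}[m]|<\infty$ and power spectral density (PSD) $s^{(\ell)}(f)$, $f\in[0,1)$, so that $r^{(\ell)}[m]=\int_0^1 s^{(\ell)}(f)e^{\mathrm i2\pi fm}\,df$. The PSDs are normalized: $\int_0^1 s^{(\ell)}(f)\,df=1$ for all $\ell\in[L]$. Let $W^{(\ell)}$ be a zero-mean white Gaussian noise process with variance $\sigma^2$ (the same for all $\ell$), independent of $X^{(\ell)}$, and let $\tilde X^{(\ell)}[m]=X^{(\ell)}[m]+W^{(\ell)}[m]$. The set $\mathcal X_\ell=\{\hat x^{(\ell)}_i\}_{i=1}^{n_\ell}$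 consists of $n_\ell$ contiguous length-$M$ observations of $\tilde X^{(\ell)}$, and $\sum_{\ell}n_\ell=N$. For each $\ell$, the $\hat x_i^{(\ell)}$ may either stem from independent realizations of $\tilde X^{(\ell)}$ or be different (possibly overlapping) length-$M$ segments of a given realization of $\tilde X^{(\ell)}$ (so in the latter case they need not be statistically independent). The observations in $\mathcal X$, enumerated irrespective of their generative model, are also written $\hat x_1,\dots,\hat x_N$. Window. $g[m]$, $m\in\mathbb Z$, is an even window function ($g[m]=g[-m]$) with $g[0]=1$ and with nonnegative bounded discrete-time Fourier transform $g(f)$, $0\le g(f)\le A<\infty$ for $f\in[0,1)$. PSD estimates. For an observation $\hat x_i$, the Blackman-Tukey PSD estimate is $\hat s_i(f)=\sum_{m=-M+1}^{M-1}g[m]\hat r_i[m]e^{-\mathrm i2\pi fm}$, where $\hat r_i[m]=\frac1M\sum_{n=1}^{M-|m|}\hat x_i[n+|m|]\,\hat x_i[n]$ for $|m|\le M-1$. Distances. $d(X^{(k)},X^{(\ell)})=\frac12\int_0^1|s^{(k)}(f)-s^{(\ell)}(f)|\,df$ for processes, and $d(\hat x_i,\hat x_j)=\frac12\int_0^1|\hat s_i(f)-\hat s_j(f)|\,df$ for observations. Constants. $B=\max_{\ell\in[L]}\sup_{f\in[0,1)}s^{(\ell)}(f)$. $\mu_{\max}=\max_{\ell\in[L]}\mu^{(\ell)}$ with $\mu^{(\ell)}=\sum_{m=-\infty}^{\infty}|h[m]|\,|r^{(\ell)}[m]|$, where $h[m]=1-g[m](1-|m|/M)$ for $|m|<M$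 and $h[m]=1$ otherwise. The KM algorithm (a single $k$-means iteration with farthest point initialization). Input: the observations $\hat x_1,\dots,\hat x_N$ and the number $L$ of generative models. Step 1: set $c_1=1$ and $\hat{\mathcal X}_\ell=\{\}$ for all $\ell\in[L]$. Step 2: for every $i\in[N]$ compute the Blackman-Tukey estimate $\hat s_i$. Step 3: for $p=2,\dots,L$ set $c_p=\arg\max_{i\in[N]}\min_{\ell\in[p-1]}d(\hat x_i,\hat x_{c_\ell})$. Step 4: for $i=1,\dots,N$ set $\ell^\star=\arg\min_{\ell\in[L]}d(\hat x_i,\hat x_{c_\ell})$ and add $\hat x_i$ to $\hat{\mathcal X}_{\ell^\star}$. Output: $\hat{\mathcal X}_1,\dots,\hat{\mathcal X}_L$. *)

theory Defs
  imports "HOL-Probability.Probability"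
begin

(* A degenerate (almost surely constant) variable counts as Gaussian: the zero linear
   combination below, and noise of variance 0, are of this kind. *)
definition gaussian_rv :: "'w measure \<Rightarrow> ('w \<Rightarrow> real) \<Rightarrow> bool" where
  "gaussian_rv P Z \<longleftrightarrow> Z \<in> borel_measurable P \<and>
     ((\<exists>c. AE w in P. Z w = c) \<or>
      (\<exists>m s. 0 < s \<and> distributed P lborel Z (normal_density m s)))"

definition gaussian_process :: "'w measure \<Rightarrow> (int \<Rightarrow> 'w \<Rightarrow> real) \<Rightarrow> bool" where
  "gaussian_process P X \<longleftrightarrow>
     (\<forall>I a. finite I \<longrightarrow> gaussian_rv P (\<lambda>w. \<Sum>m\<in>I. a m * X m w))"

abbreviation path_space :: "(int \<Rightarrow> real) measure" where
  "path_space \<equiv> PiM UNIV (\<lambda>_. borel)"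

definition trajectory :: "(int \<Rightarrow> 'w \<Rightarrow> real) \<Rightarrow> 'w \<Rightarrow> int \<Rightarrow> real" where
  "trajectory X w = (\<lambda>m. X m w)"

definition stationary :: "'w measure \<Rightarrow> (int \<Rightarrow> 'w \<Rightarrow> real) \<Rightarrow> bool" where
  "stationary P X \<longleftrightarrow>
     (\<forall>k. distr P path_space (trajectory (\<lambda>m. X (m + k))) = distr P path_space (trajectory X))"

definition stationary_gaussian ::
  "'w measure \<Rightarrow> (int \<Rightarrow> real) \<Rightarrow> (int \<Rightarrow> 'w \<Rightarrow> real) \<Rightarrow> bool" where
  "stationary_gaussian P r X \<longleftrightarrow>
     gaussian_process P X \<and> stationary P X \<and>
     (\<forall>m. integral\<^sup>L P (X m) = 0) \<and>
     (\<forall>n m. integral\<^sup>L P (\<lambda>w. X (n + m) w * X n w) = r m)"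

definition white_gaussian_noise ::
  "'w measure \<Rightarrow> real \<Rightarrow> (int \<Rightarrow> 'w \<Rightarrow> real) \<Rightarrow> bool" where
  "white_gaussian_noise P v W \<longleftrightarrow> stationary_gaussian P (\<lambda>m. if m = 0 then v else 0) W"

definition noisy_realization ::
  "'w measure \<Rightarrow> (int \<Rightarrow> real) \<Rightarrow> real \<Rightarrow> (int \<Rightarrow> 'w \<Rightarrow> real) \<Rightarrow> bool" where
  "noisy_realization P r v Y \<longleftrightarrow>
     (\<exists>X W. stationary_gaussian P r X \<and> white_gaussian_noise P v W \<and>
        prob_space.indep_var P path_space (trajectory X) path_space (trajectory W) \<and>
        (\<forall>m. \<forall>w\<in>space P. Y m w = X m w + W m w))"

(* lab i is the generative model of observation i.  Observation i consists of the M
   consecutive samples of the process Y i that follow time t i.  Within one model,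
   either the Y i are independent realizations, or they are all the same realization,
   read at different times.  Nothing is assumed about the dependence between models. *)
definition observation_model ::
  "'w measure \<Rightarrow> nat \<Rightarrow> nat \<Rightarrow> nat \<Rightarrow> (nat \<Rightarrow> int \<Rightarrow> real) \<Rightarrow> real \<Rightarrow> (nat \<Rightarrow> nat) \<Rightarrow>
   ('w \<Rightarrow> nat \<Rightarrow> nat \<Rightarrow> real) \<Rightarrow> bool" where
  "observation_model P M N L r v lab x \<longleftrightarrow>
     (\<exists>Y t.
        (\<forall>i\<in>{1..N}. noisy_realization P (r (lab i)) v (Y i)) \<and>
        (\<forall>l\<in>{1..L}.
           prob_space.indep_vars P (\<lambda>_. path_space) (\<lambda>i. trajectory (Y i)) {i\<in>{1..N}. lab i = l} \<or>
           ((\<forall>i\<in>{1..N}. \<forall>j\<in>{1..N}. lab i = l \<and> lab j = l \<longrightarrow> Y i = Y j) \<and>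
            inj_on t {i\<in>{1..N}. lab i = l})) \<and>
        (\<forall>i\<in>{1..N}. \<forall>n\<in>{1..M}. \<forall>w\<in>space P. x w i n = Y i (t i + int n) w))"

(* The sequence a and the 1-periodic spectrum F, given on [0,1), form a Fourier pair.
   Stated by inversion, so that it also covers sequences that are not absolutely summable
   (such as the window sequence of an ideal low-pass spectrum) and any version of F;
   lemma spectrumI covers the absolutely convergent series. *)
definition spectrum :: "(int \<Rightarrow> real) \<Rightarrow> (real \<Rightarrow> real) \<Rightarrow> bool" where
  "spectrum a F \<longleftrightarrow> set_integrable lborel {0..<1} F \<and>
     (\<forall>m. complex_of_real (a m) =
        (LINT f:{0..<1}|lborel. of_real (F f) * cis (2 * pi * f * of_int m)))"

(* For functions on [0,1); real for PSDs, complex for estimates. *)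
definition spec_dist :: "(real \<Rightarrow> 'b::real_normed_vector) \<Rightarrow> (real \<Rightarrow> 'b) \<Rightarrow> real" where
  "spec_dist s s' = 1 / 2 * (LINT f:{0..<1}|lborel. norm (s f - s' f))"

definition acf_est :: "nat \<Rightarrow> (nat \<Rightarrow> real) \<Rightarrow> int \<Rightarrow> real" where
  "acf_est M x m = 1 / real M * (\<Sum>n=1..M - nat \<bar>m\<bar>. x (n + nat \<bar>m\<bar>) * x n)"

definition bt_est :: "(int \<Rightarrow> real) \<Rightarrow> nat \<Rightarrow> (nat \<Rightarrow> real) \<Rightarrow> real \<Rightarrow> complex" where
  "bt_est g M x f =
     (\<Sum>m = - int M + 1..int M - 1. of_real (g m * acf_est M x m) * cis (- 2 * pi * f * of_int m))"

definition obs_dist :: "(int \<Rightarrow> real) \<Rightarrow> nat \<Rightarrow> (nat \<Rightarrow> real) \<Rightarrow> (nat \<Rightarrow> real) \<Rightarrow> real" where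
  "obs_dist g M x y = spec_dist (bt_est g M x) (bt_est g M y)"

(* Meaningful only for PSDs bounded above; the real SUP of an unbounded set is not infinite. *)
definition B_const :: "nat \<Rightarrow> (nat \<Rightarrow> real \<Rightarrow> real) \<Rightarrow> real" where
  "B_const L s = (MAX l\<in>{1..L}. SUP f\<in>{0..<1}. s l f)"

definition h_seq :: "(int \<Rightarrow> real) \<Rightarrow> nat \<Rightarrow> int \<Rightarrow> real" where
  "h_seq g M m = (if \<bar>m\<bar> < int M then 1 - g m * (1 - \<bar>real_of_int m\<bar> / real M) else 1)"

definition mu_max :: "(int \<Rightarrow> real) \<Rightarrow> nat \<Rightarrow> nat \<Rightarrow> (nat \<Rightarrow> int \<Rightarrow> real) \<Rightarrow> real" where
  "mu_max g M L r = (MAX l\<in>{1..L}. \<Sum>\<^sub>\<infinity>m\<in>UNIV. \<bar>h_seq g M m\<bar> * \<bar>r l m\<bar>)"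

(* C is a possible output on the observations x 1, ..., x N, clusters being given as sets
   of indices of observations.  A relation, because ties in the arg max and arg min may be
   broken in any way. *)
definition KM_output ::
  "(int \<Rightarrow> real) \<Rightarrow> nat \<Rightarrow> nat \<Rightarrow> nat \<Rightarrow> (nat \<Rightarrow> nat \<Rightarrow> real) \<Rightarrow> (nat \<Rightarrow> nat set) \<Rightarrow> bool" where
  "KM_output g M N L x C \<longleftrightarrow>
     (\<exists>c a. c 1 = 1 \<and>
        (\<forall>p\<in>{2..L}. is_arg_max (\<lambda>i. MIN q\<in>{1..p - 1}. obs_dist g M (x i) (x (c q)))
                       (\<lambda>i. i \<in> {1..N}) (c p)) \<and>
        (\<forall>i\<in>{1..N}. is_arg_min (\<lambda>q. obs_dist g M (x i) (x (c q))) (\<lambda>q. q \<in> {1..L}) (a i)) \<and>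
        (\<forall>q\<in>{1..L}. C q = {i\<in>{1..N}. a i = q}))"

definition same_partition :: "nat \<Rightarrow> (nat \<Rightarrow> nat set) \<Rightarrow> (nat \<Rightarrow> nat set) \<Rightarrow> bool" where
  "same_partition L C D \<longleftrightarrow> (\<exists>\<pi>. bij_betw \<pi> {1..L} {1..L} \<and> (\<forall>l\<in>{1..L}. C (\<pi> l) = D l))"

lemma integral_cis_int:
  fixes k :: int
  shows "set_integrable lborel {0..<1} (\<lambda>f. cis (2 * pi * f * of_int k))"
    and "(LINT f:{0..<1}|lborel. cis (2 * pi * f * of_int k)) = (if k = 0 then 1 else 0)"
proof -
  let ?u = "\<lambda>f::real. cis (2 * pi * f * of_int k)"
  have cont: "continuous_on {0..1} ?u" by (intro continuous_intros)
  have int: "set_integrable lborel {0..1} ?u"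
    unfolding set_integrable_def by (rule borel_integrable_compact[OF compact_Icc cont])
  show int': "set_integrable lborel {0..<1} ?u"
    by (rule set_integrable_subset[OF int]) auto
  have "(LINT f:{0..<1}|lborel. ?u f) = (LINT f:{0..1}|lborel. ?u f)"
    unfolding set_lebesgue_integral_def
    using int int' unfolding set_integrable_def
    by (intro integral_cong_AE AE_I[of _ _ "{1}"]) (auto simp: indicator_def)
  also have "\<dots> = (if k = 0 then 1 else 0)"
  proof (cases "k = 0")
    case True
    then show ?thesis by (simp add: set_lebesgue_integral_def)
  next
    case False
    let ?c = "2 * pi * of_int k :: real"
    let ?G = "\<lambda>f::real. cis (?c * f) / (\<i> * of_real ?c)"
    have "?c \<noteq> 0" using False by simp
    have der: "(?G has_vector_derivative ?u f) (at f within {0..1})" for f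
    proof -
      have "((\<lambda>f. exp (\<i> * of_real ?c * of_real f) / (\<i> * of_real ?c)) has_vector_derivative
             exp (\<i> * of_real ?c * of_real f)) (at f within {0..1})"
        using \<open>?c \<noteq> 0\<close>
        by (auto intro!: derivative_eq_intros has_vector_derivative_real_field)
      then show ?thesis
        by (simp add: cis_conv_exp mult_ac)
    qed
    have "(LINT f:{0..1}|lborel. ?u f) = ?G 1 - ?G 0"
      unfolding set_lebesgue_integral_def
      using integral_FTC_atLeastAtMost[of 0 1 ?G ?u, OF _ der cont] by simp
    also have "\<dots> = 0"
      using cis_multiple_2pi[of "of_int k"] by simp
    finally show ?thesis using False by simp
  qed
  finally show "(LINT f:{0..<1}|lborel. ?u f) = (if k = 0 then 1 else 0)" .
qed

lemma spectrumI:
  assumes sum: "(\<lambda>m. \<bar>a m\<bar>) summable_on UNIV"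
    and F: "\<And>f. complex_of_real (F f) =
              (\<Sum>\<^sub>\<infinity>m\<in>UNIV. of_real (a m) * cis (- 2 * pi * f * of_int m))"
  shows "spectrum a F"
proof -
  let ?d = int_decode
  have dec: "bij_betw ?d UNIV UNIV" by (rule bij_int_decode)
  have "(\<lambda>n. \<bar>a (?d n)\<bar>) summable_on UNIV"
    using summable_on_reindex_bij_betw[OF dec, of "\<lambda>m. \<bar>a m\<bar>"] sum by simp
  then have abs: "summable (\<lambda>n. \<bar>a (?d n)\<bar>)"
    by (rule summable_on_imp_summable)
  have F_sums: "(\<lambda>n. of_real (a (?d n)) * cis (- 2 * pi * f * of_int (?d n))) sums
                complex_of_real (F f)" for f
  proof -
    have "(\<lambda>m. norm (of_real (a m) * cis (- 2 * pi * f * of_int m))) summable_on UNIV"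
      using sum by (simp add: norm_mult)
    then have "((\<lambda>m. of_real (a m) * cis (- 2 * pi * f * of_int m)) has_sum of_real (F f)) UNIV"
      unfolding F by (rule has_sum_infsum[OF abs_summable_summable])
    then have "((\<lambda>n. of_real (a (?d n)) * cis (- 2 * pi * f * of_int (?d n))) has_sum
                of_real (F f)) UNIV"
      using has_sum_reindex_bij_betw[OF dec,
          of "\<lambda>m. of_real (a m) * cis (- 2 * pi * f * of_int m)" "of_real (F f)"] by simp
    then show ?thesis by (rule has_sum_imp_sums)
  qed
  have main: "set_integrable lborel {0..<1} (\<lambda>f. of_real (F f) * cis (2 * pi * f * of_int k))
      \<and> (LINT f:{0..<1}|lborel. of_real (F f) * cis (2 * pi * f * of_int k))
          = complex_of_real (a k)" for k :: int
  proof -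
    let ?t = "\<lambda>n f. indicator {0..<1} f *\<^sub>R
                (complex_of_real (a (?d n)) * cis (2 * pi * f * of_int (k - ?d n)))"
    have t_sums: "(\<lambda>n. ?t n f) sums
        (indicator {0..<1} f *\<^sub>R (of_real (F f) * cis (2 * pi * f * of_int k)))" for f
    proof -
      have eq: "of_real (a (?d n)) * cis (- 2 * pi * f * of_int (?d n)) * cis (2 * pi * f * of_int k)
          = complex_of_real (a (?d n)) * cis (2 * pi * f * of_int (k - ?d n))" for n
      proof -
        have "- 2 * pi * f * of_int (?d n) + 2 * pi * f * of_int k = 2 * pi * f * of_int (k - ?d n)"
          by (simp add: algebra_simps)
        then show ?thesis by (simp only: mult.assoc cis_mult)
      qed
      have "(\<lambda>n. complex_of_real (a (?d n)) * cis (2 * pi * f * of_int (k - ?d n))) sums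
          (of_real (F f) * cis (2 * pi * f * of_int k))"
        using sums_mult2[OF F_sums[of f], of "cis (2 * pi * f * of_int k)"] unfolding eq .
      then show ?thesis by (rule sums_scaleR_right)
    qed
    have t_int: "integrable lborel (?t n)" for n
      using integrable_mult_right[OF integral_cis_int(1)[of "k - ?d n", unfolded set_integrable_def],
          of "complex_of_real (a (?d n))"]
      by simp
    have t_norm: "norm (?t n f) = indicator {0..<1} f * \<bar>a (?d n)\<bar>" for n f
      by (simp add: norm_mult)
    have t_le: "norm (?t n f) \<le> \<bar>a (?d n)\<bar>" for n f
      unfolding t_norm by (simp add: indicator_def)
    have s1: "AE f in lborel. summable (\<lambda>n. norm (?t n f))"
      by (intro AE_I2 summable_comparison_test'[OF abs, of 0]) (use t_le in simp)
    have s2: "summable (\<lambda>n. LINT f|lborel. norm (?t n f))"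
      unfolding t_norm using abs by simp
    have val: "(LINT f|lborel. ?t n f) = (if n = int_encode k then complex_of_real (a k) else 0)" for n
    proof -
      have "(LINT f|lborel. ?t n f) = complex_of_real (a (?d n)) *
              (LINT f:{0..<1}|lborel. cis (2 * pi * f * of_int (k - ?d n)))"
        unfolding set_lebesgue_integral_def
        by (subst integral_mult_right_zero[symmetric]) simp
      also have "\<dots> = (if n = int_encode k then complex_of_real (a k) else 0)"
        unfolding integral_cis_int(2) by auto
      finally show ?thesis .
    qed
    have sm: "(\<lambda>f. \<Sum>n. ?t n f) =
        (\<lambda>f. indicator {0..<1} f *\<^sub>R (of_real (F f) * cis (2 * pi * f * of_int k)))"
      using t_sums by (auto simp: sums_iff)
    have "(LINT f|lborel. (\<Sum>n. ?t n f)) = (\<Sum>n. (LINT f|lborel. ?t n f))"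
      by (rule integral_suminf[OF t_int s1 s2])
    also have "\<dots> = complex_of_real (a k)"
      unfolding val using sums_single[of "int_encode k" "\<lambda>_. complex_of_real (a k)"]
      by (simp add: sums_iff)
    finally show ?thesis
      using integrable_suminf[OF t_int s1 s2]
      unfolding sm set_integrable_def set_lebesgue_integral_def by simp
  qed
  have "integrable lborel (\<lambda>f. Re (indicator {0..<1} f *\<^sub>R (of_real (F f) * cis (2 * pi * f * of_int 0))))"
    using main[of 0] unfolding set_integrable_def by (intro integrable_Re) blast
  then have "set_integrable lborel {0..<1} F"
    unfolding set_integrable_def by simp
  then show ?thesis
    unfolding spectrum_def using main by simp
qed

end

theory Submission
  imports Defs
begin

text \<open>
  Write the estimate at frequency \<open>f\<close> as a positive semidefinite quadratic form in the
  samples, hence as \<open>|y|\<^sup>2\<close> for a Gaussian vector \<open>y\<close> whose covariance \<open>D\<close> has operator norm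
  at most \<open>b = A (B + \<sigma>\<^sup>2) / M\<close>. For a standard Gaussian vector \<open>\<eta>\<close>, the Hubbard-Stratonovich
  identity gives \<open>E exp (s/2 |y|\<^sup>2) = E exp (s/2 \<langle>\<eta>, D \<eta>\<rangle>)\<close> for both signs of \<open>s\<close>. In the
  product of these expectations at \<open>s\<close> and \<open>-s\<close>, a rotation by 45 degrees turns the difference
  of two independent copies of the form into \<open>2 \<langle>u, D v\<rangle>\<close>, so the product is at most
  \<open>E exp (s\<^sup>2 b\<^sup>2 |v|\<^sup>2 / 2)\<close>; Jensen's inequality bounds one factor from below by
  the centering term. This controls the exponential moments of the deviation at every \<open>f\<close>, and
  Jensen's inequality over \<open>f\<close> transfers the bound to the integrated deviation without a
  supremum over \<open>f\<close>.

  The bias of the estimate has Fourier coefficients \<open>h r\<close>, so it is at most \<open>\<mu>\<close>; the white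
  noise contributes a constant that cancels in differences. Hence, off the exceptional event,
  distances within a cluster are smaller than all distances between clusters, and then farthest
  point initialization picks one centre from each cluster.
\<close>

section \<open>The clustering iteration\<close>

text \<open>The constants come from one Chernoff bound. Put \<open>\<kappa> = 2 ln M / M\<close>.
  The exponent \<open>\<theta> = sqrt \<kappa> / (2 b)\<close> bounds the exponential moment of the
  integrated deviation by \<open>2 M^2\<close>; at the level
  \<open>T = 4 A (B + \<sigma>^2) sqrt \<kappa>\<close> Markov's inequality divides this by
  \<open>M^4\<close>. So each observation fails with probability at most \<open>2 / M^2\<close>, and
  a union bound copes with dependent observations. Since \<open>d\<close> is half an integral, every
  estimate is then within \<open>T / 2\<close> of its mean, and means more than \<open>2 T\<close>
  apart can be told apart: this is the 8 in the separation.

  The moment bound needs \<open>\<kappa> <= 1/2\<close>. For \<open>L >= 2\<close> this follows from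
  the separation itself: the means are nonnegative with integral \<open>1 + \<sigma>^2\<close>, so
  their distance is at most \<open>1 + \<sigma>^2 <= A (B + \<sigma>^2)\<close>, which forces
  \<open>8 sqrt \<kappa> < 1\<close>. For \<open>L = 1\<close> there is nothing to separate.

  Operator bounds are obtained from inequalities between quadratic forms, without eigenvalues. The
  bias bound is pointwise, while a PSD is known only through its coefficients, so Fourier uniqueness
  is proved on the way.\<close>

lemma KM_output_correct:
  assumes "1 \<le> N" and labels: "lab ` {1..N} = {1..L}"
    and same: "\<And>i j. i \<in> {1..N} \<Longrightarrow> j \<in> {1..N} \<Longrightarrow> lab i = lab j \<Longrightarrow> obs_dist g M (x i) (x j) \<le> t"
    and diff: "\<And>i j. i \<in> {1..N} \<Longrightarrow> j \<in> {1..N} \<Longrightarrow> lab i \<noteq> lab j \<Longrightarrow> t < obs_dist g M (x i) (x j)"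
    and KM: "KM_output g M N L x C"
  shows "same_partition L C (\<lambda>l. {i\<in>{1..N}. lab i = l})"
proof -
  let ?d = "\<lambda>i j. obs_dist g M (x i) (x j)"
  obtain c a where c1: "c 1 = 1"
    and cmax: "\<And>p. p \<in> {2..L} \<Longrightarrow> is_arg_max (\<lambda>i. MIN q\<in>{1..p - 1}. ?d i (c q)) (\<lambda>i. i \<in> {1..N}) (c p)"
    and amin: "\<And>i. i \<in> {1..N} \<Longrightarrow> is_arg_min (\<lambda>q. ?d i (c q)) (\<lambda>q. q \<in> {1..L}) (a i)"
    and C: "\<And>q. q \<in> {1..L} \<Longrightarrow> C q = {i\<in>{1..N}. a i = q}"
    using KM unfolding KM_output_def by blast
  have c_in: "c q \<in> {1..N}" if "q \<in> {1..L}" for q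
  proof (cases "q = 1")
    case True then show ?thesis using c1 \<open>1 \<le> N\<close> by simp
  next
    case False then show ?thesis using cmax[of q] that by (auto simp: is_arg_max_def)
  qed
  \<comment> \<open>Pigeonhole: fewer than \<open>L\<close> centres miss some label, and since
    \<open>lab\<close> is onto, some observation carries it. That observation is more than
    \<open>t\<close> away from all earlier centres, so the maximiser \<open>c p\<close> is too,
    whereas equal labels mean distance at most \<open>t\<close>.\<close>
  have new_label: "lab (c p) \<noteq> lab (c q)" if "q \<in> {1..L}" "p \<in> {1..L}" "q < p" for p q
  proof
    assume eq: "lab (c p) = lab (c q)"
    have p: "p \<in> {2..L}" and q: "q \<in> {1..p - 1}" using that by auto
    have "card ((lab \<circ> c) ` {1..p - 1}) \<le> card {1..p - 1}" by (rule card_image_le) simp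
    also have "\<dots> < card {1..L}" using p by auto
    finally have "\<not> {1..L} \<subseteq> (lab \<circ> c) ` {1..p - 1}"
      using card_mono[of "(lab \<circ> c) ` {1..p - 1}" "{1..L}"] by auto
    then obtain l where l: "l \<in> {1..L}" "l \<notin> (lab \<circ> c) ` {1..p - 1}" by (meson subsetI)
    then obtain i where i: "i \<in> {1..N}" "lab i \<notin> (lab \<circ> c) ` {1..p - 1}"
      unfolding labels[symmetric] by (metis imageE)
    have "t < ?d i (c k)" if "k \<in> {1..p - 1}" for k
      using i that p c_in[of k] by (intro diff) auto
    then have "t < (MIN k\<in>{1..p - 1}. ?d i (c k))"
      using q by (subst Min_gr_iff) auto
    also have "\<dots> \<le> (MIN k\<in>{1..p - 1}. ?d (c p) (c k))"
      using cmax[OF p] i(1) by (auto simp: is_arg_max_def not_less)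
    also have "\<dots> \<le> ?d (c p) (c q)" using q by (intro Min_le) auto
    also have "\<dots> \<le> t" using that eq by (intro same c_in)
    finally show False by simp
  qed
  have inj: "inj_on (lab \<circ> c) {1..L}"
  proof (rule inj_onI, rule ccontr)
    fix p q assume pq: "p \<in> {1..L}" "q \<in> {1..L}" "(lab \<circ> c) p = (lab \<circ> c) q" "p \<noteq> q"
    then consider "p < q" | "q < p" by linarith
    then show False using new_label[OF pq(1,2)] new_label[OF pq(2,1)] pq(3) by cases auto
  qed
  have bij: "bij_betw (lab \<circ> c) {1..L} {1..L}"
  proof (rule bij_betw_imageI[OF inj], rule endo_inj_surj[OF _ _ inj])
    show "(lab \<circ> c) ` {1..L} \<subseteq> {1..L}"
    proof (rule image_subsetI)
      fix q assume "q \<in> {1..L}"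
      from imageI[OF c_in[OF this], of lab] show "(lab \<circ> c) q \<in> {1..L}" unfolding labels by simp
    qed
  qed simp
  have lab_a: "a i \<in> {1..L} \<and> lab (c (a i)) = lab i" if i: "i \<in> {1..N}" for i
  proof -
    have ai: "a i \<in> {1..L}" using amin[OF i] by (auto simp: is_arg_min_def)
    have "lab i \<in> (lab \<circ> c) ` {1..L}"
      unfolding bij_betw_imp_surj_on[OF bij] using imageI[OF i, of lab] unfolding labels .
    then obtain q where q: "q \<in> {1..L}" "lab (c q) = lab i" by auto
    have "?d i (c (a i)) \<le> ?d i (c q)"
      using amin[OF i] q(1) by (auto simp: is_arg_min_def not_less)
    also have "\<dots> \<le> t" using i q by (intro same c_in) auto
    finally show ?thesis
      using diff[OF i c_in[OF ai]] ai by (metis not_less)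
  qed
  show ?thesis
    unfolding same_partition_def
  \<comment> \<open>Cluster \<open>q\<close> collects the observations labelled
    \<open>lab (c q)\<close>, so the map from true labels to clusters is the inverse of
    \<open>lab \<circ> c\<close>.\<close>
  proof (intro exI[of _ "inv_into {1..L} (lab \<circ> c)"] conjI ballI)
    show "bij_betw (inv_into {1..L} (lab \<circ> c)) {1..L} {1..L}" by (rule bij_betw_inv_into[OF bij])
    fix l assume l: "l \<in> {1..L}"
    let ?q = "inv_into {1..L} (lab \<circ> c) l"
    have q: "?q \<in> {1..L}" "lab (c ?q) = l"
      using bij l bij_betw_inv_into_right[OF bij l] bij_betw_apply[OF bij_betw_inv_into[OF bij] l] by auto
    have "a i = ?q \<longleftrightarrow> lab i = l" if "i \<in> {1..N}" for i
      using lab_a[OF that] q inj_onD[OF inj, of "a i" ?q] by (metis comp_apply)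
    then show "C ?q = {i\<in>{1..N}. lab i = l}" unfolding C[OF q(1)] by auto
  qed
qed

text \<open>The lag \<open>m\<close> names a diagonal of the index square and \<open>n\<close> a
  position on it. Values in a ring serve the complex estimate; with \<open>x = 1\<close> the inner
  sum counts the \<open>M - |m|\<close> entries of a diagonal, which produces the triangular weight
  in the mean.\<close>

lemma sum_diagonals:
  fixes G :: "int \<Rightarrow> 'a::comm_ring_1"
  shows "(\<Sum>m = - int M + 1..int M - 1. G m * (\<Sum>n=1..M - nat \<bar>m\<bar>. x (n + nat \<bar>m\<bar>) * x n)) =
    (\<Sum>p=1..M. \<Sum>q=1..M. G (int p - int q) * (x p * x q))"
proof -
  let ?S = "SIGMA m:{- int M + 1..int M - 1}. {1..M - nat \<bar>m\<bar>}"
  \<comment> \<open>Here \<open>n\<close> is the smaller index. \<open>nat\<close> sends negative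
    numbers to 0, so at least one of the two shifts vanishes, according to the sign of
    \<open>m\<close>.\<close>
  define j where "j = (\<lambda>(m::int, n::nat). (n + nat m, n + nat (- m)))"
  define i where "i = (\<lambda>(p, q). (int p - int q, min p q))"
  have j: "j a \<in> {1..M} \<times> {1..M} \<and> i (j a) = a \<and>
      (case j a of (p, q) \<Rightarrow> G (int p - int q) * (x p * x q)) = (case a of (m, n) \<Rightarrow> G m * (x (n + nat \<bar>m\<bar>) * x n))"
    if a: "a \<in> ?S" for a
  proof -
    obtain m n where mn: "a = (m, n)" by (cases a)
    show ?thesis
    proof (cases "0 \<le> m")
      case True
      then have "nat (- m) = 0" "int (n + nat m) - int n = m" "\<bar>m\<bar> = m" by auto
      then show ?thesis using a True unfolding mn by (auto simp: i_def j_def)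
    next
      case False
      then have "nat m = 0" "int n - int (n + nat (- m)) = m" "\<bar>m\<bar> = - m" by auto
      then show ?thesis using a False unfolding mn by (auto simp: i_def j_def mult.commute)
    qed
  qed
  have i: "i b \<in> ?S \<and> j (i b) = b" if b: "b \<in> {1..M} \<times> {1..M}" for b
  proof -
    obtain p q where pq: "b = (p, q)" by (cases b)
    have "nat (int p - int q) = p - q" "nat (- (int p - int q)) = q - p" "nat \<bar>int p - int q\<bar> = max p q - min p q"
      by linarith+
    moreover have "min p q \<le> M - (max p q - min p q)" "min p q + (p - q) = p" "min p q + (q - p) = q" "1 \<le> min p q"
      using b unfolding pq by auto
    ultimately show ?thesis using b unfolding pq by (auto simp: i_def j_def)
  qed
  have "(\<Sum>m = - int M + 1..int M - 1. G m * (\<Sum>n=1..M - nat \<bar>m\<bar>. x (n + nat \<bar>m\<bar>) * x n)) =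
    (\<Sum>(m, n)\<in>?S. G m * (x (n + nat \<bar>m\<bar>) * x n))"
    by (simp only: sum_distrib_left) (rule sum.Sigma, auto)
  also have "\<dots> = (\<Sum>(p, q)\<in>{1..M} \<times> {1..M}. G (int p - int q) * (x p * x q))"
    by (rule sum.reindex_bij_witness[of _ i j]) (use i j in blast)+
  also have "\<dots> = (\<Sum>p=1..M. \<Sum>q=1..M. G (int p - int q) * (x p * x q))"
    by (rule sum.cartesian_product[symmetric])
  finally show ?thesis .
qed

section \<open>Fourier pairs on the unit interval\<close>

lemma borel_measurable_cis[measurable]: "cis \<in> borel_measurable borel"
  by (intro borel_measurable_continuous_onI continuous_intros)

lemma set_integrable_mult_bounded:
  fixes E u :: "'a \<Rightarrow> complex"
  assumes E: "set_integrable M S E" and u: "u \<in> borel_measurable M" "\<And>x. x \<in> S \<Longrightarrow> norm (u x) \<le> C"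
  shows "set_integrable M S (\<lambda>x. E x * u x)"
proof -
  have [measurable]: "(\<lambda>x. indicator S x *\<^sub>R E x) \<in> borel_measurable M"
    using E unfolding set_integrable_def by (rule borel_measurable_integrable)
  have "integrable M (\<lambda>x. (indicator S x *\<^sub>R E x) * u x)"
  proof (rule Bochner_Integration.integrable_bound)
    show "integrable M (\<lambda>x. C *\<^sub>R (indicator S x *\<^sub>R E x))"
      using E unfolding set_integrable_def by (rule integrable_scaleR_right)
    show "AE x in M. norm ((indicator S x *\<^sub>R E x) * u x) \<le> norm (C *\<^sub>R (indicator S x *\<^sub>R E x))"
    proof (rule AE_I2)
      fix x
      have "norm (E x) * norm (u x) \<le> \<bar>C\<bar> * norm (E x)" if "x \<in> S"
        using mult_left_mono[OF u(2)[OF that], of "norm (E x)"] mult_right_mono[OF abs_ge_self[of C], of "norm (E x)"]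
        by (simp add: mult.commute)
      then show "norm ((indicator S x *\<^sub>R E x) * u x) \<le> norm (C *\<^sub>R (indicator S x *\<^sub>R E x))"
        by (auto simp: norm_mult indicator_def)
    qed
  qed (use u in measurable)
  then show ?thesis by (simp add: set_integrable_def)
qed

lemma spectrum_integrable:
  assumes "spectrum a F"
  shows "set_integrable lborel {0..<1} (\<lambda>f. complex_of_real (F f))"
proof -
  have "integrable lborel (\<lambda>f. complex_of_real (indicator {0..<1} f *\<^sub>R F f))"
    using assms unfolding spectrum_def set_integrable_def by (intro integrable_of_real) auto
  then show ?thesis by (simp add: set_integrable_def scaleR_conv_of_real)
qed

text \<open>\<open>F\<close> is real, so conjugating the integral replaces \<open>m\<close> by
  \<open>- m\<close>; \<open>a\<close> is real and hence unchanged by conjugation.\<close>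

lemma spectrum_even:
  assumes "spectrum a F"
  shows "a (- m) = a m"
proof -
  have "complex_of_real (a (- m)) = (LINT f:{0..<1}|lborel. of_real (F f) * cis (2 * pi * f * of_int (- m)))"
    using assms unfolding spectrum_def by blast
  also have "\<dots> = (LINT f|lborel. cnj (indicator {0..<1} f *\<^sub>R (of_real (F f) * cis (2 * pi * f * of_int m))))"
    unfolding set_lebesgue_integral_def by (intro Bochner_Integration.integral_cong refl) (simp add: cis_cnj)
  also have "\<dots> = cnj (of_real (a m))"
    using assms unfolding spectrum_def set_lebesgue_integral_def by (simp only: Bochner_Integration.integral_cnj)
  finally show ?thesis by simp
qed

lemma cnj_sum_cis:
  "(\<Sum>p\<in>J. w p * cis (t * real p)) * cnj (\<Sum>p\<in>J. w p * cis (t * real p)) =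
   (\<Sum>p\<in>J. \<Sum>q\<in>J. w p * cnj (w q) * cis (t * of_int (int p - int q)))"
proof -
  have "cis (t * real p) * cis (- (t * real q)) = cis (t * of_int (int p - int q))" for p q
    by (simp add: cis_mult algebra_simps)
  then have "w p * cis (t * real p) * (cnj (w q) * cis (- (t * real q))) = w p * cnj (w q) * cis (t * of_int (int p - int q))" for p q
    by (simp add: mult_ac)
  moreover have "cnj (\<Sum>p\<in>J. w p * cis (t * real p)) = (\<Sum>q\<in>J. cnj (w q) * cis (- (t * real q)))"
    by (simp add: cis_cnj)
  ultimately show ?thesis by (simp only: sum_product)
qed

text \<open>Expanding the squared modulus of the trigonometric polynomial gives one exponential for
  each lag \<open>p - q\<close>, and its integral against \<open>F\<close> is the coefficient at
  that lag.\<close>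

lemma toeplitz_form:
  fixes w :: "nat \<Rightarrow> complex"
  assumes sp: "spectrum a F" and J: "finite J"
  shows "(\<Sum>p\<in>J. \<Sum>q\<in>J. of_real (a (int p - int q)) * (w p * cnj (w q))) =
      of_real (LINT f:{0..<1}|lborel. F f * (cmod (\<Sum>p\<in>J. w p * cis (2 * pi * f * real p)))\<^sup>2)" (is ?eq)
    and "set_integrable lborel {0..<1} (\<lambda>f. F f * (cmod (\<Sum>p\<in>J. w p * cis (2 * pi * f * real p)))\<^sup>2)" (is ?int)
proof -
  let ?S = "\<lambda>f. \<Sum>p\<in>J. w p * cis (2 * pi * f * real p)"
  let ?e = "\<lambda>p q f. complex_of_real (F f) * (w p * cnj (w q) * cis (2 * pi * f * of_int (int p - int q)))"
  have int: "set_integrable lborel {0..<1} (?e p q)" for p q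
    by (rule set_integrable_mult_bounded[OF spectrum_integrable[OF sp], where C="cmod (w p) * cmod (w q)"])
      (auto simp: norm_mult)
  have S: "complex_of_real (F f * (cmod (?S f))\<^sup>2) = (\<Sum>p\<in>J. \<Sum>q\<in>J. ?e p q f)" for f
    using cnj_sum_cis[where w=w and J=J and t="2 * pi * f"]
    by (simp only: of_real_mult complex_norm_square sum_distrib_left)
  have intS: "set_integrable lborel {0..<1} (\<lambda>f. complex_of_real (F f * (cmod (?S f))\<^sup>2))"
    using int unfolding S set_integrable_def scaleR_sum_right
    by (intro Bochner_Integration.integrable_sum)
  have "integrable lborel (\<lambda>f. Re (indicator {0..<1} f *\<^sub>R complex_of_real (F f * (cmod (?S f))\<^sup>2)))"
    using intS unfolding set_integrable_def by (rule integrable_Re)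
  then show ?int unfolding set_integrable_def by simp
  have "(LINT f:{0..<1}|lborel. complex_of_real (F f * (cmod (?S f))\<^sup>2)) =
     (\<Sum>p\<in>J. \<Sum>q\<in>J. LINT f:{0..<1}|lborel. ?e p q f)"
    unfolding S using int unfolding set_integrable_def set_lebesgue_integral_def scaleR_sum_right
    by (simp add: Bochner_Integration.integral_sum Bochner_Integration.integrable_sum)
  also have "\<dots> = (\<Sum>p\<in>J. \<Sum>q\<in>J. of_real (a (int p - int q)) * (w p * cnj (w q)))"
  proof (intro sum.cong refl)
    fix p q
    have "(LINT f:{0..<1}|lborel. ?e p q f) =
       (LINT f:{0..<1}|lborel. of_real (F f) * cis (2 * pi * f * of_int (int p - int q)) * (w p * cnj (w q)))"
      by (simp add: mult_ac)
    also have "\<dots> = of_real (a (int p - int q)) * (w p * cnj (w q))"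
      using sp unfolding spectrum_def by simp
    finally show "(LINT f:{0..<1}|lborel. ?e p q f) = \<dots>" .
  qed
  also have "(LINT f:{0..<1}|lborel. complex_of_real (F f * (cmod (?S f))\<^sup>2)) = of_real (LINT f:{0..<1}|lborel. F f * (cmod (?S f))\<^sup>2)"
    unfolding set_lebesgue_integral_def by (subst integral_complex_of_real[symmetric]) (simp add: scaleR_conv_of_real)
  finally show ?eq by simp
qed

lemma spectrum_delta: "spectrum (\<lambda>m. if m = 0 then v else 0) (\<lambda>_. v)"
proof -
  have "(LINT f:{0..<1}|lborel. complex_of_real v * cis (2 * pi * f * of_int m)) = (if m = 0 then of_real v else 0)" for m
    using integral_cis_int(2)[of m] by simp
  moreover have "set_integrable lborel {0..<1::real} (\<lambda>_. v)"
    unfolding set_integrable_def by (intro integrable_scaleR_left) simp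
  ultimately show ?thesis unfolding spectrum_def by auto
qed

text \<open>Bounds on \<open>F\<close> pass through the integral representation to the form. For the
  upper one, \<open>F\<close> is compared with the constant \<open>C\<close>, the spectrum of
  \<open>C\<close> times the unit impulse, whose form is \<open>C\<close> times the squared
  norm.\<close>

lemma toeplitz_form_bounds:
  fixes w :: "nat \<Rightarrow> complex"
  assumes sp: "spectrum a F" and J: "finite J"
  shows "(\<And>f. f \<in> {0..<1} \<Longrightarrow> F f \<le> C) \<Longrightarrow>
      Re (\<Sum>p\<in>J. \<Sum>q\<in>J. of_real (a (int p - int q)) * (w p * cnj (w q))) \<le> C * (\<Sum>p\<in>J. (cmod (w p))\<^sup>2)"
    and "(\<And>f. f \<in> {0..<1} \<Longrightarrow> 0 \<le> F f) \<Longrightarrow>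
      0 \<le> Re (\<Sum>p\<in>J. \<Sum>q\<in>J. of_real (a (int p - int q)) * (w p * cnj (w q)))"
proof -
  let ?S = "\<lambda>f. \<Sum>p\<in>J. w p * cis (2 * pi * f * real p)"
  have eq: "Re (\<Sum>p\<in>J. \<Sum>q\<in>J. of_real (a (int p - int q)) * (w p * cnj (w q))) =
     (LINT f:{0..<1}|lborel. F f * (cmod (?S f))\<^sup>2)"
    unfolding toeplitz_form(1)[OF sp J] by simp
  show "0 \<le> Re (\<Sum>p\<in>J. \<Sum>q\<in>J. of_real (a (int p - int q)) * (w p * cnj (w q)))"
    if "\<And>f. f \<in> {0..<1} \<Longrightarrow> 0 \<le> F f"
    unfolding eq set_lebesgue_integral_def using that
    by (intro Bochner_Integration.integral_nonneg) (simp add: indicator_def)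
  assume le: "\<And>f. f \<in> {0..<1} \<Longrightarrow> F f \<le> C"
  have "(LINT f:{0..<1}|lborel. F f * (cmod (?S f))\<^sup>2) \<le> (LINT f:{0..<1}|lborel. C * (cmod (?S f))\<^sup>2)"
    by (rule set_integral_mono[OF toeplitz_form(2)[OF sp J] toeplitz_form(2)[OF spectrum_delta J]])
      (auto intro!: mult_right_mono le)
  also have "\<dots> = Re (\<Sum>p\<in>J. \<Sum>q\<in>J. of_real (if int p - int q = 0 then C else 0) * (w p * cnj (w q)))"
    using toeplitz_form(1)[OF spectrum_delta[of C] J, of w] by simp
  also have "(\<Sum>p\<in>J. \<Sum>q\<in>J. of_real (if int p - int q = 0 then C else 0) * (w p * cnj (w q))) =
      (\<Sum>p\<in>J. \<Sum>q\<in>J. if q = p then of_real C * (w p * cnj (w q)) else 0)"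
    by (intro sum.cong refl) auto
  also have "\<dots> = of_real (C * (\<Sum>p\<in>J. (cmod (w p))\<^sup>2))"
    using J by (simp add: complex_norm_square[symmetric] sum_distrib_left)
  finally show "Re (\<Sum>p\<in>J. \<Sum>q\<in>J. of_real (a (int p - int q)) * (w p * cnj (w q))) \<le> C * (\<Sum>p\<in>J. (cmod (w p))\<^sup>2)"
    unfolding eq by simp
qed

section \<open>Integrable functions with vanishing Fourier coefficients\<close>

definition null_coeffs :: "(real \<Rightarrow> complex) \<Rightarrow> bool" where
  "null_coeffs E \<longleftrightarrow> set_integrable lborel {0..<1} E \<and>
     (\<forall>n::int. (LINT f:{0..<1}|lborel. E f * cis (2 * pi * f * of_int n)) = 0)"

lemma null_coeffs_integrable:
  "null_coeffs E \<Longrightarrow> set_integrable lborel {0..<1} (\<lambda>f. E f * cis (2 * pi * f * of_int n))"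
  unfolding null_coeffs_def by (rule set_integrable_mult_bounded[where C=1]) auto

lemma null_coeffs_cis: "null_coeffs E \<Longrightarrow> null_coeffs (\<lambda>f. E f * cis (2 * pi * f * of_int k))"
  unfolding null_coeffs_def
proof (elim conjE, intro conjI allI)
  fix n :: int
  assume E: "\<forall>n::int. (LINT f:{0..<1}|lborel. E f * cis (2 * pi * f * of_int n)) = 0"
  have "cis (2 * pi * f * of_int k) * cis (2 * pi * f * of_int n) = cis (2 * pi * f * of_int (k + n))" for f
    by (simp add: cis_mult algebra_simps)
  then have "E f * cis (2 * pi * f * of_int k) * cis (2 * pi * f * of_int n) = E f * cis (2 * pi * f * of_int (k + n))" for f
    by (simp only: mult.assoc[of "E f"])
  then show "(LINT f:{0..<1}|lborel. E f * cis (2 * pi * f * of_int k) * cis (2 * pi * f * of_int n)) = 0"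
    by (simp only: E)
qed (auto intro!: set_integrable_mult_bounded[where C=1])

lemma null_coeffs_add:
  assumes "null_coeffs E" "null_coeffs E'"
  shows "null_coeffs (\<lambda>f. E f + E' f)"
  using assms null_coeffs_integrable[OF assms(1)] null_coeffs_integrable[OF assms(2)]
  unfolding null_coeffs_def by (simp add: distrib_right set_integral_add)

lemma null_coeffs_scale: "null_coeffs E \<Longrightarrow> null_coeffs (\<lambda>f. E f * c)"
  unfolding null_coeffs_def
proof (elim conjE, intro conjI allI)
  fix n :: int
  assume E: "\<forall>n::int. (LINT f:{0..<1}|lborel. E f * cis (2 * pi * f * of_int n)) = 0"
  have "(LINT f:{0..<1}|lborel. E f * c * cis (2 * pi * f * of_int n)) =
     (LINT f:{0..<1}|lborel. E f * cis (2 * pi * f * of_int n) * c)" by (simp add: mult_ac)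
  then show "(LINT f:{0..<1}|lborel. E f * c * cis (2 * pi * f * of_int n)) = 0"
    using E by simp
qed auto

text \<open>A product of polynomials is handled by absorbing the first factor into \<open>E\<close>,
  hence the induction over arbitrary \<open>E\<close>. In the base case \<open>E\<close> is
  multiplied by characters, which only shifts its coefficients; this is why
  \<open>null_coeffs\<close> is about complex functions.\<close>

lemma null_coeffs_polynomial:
  assumes "real_polynomial_function p" "null_coeffs E"
  shows "null_coeffs (\<lambda>f. E f * of_real (p (cis (2 * pi * f))))"
  using assms
proof (induction p arbitrary: E)
  case (linear p)
  interpret bounded_linear p by fact
  have lin: "p z = Re z * p 1 + Im z * p \<i>" for z
  proof -
    have "z = Re z *\<^sub>R 1 + Im z *\<^sub>R \<i>" by (simp add: complex_eq_iff)
    then have "p z = p (Re z *\<^sub>R 1 + Im z *\<^sub>R \<i>)" by simp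
    then show ?thesis by (simp add: add scaleR)
  qed
  \<comment> \<open>Real linearity gives \<open>p (cis t) = p 1 * cos t + p \<i> * sin t\<close>;
    Euler's formulas turn this into a combination of \<open>cis t\<close> and
    \<open>cis (- t)\<close>.\<close>
  have "of_real (p (cis t)) = cis t * (Complex (p 1) (- p \<i>) / 2) + cis (- t) * (Complex (p 1) (p \<i>) / 2)" for t
    unfolding lin[of "cis t"] by (simp add: complex_eq_iff field_simps)
  then have "(\<lambda>f. E f * of_real (p (cis (2 * pi * f)))) =
     (\<lambda>f. E f * cis (2 * pi * f * of_int 1) * (Complex (p 1) (- p \<i>) / 2) +
        E f * cis (2 * pi * f * of_int (- 1)) * (Complex (p 1) (p \<i>) / 2))"
    by (simp add: distrib_left mult.assoc)
  then show ?case
    by (simp only:) (intro null_coeffs_add null_coeffs_scale null_coeffs_cis linear.prems)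
next
  case (const c)
  then show ?case by (rule null_coeffs_scale)
next
  case (add p q)
  then show ?case using null_coeffs_add[OF add.IH(1)[of E] add.IH(2)[of E]] by (simp add: distrib_left)
next
  case (mult p q)
  then show ?case using mult.IH(2)[OF mult.IH(1)[of E]] by (simp add: mult.assoc)
qed

text \<open>Stone-Weierstrass on the unit circle: a polynomial within \<open>e\<close> of
  \<open>\<psi>\<close> contributes nothing, and the remainder contributes at most \<open>e\<close>
  times the integral of \<open>norm (E f)\<close>.\<close>

lemma null_coeffs_continuous:
  assumes E: "null_coeffs E" and \<psi>: "continuous_on UNIV \<psi>"
  shows "(LINT f:{0..<1}|lborel. E f * of_real (\<psi> (cis (2 * pi * f)))) = 0"
proof -
  let ?I = "\<lambda>\<psi>. LINT f:{0..<1}|lborel. E f * of_real (\<psi> (cis (2 * pi * f)))"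
  let ?C = "LINT f:{0..<1}|lborel. norm (E f)"
  have E': "set_integrable lborel {0..<1} E" using E by (simp add: null_coeffs_def)
  have "norm (?I \<psi>) \<le> e * ?C" if "0 < e" for e
  proof -
    obtain p where p: "real_polynomial_function p" "\<And>z. z \<in> sphere 0 1 \<Longrightarrow> \<bar>\<psi> z - p z\<bar> < e"
      using Stone_Weierstrass_real_polynomial_function[OF compact_sphere continuous_on_subset[OF \<psi>] \<open>0 < e\<close>, of 0 1]
      by auto
    have p0: "?I p = 0"
      using null_coeffs_polynomial[OF p(1) E] unfolding null_coeffs_def by (auto dest: spec[of _ 0])
    have [measurable]: "\<psi> \<in> borel_measurable borel" "p \<in> borel_measurable borel"
      using \<psi> continuous_real_polymonial_function[OF p(1)]
      by (auto intro!: borel_measurable_continuous_onI continuous_at_imp_continuous_on)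
    have bd: "norm (complex_of_real (\<psi> (cis t) - p (cis t))) \<le> e" for t
      using p(2)[of "cis t"] by (simp del: of_real_diff)
    have int: "set_integrable lborel {0..<1} (\<lambda>f. E f * of_real (\<psi> (cis (2 * pi * f)) - p (cis (2 * pi * f))))"
      by (rule set_integrable_mult_bounded[OF E' _ bd]) simp
    have intp: "set_integrable lborel {0..<1} (\<lambda>f. E f * of_real (p (cis (2 * pi * f))))"
      using null_coeffs_polynomial[OF p(1) E] by (simp add: null_coeffs_def)
    have "?I \<psi> = (LINT f:{0..<1}|lborel. E f * of_real (\<psi> (cis (2 * pi * f)) - p (cis (2 * pi * f))) + E f * of_real (p (cis (2 * pi * f))))"
      by (simp add: algebra_simps)
    also have "\<dots> = (LINT f:{0..<1}|lborel. E f * of_real (\<psi> (cis (2 * pi * f)) - p (cis (2 * pi * f))))"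
      using p0 by (simp only: set_integral_add(2)[OF int intp]) simp
    finally have "norm (?I \<psi>) \<le> (LINT f:{0..<1}|lborel. norm (E f * of_real (\<psi> (cis (2 * pi * f)) - p (cis (2 * pi * f)))))"
      by (simp only: set_integral_norm_bound[OF int])
    also have "\<dots> \<le> (LINT f:{0..<1}|lborel. e * norm (E f))"
    proof (rule set_integral_mono)
      show "set_integrable lborel {0..<1} (\<lambda>f. e * norm (E f))"
        using set_integrable_norm[OF E'] by (rule set_integrable_mult_right)
      show "norm (E f * of_real (\<psi> (cis (2 * pi * f)) - p (cis (2 * pi * f)))) \<le> e * norm (E f)" for f
        using mult_left_mono[OF bd[of "2 * pi * f"], of "norm (E f)"] by (simp add: norm_mult mult.commute)
    qed (rule set_integrable_norm[OF int])
    finally show ?thesis by simp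
  qed
  then have "norm (?I \<psi>) \<le> 0 + e" if "0 < e" for e
  proof -
    have "?C \<ge> 0" unfolding set_lebesgue_integral_def by (intro Bochner_Integration.integral_nonneg) (simp add: indicator_def)
    then have "e / (?C + 1) * ?C \<le> e" "0 < e / (?C + 1)" using that by (simp_all add: field_simps)
    then show ?thesis using \<open>\<And>e. 0 < e \<Longrightarrow> norm (?I \<psi>) \<le> e * ?C\<close>[of "e / (?C + 1)"] by linarith
  qed
  then have "norm (?I \<psi>) \<le> 0" by (rule field_le_epsilon) 
  then show ?thesis by simp
qed

lemma cis_2pi_inj:
  assumes "cis (2 * pi * f) = cis (2 * pi * f')" "f \<in> {0..<1}" "f' \<in> {0..<1}"
  shows "f = f'"
proof -
  have A: "Arg2pi (cis (2 * pi * t)) = 2 * pi * t" if "t \<in> {0..<1}" for t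
    by (rule Arg2pi_unique[of 1]) (use that in \<open>auto simp: cis_conv_exp\<close>)
  have "2 * pi * f = 2 * pi * f'" by (metis A assms)
  then show ?thesis by simp
qed

text \<open>The indicator of a closed arc \<open>K\<close> is the limit of continuous cutoffs in the
  distance to \<open>K\<close>, so dominated convergence applies. Injectivity of the circle map on
  [0,1) identifies the limit with the indicator of \<open>{0..x}\<close>.\<close>

lemma null_coeffs_initial:
  assumes E: "null_coeffs E" and x: "0 \<le> x" "x < 1"
  shows "(LINT f:{0..x}|lborel. E f) = 0"
proof -
  define K where "K = (\<lambda>f. cis (2 * pi * f)) ` {0..x}"
  have "closed K" "K \<noteq> {}" unfolding K_def
    using x by (auto intro!: compact_imp_closed compact_continuous_image continuous_intros)
  define \<psi> where "\<psi> = (\<lambda>n z. max 0 (1 - real n * infdist z K))"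
  have \<psi>_cont: "continuous_on UNIV (\<psi> n)" for n
    unfolding \<psi>_def by (intro continuous_intros)
  have [measurable]: "\<psi> n \<in> borel_measurable borel" for n
    by (rule borel_measurable_continuous_onI[OF \<psi>_cont])
  have \<psi>_bd: "norm (complex_of_real (\<psi> n z)) \<le> 1" for n z
    using infdist_nonneg[of z K] by (auto simp: \<psi>_def)
  have int: "integrable lborel (\<lambda>f. indicator {0..<1} f *\<^sub>R E f)"
    using E by (simp add: null_coeffs_def set_integrable_def)
  note [measurable] = borel_measurable_integrable[OF int]
  have lim: "(\<lambda>n. (indicator {0..<1} f *\<^sub>R E f) * of_real (\<psi> n (cis (2 * pi * f)))) \<longlonglongrightarrow> indicator {0..x} f *\<^sub>R E f" for f
  proof (cases "f \<in> {0..<1}")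
    case True
    have iff: "cis (2 * pi * f) \<in> K \<longleftrightarrow> f \<in> {0..x}"
      using cis_2pi_inj[OF _ True] x by (force simp: K_def)
    show ?thesis
    proof (cases "f \<in> {0..x}")
      case True
      then have "infdist (cis (2 * pi * f)) K = 0"
        using iff \<open>closed K\<close> \<open>K \<noteq> {}\<close> by (simp add: in_closed_iff_infdist_zero)
      then show ?thesis using True x by (simp add: \<psi>_def)
    next
      case False
      let ?\<delta> = "infdist (cis (2 * pi * f)) K"
      have "?\<delta> > 0"
        using iff \<open>closed K\<close> \<open>K \<noteq> {}\<close> False infdist_pos_not_in_closed by blast
      then obtain n0 where n0: "1 < real n0 * ?\<delta>" using reals_Archimedean3 by blast
      have "eventually (\<lambda>n. \<psi> n (cis (2 * pi * f)) = 0) sequentially"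
        using eventually_ge_at_top[of n0]
      proof eventually_elim
        case (elim n)
        then have "real n0 * ?\<delta> \<le> real n * ?\<delta>" by (intro mult_right_mono infdist_nonneg) auto
        then show ?case using n0 by (simp add: \<psi>_def)
      qed
      then have "eventually (\<lambda>n. (indicator {0..<1} f *\<^sub>R E f) * of_real (\<psi> n (cis (2 * pi * f))) = 0) sequentially"
        by (rule eventually_mono) simp
      then show ?thesis using False by (simp add: tendsto_eventually)
    qed
  next
    case False
    then have "f \<notin> {0..x}" using x by auto
    then show ?thesis using False by simp
  qed
  have "(\<lambda>n. LINT f|lborel. (indicator {0..<1} f *\<^sub>R E f) * of_real (\<psi> n (cis (2 * pi * f)))) \<longlonglongrightarrow>
     (LINT f|lborel. indicator {0..x} f *\<^sub>R E f)"
  proof (rule integral_dominated_convergence[where w="\<lambda>f. norm (indicator {0..<1} f *\<^sub>R E f)"])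
    show "(\<lambda>f. indicator {0..x} f *\<^sub>R E f) \<in> borel_measurable lborel"
      by (rule borel_measurable_LIMSEQ_metric[OF _ lim]) measurable
    show "integrable lborel (\<lambda>f. norm (indicator {0..<1} f *\<^sub>R E f))" by (rule integrable_norm[OF int])
    show "AE f in lborel. (\<lambda>n. (indicator {0..<1} f *\<^sub>R E f) * of_real (\<psi> n (cis (2 * pi * f)))) \<longlonglongrightarrow> indicator {0..x} f *\<^sub>R E f"
      using lim by simp
    show "AE f in lborel. norm ((indicator {0..<1} f *\<^sub>R E f) * of_real (\<psi> n (cis (2 * pi * f)))) \<le> norm (indicator {0..<1} f *\<^sub>R E f)" for n
    proof (rule AE_I2)
      fix f
      show "norm ((indicator {0..<1} f *\<^sub>R E f) * of_real (\<psi> n (cis (2 * pi * f)))) \<le> norm (indicator {0..<1} f *\<^sub>R E f)"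
        using mult_left_mono[OF \<psi>_bd, of "norm (indicator {0..<1} f *\<^sub>R E f)"] by (simp only: norm_mult mult_1_right norm_ge_zero)
    qed
  qed measurable
  moreover have "(LINT f|lborel. (indicator {0..<1} f *\<^sub>R E f) * of_real (\<psi> n (cis (2 * pi * f)))) = 0" for n
    using null_coeffs_continuous[OF E \<psi>_cont] by (simp add: set_lebesgue_integral_def)
  ultimately show ?thesis
    unfolding set_lebesgue_integral_def by (simp add: LIMSEQ_const_iff)
qed

section \<open>Standard Gaussian vectors\<close>

lemma nn_integral_std_normal:
  assumes [measurable]: "f \<in> borel_measurable borel"
  shows "(\<integral>\<^sup>+x. f x \<partial>std_normal_distribution) = (\<integral>\<^sup>+x. ennreal (std_normal_density x) * f x \<partial>lborel)"
  by (subst nn_integral_density) auto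

lemma nn_integral_normal_density:
  assumes "0 < \<sigma>"
  shows "(\<integral>\<^sup>+x. ennreal (normal_density \<mu> \<sigma> x) \<partial>lborel) = 1"
  using assms by (subst nn_integral_eq_integral) (auto simp: integral_normal_density)

lemma std_normal_exp_linear:
  "(\<integral>\<^sup>+x. ennreal (exp (t * x)) \<partial>std_normal_distribution) = ennreal (exp (t\<^sup>2 / 2))"
proof -
  have *: "std_normal_density x * exp (t * x) = exp (t\<^sup>2 / 2) * normal_density t 1 x" for x
    unfolding normal_density_def
    by (simp add: exp_add[symmetric] field_simps power2_eq_square)
  show ?thesis
    by (simp add: nn_integral_std_normal ennreal_mult'[symmetric] *)
       (simp add: ennreal_mult' nn_integral_cmult nn_integral_normal_density)
qed

text \<open>The exponential tilts the standard density into a multiple of the normal density with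
  variance \<open>1 / (1 - x)\<close>.\<close>

lemma std_normal_exp_square:
  assumes "x < 1"
  shows "(\<integral>\<^sup>+y. ennreal (exp (x / 2 * y\<^sup>2)) \<partial>std_normal_distribution) = ennreal (1 / sqrt (1 - x))"
proof -
  have *: "std_normal_density y * exp (x / 2 * y\<^sup>2) =
      1 / sqrt (1 - x) * normal_density 0 (1 / sqrt (1 - x)) y" for y
    using assms unfolding normal_density_def
    by (simp add: exp_add[symmetric] field_simps power2_eq_square real_sqrt_mult real_sqrt_divide)
  have "(\<integral>\<^sup>+y. ennreal (exp (x / 2 * y\<^sup>2)) \<partial>std_normal_distribution) =
      (\<integral>\<^sup>+y. ennreal (1 / sqrt (1 - x) * normal_density 0 (1 / sqrt (1 - x)) y) \<partial>lborel)"
    by (subst nn_integral_std_normal) (simp_all only: ennreal_mult'[symmetric] * normal_density_nonneg, measurable)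
  also have "\<dots> = ennreal (1 / sqrt (1 - x))"
    using assms by (simp add: ennreal_mult' nn_integral_cmult nn_integral_normal_density del: times_divide_eq_left)
  finally show ?thesis .
qed

text \<open>The rotation is split into two one-dimensional substitutions,
  \<open>a = b + sqrt 2 * p\<close> for fixed \<open>b\<close> and then, after exchanging the
  integrals, \<open>b = (q - p) / sqrt 2\<close> for fixed \<open>p\<close>. Their Jacobians cancel,
  and the joint density depends only on the preserved sum of squares.\<close>

lemma std_normal_rotation:
  "distr (std_normal_distribution \<Otimes>\<^sub>M std_normal_distribution)
     (std_normal_distribution \<Otimes>\<^sub>M std_normal_distribution)
     (\<lambda>p. ((fst p - snd p) / sqrt 2, (fst p + snd p) / sqrt 2)) =
   std_normal_distribution \<Otimes>\<^sub>M std_normal_distribution"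
    (is "distr ?D ?D ?\<rho> = ?D")
proof (rule measure_eqI)
  interpret real_distribution std_normal_distribution by (rule real_dist_normal_dist)
  fix S assume "S \<in> sets (distr ?D ?D ?\<rho>)"
  then have S[measurable]: "S \<in> sets (borel \<Otimes>\<^sub>M borel)" by (simp cong: sets_pair_measure_cong)
  define \<phi> where "\<phi> = (\<lambda>x. ennreal (std_normal_density x))"
  have [measurable]: "\<phi> \<in> borel_measurable borel" unfolding \<phi>_def by measurable
  have meas: "?\<rho> \<in> measurable ?D ?D" by measurable
  have D: "(\<integral>\<^sup>+p. h p \<partial>?D) = (\<integral>\<^sup>+b. \<phi> b * (\<integral>\<^sup>+a. \<phi> a * h (a, b) \<partial>lborel) \<partial>lborel)"
    if [measurable]: "h \<in> borel_measurable (borel \<Otimes>\<^sub>M borel)" for h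
  proof -
    interpret pair_sigma_finite std_normal_distribution std_normal_distribution
      by unfold_locales
    have h': "h \<in> borel_measurable ?D" by simp
    have "(\<integral>\<^sup>+p. h p \<partial>?D) = (\<integral>\<^sup>+b. \<integral>\<^sup>+a. h (a, b) \<partial>std_normal_distribution \<partial>std_normal_distribution)"
      using nn_integral_snd[OF h'] by simp
    also have "\<dots> = (\<integral>\<^sup>+b. \<phi> b * (\<integral>\<^sup>+a. \<phi> a * h (a, b) \<partial>lborel) \<partial>lborel)"
      by (subst nn_integral_std_normal) (auto simp: nn_integral_std_normal \<phi>_def)
    finally show ?thesis .
  qed
  define I where "I = (indicator S :: real \<times> real \<Rightarrow> ennreal)"
  have [measurable]: "I \<in> borel_measurable (borel \<Otimes>\<^sub>M borel)" unfolding I_def by measurable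
  have \<phi>\<phi>: "\<phi> (sqrt 2 * p + (q - p) / sqrt 2) * \<phi> ((q - p) / sqrt 2) = \<phi> p * \<phi> q" for p q
  proof -
    have e: "sqrt 2 * p + (q - p) / sqrt 2 = (q + p) / sqrt 2"
      by (simp add: field_simps)
    have "((q + p) / sqrt 2)\<^sup>2 + ((q - p) / sqrt 2)\<^sup>2 = p\<^sup>2 + q\<^sup>2"
      by (simp add: power_divide power2_eq_square field_simps)
    then have "exp (- ((q + p) / sqrt 2)\<^sup>2 / 2) * exp (- ((q - p) / sqrt 2)\<^sup>2 / 2) =
       exp (- p\<^sup>2 / 2) * exp (- q\<^sup>2 / 2)"
      unfolding exp_add[symmetric] by (simp add: field_simps)
    then show ?thesis
      unfolding e \<phi>_def normal_density_def by (simp add: ennreal_mult'[symmetric])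
  qed
  have s2: "ennreal (1 / sqrt 2) * ennreal (sqrt 2) = 1"
    by (simp add: ennreal_mult'[symmetric])
  have "emeasure (distr ?D ?D ?\<rho>) S = (\<integral>\<^sup>+p. I (?\<rho> p) \<partial>?D)"
    using nn_integral_distr[OF meas, of I] by (simp add: I_def)
  also have "\<dots> = (\<integral>\<^sup>+b. \<phi> b * (\<integral>\<^sup>+a. \<phi> a * I (?\<rho> (a, b)) \<partial>lborel) \<partial>lborel)"
    by (subst D) auto
  also have "\<dots> = (\<integral>\<^sup>+b. \<phi> b * (ennreal (sqrt 2) * (\<integral>\<^sup>+p. \<phi> (b + sqrt 2 * p) * I (p, p + sqrt 2 * b) \<partial>lborel)) \<partial>lborel)"
  proof -
    have "(\<integral>\<^sup>+a. \<phi> a * I (?\<rho> (a, b)) \<partial>lborel) =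
      ennreal (sqrt 2) * (\<integral>\<^sup>+p. \<phi> (b + sqrt 2 * p) * I (p, p + sqrt 2 * b) \<partial>lborel)" for b
    proof -
      have "p + 2 * b / sqrt 2 = p + sqrt 2 * b" for p
        by (simp add: field_simps)
      then show ?thesis
      by (subst nn_integral_real_affine[of _ "sqrt 2" b]) (auto simp: add_divide_distrib add.commute)
    qed
    then show ?thesis by simp
  qed
  also have "\<dots> = (\<integral>\<^sup>+b. \<integral>\<^sup>+p. ennreal (sqrt 2) * (\<phi> (b + sqrt 2 * p) * \<phi> b * I (p, p + sqrt 2 * b)) \<partial>lborel \<partial>lborel)"
    by (simp add: nn_integral_cmult[symmetric] mult_ac)
  also have "\<dots> = (\<integral>\<^sup>+p. \<integral>\<^sup>+b. ennreal (sqrt 2) * (\<phi> (b + sqrt 2 * p) * \<phi> b * I (p, p + sqrt 2 * b)) \<partial>lborel \<partial>lborel)"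
    by (rule lborel_pair.Fubini') simp
  also have "\<dots> = (\<integral>\<^sup>+p. \<integral>\<^sup>+q. \<phi> p * \<phi> q * I (p, q) \<partial>lborel \<partial>lborel)"
  proof (rule nn_integral_cong)
    fix p
    have b: "p + sqrt 2 * (- p / sqrt 2 + 1 / sqrt 2 * q) = q" for q
      by (simp add: field_simps)
    have b': "- p / sqrt 2 + 1 / sqrt 2 * q = (q - p) / sqrt 2" for q
      by (simp add: field_simps)
    have "(\<integral>\<^sup>+b. ennreal (sqrt 2) * (\<phi> (b + sqrt 2 * p) * \<phi> b * I (p, p + sqrt 2 * b)) \<partial>lborel) =
      ennreal (1 / sqrt 2) * (\<integral>\<^sup>+q. ennreal (sqrt 2) * (\<phi> (sqrt 2 * p + (q - p) / sqrt 2) * \<phi> ((q - p) / sqrt 2) * I (p, q)) \<partial>lborel)"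
      using nn_integral_real_affine[of "\<lambda>b. ennreal (sqrt 2) * (\<phi> (b + sqrt 2 * p) * \<phi> b * I (p, p + sqrt 2 * b))"
          "1 / sqrt 2" "- p / sqrt 2"]
      unfolding b b' by (simp add: add.commute del: diff_divide_distrib)
    also have "\<dots> = (\<integral>\<^sup>+q. \<phi> p * \<phi> q * I (p, q) \<partial>lborel)"
      unfolding \<phi>\<phi> by (subst nn_integral_cmult[symmetric]) (auto simp: mult.assoc[symmetric] s2)
    finally show "(\<integral>\<^sup>+b. ennreal (sqrt 2) * (\<phi> (b + sqrt 2 * p) * \<phi> b * I (p, p + sqrt 2 * b)) \<partial>lborel) = \<dots>" .
  qed
  also have "\<dots> = (\<integral>\<^sup>+q. \<integral>\<^sup>+p. \<phi> p * \<phi> q * I (p, q) \<partial>lborel \<partial>lborel)"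
    by (rule lborel_pair.Fubini') simp
  also have "\<dots> = (\<integral>\<^sup>+p. I p \<partial>?D)"
    by (subst D) (auto simp: nn_integral_cmult[symmetric] mult_ac)
  also have "\<dots> = emeasure ?D S" by (simp add: I_def)
  finally show "emeasure (distr ?D ?D ?\<rho>) S = emeasure ?D S" .
qed simp

definition bilin :: "nat \<Rightarrow> (nat \<Rightarrow> nat \<Rightarrow> real) \<Rightarrow> (nat \<Rightarrow> real) \<Rightarrow> (nat \<Rightarrow> real) \<Rightarrow> real" where
  "bilin K D x y = (\<Sum>k<K. \<Sum>l<K. D k l * x k * y l)"

definition std_normal_vec :: "nat \<Rightarrow> (nat \<Rightarrow> real) measure" where
  "std_normal_vec K = PiM {..<K} (\<lambda>_. std_normal_distribution)"

lemma prob_space_std_normal: "prob_space std_normal_distribution"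
  by (rule prob_space_normal_density) simp

lemma prob_space_std_normal_vec: "prob_space (std_normal_vec K)"
  unfolding std_normal_vec_def by (rule prob_space_PiM) (rule prob_space_std_normal)

lemma product_sigma_finite_std_normal: "product_sigma_finite (\<lambda>_::nat. std_normal_distribution)"
  by (intro product_sigma_finite.intro prob_space_imp_sigma_finite prob_space_std_normal)

lemma sets_std_normal_vec[measurable_cong]:
  "sets (std_normal_vec K) = sets (PiM {..<K} (\<lambda>_. borel))"
  unfolding std_normal_vec_def by (intro sets_PiM_cong) auto

lemma measurable_std_normal_vec_component[measurable]:
  "k < K \<Longrightarrow> (\<lambda>\<eta>. \<eta> k) \<in> borel_measurable (std_normal_vec K)"
  by (simp add: measurable_cong_sets[OF sets_std_normal_vec refl])

lemma measurable_sum_lessThan[measurable (raw)]: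
  fixes f :: "nat \<Rightarrow> 'a \<Rightarrow> real"
  assumes "\<And>k. k < K \<Longrightarrow> f k \<in> borel_measurable M"
  shows "(\<lambda>x. \<Sum>k<K. f k x) \<in> borel_measurable M"
  using assms by (intro borel_measurable_sum) auto

lemma measurable_bilin[measurable (raw)]:
  assumes "\<And>k. k < K \<Longrightarrow> (\<lambda>x. a x k) \<in> borel_measurable M"
    and "\<And>k. k < K \<Longrightarrow> (\<lambda>x. b x k) \<in> borel_measurable M"
  shows "(\<lambda>x. bilin K D (a x) (b x)) \<in> borel_measurable M"
  unfolding bilin_def using assms by measurable

lemma std_normal_vec_exp_linear:
  "(\<integral>\<^sup>+\<eta>. ennreal (exp (\<Sum>k<K. v k * \<eta> k)) \<partial>std_normal_vec K) = ennreal (exp ((\<Sum>k<K. (v k)\<^sup>2) / 2))"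
proof -
  have "(\<integral>\<^sup>+\<eta>. ennreal (exp (\<Sum>k<K. v k * \<eta> k)) \<partial>std_normal_vec K) =
      (\<integral>\<^sup>+\<eta>. (\<Prod>k<K. ennreal (exp (v k * \<eta> k))) \<partial>std_normal_vec K)"
    by (simp add: exp_sum prod_ennreal)
  also have "\<dots> = (\<Prod>k<K. \<integral>\<^sup>+x. ennreal (exp (v k * x)) \<partial>std_normal_distribution)"
    unfolding std_normal_vec_def
    by (rule product_sigma_finite.product_nn_integral_prod[OF product_sigma_finite_std_normal]) auto
  also have "\<dots> = ennreal (exp ((\<Sum>k<K. (v k)\<^sup>2) / 2))"
    by (simp add: std_normal_exp_linear exp_sum prod_ennreal sum_divide_distrib)
  finally show ?thesis .
qed

lemma std_normal_vec_exp_square: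
  assumes "x < 1"
  shows "(\<integral>\<^sup>+\<eta>. ennreal (exp (x / 2 * (\<Sum>k<K. (\<eta> k)\<^sup>2))) \<partial>std_normal_vec K) =
    ennreal ((1 / sqrt (1 - x)) ^ K)"
proof -
  have "(\<integral>\<^sup>+\<eta>. ennreal (exp (x / 2 * (\<Sum>k<K. (\<eta> k)\<^sup>2))) \<partial>std_normal_vec K) =
      (\<integral>\<^sup>+\<eta>. (\<Prod>k<K. ennreal (exp (x / 2 * (\<eta> k)\<^sup>2))) \<partial>std_normal_vec K)"
    by (simp add: sum_distrib_left exp_sum prod_ennreal)
  also have "\<dots> = (\<Prod>k<K. \<integral>\<^sup>+y. ennreal (exp (x / 2 * y\<^sup>2)) \<partial>std_normal_distribution)"
    unfolding std_normal_vec_def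
    by (rule product_sigma_finite.product_nn_integral_prod[OF product_sigma_finite_std_normal]) auto
  also have "\<dots> = ennreal ((1 / sqrt (1 - x)) ^ K)"
    using assms by (simp only: std_normal_exp_square prod_constant card_lessThan) (simp add: ennreal_power)
  finally show ?thesis .
qed

lemma std_normal_vec_cis_linear:
  "(LINT \<eta>|std_normal_vec K. cis (\<Sum>k<K. v k * \<eta> k)) = of_real (exp (- (\<Sum>k<K. (v k)\<^sup>2) / 2))"
proof -
  have c: "cis (\<Sum>k<K. v k * \<eta> k) = (\<Prod>k<K. iexp (v k * \<eta> k))" for \<eta>
    by (simp add: cis_conv_exp sum_distrib_left exp_sum)
  have "(LINT \<eta>|std_normal_vec K. cis (\<Sum>k<K. v k * \<eta> k)) = (\<Prod>k<K. char std_normal_distribution (v k))"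
    unfolding c std_normal_vec_def char_def
  proof (rule product_sigma_finite.product_integral_prod[OF product_sigma_finite_std_normal])
    interpret prob_space std_normal_distribution by (rule prob_space_std_normal)
    fix k show "integrable std_normal_distribution (\<lambda>x. iexp (v k * x))"
      by (rule integrable_const_bound[where B=1]) auto
  qed auto
  also have "\<dots> = of_real (exp (- (\<Sum>k<K. (v k)\<^sup>2) / 2))"
    by (simp only: char_std_normal_distribution of_real_prod[symmetric] exp_sum[symmetric] finite_lessThan)
       (simp add: sum_divide_distrib sum_negf)
  finally show ?thesis .
qed

text \<open>Turns a pair of independent vectors into a vector of independent pairs, so that the
  planar rotation can act coordinate by coordinate. Both measures agree on boxes, where everything
  factors.\<close>

lemma distr_pair_PiM_zip:
  fixes N1 :: "'a measure"
  assumes "prob_space N1" "finite I"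
  shows "distr (PiM I (\<lambda>_. N1) \<Otimes>\<^sub>M PiM I (\<lambda>_. N1)) (PiM I (\<lambda>_. N1 \<Otimes>\<^sub>M N1))
     (\<lambda>p. \<lambda>k\<in>I. (fst p k, snd p k)) = PiM I (\<lambda>_. N1 \<Otimes>\<^sub>M N1)"
    (is "distr (?G \<Otimes>\<^sub>M ?G) ?P ?z = ?P")
proof -
  interpret N1: prob_space N1 by fact
  interpret pair_prob_space N1 N1 ..
  interpret P: product_sigma_finite "\<lambda>_. N1 \<Otimes>\<^sub>M N1"
    ..
  interpret S: product_sigma_finite "\<lambda>_. N1" ..
  interpret G: prob_space ?G by (rule prob_space_PiM) (rule assms)
  have z: "?z \<in> measurable (?G \<Otimes>\<^sub>M ?G) ?P" by measurable
  show ?thesis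
  proof (rule P.PiM_eqI[OF \<open>finite I\<close>])
    fix A assume A: "\<And>i. i \<in> I \<Longrightarrow> A i \<in> sets (N1 \<Otimes>\<^sub>M N1)"
    have "emeasure (distr (?G \<Otimes>\<^sub>M ?G) ?P ?z) (Pi\<^sub>E I A) =
        (\<integral>\<^sup>+p. indicator (Pi\<^sub>E I A) p \<partial>distr (?G \<Otimes>\<^sub>M ?G) ?P ?z)"
      using A \<open>finite I\<close> by (subst nn_integral_indicator) (auto intro!: sets_PiM_I_finite)
    also have "\<dots> = (\<integral>\<^sup>+p. (\<Prod>k\<in>I. indicator (A k) (fst p k, snd p k)) \<partial>(?G \<Otimes>\<^sub>M ?G))"
    proof -
      have "indicator (Pi\<^sub>E I A) (?z p) = (\<Prod>k\<in>I. indicator (A k) (fst p k, snd p k) :: ennreal)" for p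
        using \<open>finite I\<close> by (auto simp: indicator_def PiE_iff prod_zero_iff split: if_splits)
      then show ?thesis
        using A \<open>finite I\<close> by (subst nn_integral_distr[OF z]) (auto intro!: sets_PiM_I_finite)
    qed
    also have "\<dots> = (\<integral>\<^sup>+a. \<integral>\<^sup>+b. (\<Prod>k\<in>I. indicator (A k) (a k, b k)) \<partial>?G \<partial>?G)"
    proof -
      have "(\<lambda>p. \<Prod>k\<in>I. indicator (A k) (fst p k, snd p k) :: ennreal) \<in> borel_measurable (?G \<Otimes>\<^sub>M ?G)"
      proof (rule borel_measurable_prod_ennreal)
        fix k assume k: "k \<in> I"
        then have "(\<lambda>p. (fst p k, snd p k)) \<in> measurable (?G \<Otimes>\<^sub>M ?G) (N1 \<Otimes>\<^sub>M N1)" by measurable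
        from measurable_compose[OF this borel_measurable_indicator[OF A[OF k]]]
        show "(\<lambda>p. indicator (A k) (fst p k, snd p k) :: ennreal) \<in> borel_measurable (?G \<Otimes>\<^sub>M ?G)" .
      qed
      from G.nn_integral_fst[OF this] show ?thesis by simp
    qed
    also have "\<dots> = (\<integral>\<^sup>+a. (\<Prod>k\<in>I. \<integral>\<^sup>+y. indicator (A k) (a k, y) \<partial>N1) \<partial>?G)"
    proof (rule nn_integral_cong)
      fix a assume a: "a \<in> space ?G"
      show "(\<integral>\<^sup>+b. (\<Prod>k\<in>I. indicator (A k) (a k, b k)) \<partial>?G) = (\<Prod>k\<in>I. \<integral>\<^sup>+y. indicator (A k) (a k, y) \<partial>N1)"
      proof (rule S.product_nn_integral_prod[OF \<open>finite I\<close>])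
        fix i assume "i \<in> I"
        then have "a i \<in> space N1" using a by (auto simp: space_PiM)
        then show "(\<lambda>y. indicator (A i) (a i, y) :: ennreal) \<in> borel_measurable N1"
          using A[OF \<open>i \<in> I\<close>] by measurable
      qed
    qed
    also have "\<dots> = (\<Prod>k\<in>I. \<integral>\<^sup>+x. \<integral>\<^sup>+y. indicator (A k) (x, y) \<partial>N1 \<partial>N1)"
      using N1.borel_measurable_nn_integral_fst[OF borel_measurable_indicator[OF A]]
      by (intro S.product_nn_integral_prod[OF \<open>finite I\<close>])
    also have "\<dots> = (\<Prod>k\<in>I. emeasure (N1 \<Otimes>\<^sub>M N1) (A k))"
      using A by (intro prod.cong refl) (simp add: N1.emeasure_pair_measure)
    finally show "emeasure (distr (?G \<Otimes>\<^sub>M ?G) ?P ?z) (Pi\<^sub>E I A) = (\<Prod>i\<in>I. emeasure (N1 \<Otimes>\<^sub>M N1) (A i))" .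
  qed simp
qed

lemma bilin_rotation:
  assumes "\<And>k l. k < K \<Longrightarrow> l < K \<Longrightarrow> D k l = D l k"
  shows "bilin K D (\<lambda>k. (a k - b k) / sqrt 2) (\<lambda>k. (a k + b k) / sqrt 2) = (bilin K D a a - bilin K D b b) / 2"
proof -
  have sym: "bilin K D a b = bilin K D b a"
    unfolding bilin_def by (subst sum.swap) (auto intro!: sum.cong simp: assms)
  have "D k l * ((a k - b k) / sqrt 2) * ((a l + b l) / sqrt 2) =
     (D k l * a k * a l - D k l * b k * b l + D k l * a k * b l - D k l * b k * a l) * (1 / 2)" for k l
    by (simp add: field_simps)
  then have "bilin K D (\<lambda>k. (a k - b k) / sqrt 2) (\<lambda>k. (a k + b k) / sqrt 2) =
     (bilin K D a a - bilin K D b b + bilin K D a b - bilin K D b a) / 2"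
    unfolding bilin_def by (simp only: sum_distrib_right[symmetric] sum.distrib sum_subtractf)
  then show ?thesis using sym by simp
qed

text \<open>Rotating every pair \<open>(a k, b k)\<close> leaves the joint law unchanged and, by
  symmetry of \<open>D\<close>, turns the bilinear form into half the difference of the two
  quadratic forms. The gain is an exponent that is linear in \<open>b\<close>, so the inner integral
  becomes explicit.\<close>

lemma std_normal_vec_decouple:
  assumes "\<And>k l. k < K \<Longrightarrow> l < K \<Longrightarrow> D k l = D l k"
  shows "(\<integral>\<^sup>+a. \<integral>\<^sup>+b. ennreal (exp (s / 2 * (bilin K D a a - bilin K D b b))) \<partial>std_normal_vec K \<partial>std_normal_vec K) =
    (\<integral>\<^sup>+a. \<integral>\<^sup>+b. ennreal (exp (s * bilin K D a b)) \<partial>std_normal_vec K \<partial>std_normal_vec K)"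
proof -
  let ?N = "std_normal_distribution" let ?G = "PiM {..<K} (\<lambda>_. ?N)" let ?P = "PiM {..<K} (\<lambda>_. ?N \<Otimes>\<^sub>M ?N)"
  let ?\<rho> = "\<lambda>p. ((fst p - snd p) / sqrt 2, (fst p + snd p) / sqrt (2::real))"
  let ?f = "\<lambda>\<omega>. ennreal (exp (s * bilin K D (\<lambda>k. fst (\<omega> k)) (\<lambda>k. snd (\<omega> k))))"
  interpret G: prob_space ?G by (rule prob_space_PiM) (rule prob_space_std_normal)
  interpret N: pair_prob_space ?N ?N
    by (intro pair_prob_space.intro pair_sigma_finite.intro prob_space_imp_sigma_finite prob_space_std_normal)
  have sPN: "sets ?P = sets (PiM {..<K} (\<lambda>_. borel \<Otimes>\<^sub>M borel))"
    by (intro sets_PiM_cong refl sets_pair_measure_cong) auto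
  have f: "?f \<in> borel_measurable ?P"
    unfolding measurable_cong_sets[OF sPN refl] bilin_def by measurable
  have zip: "(\<integral>\<^sup>+a. \<integral>\<^sup>+b. h (\<lambda>k\<in>{..<K}. (a k, b k)) \<partial>?G \<partial>?G) = (\<integral>\<^sup>+\<omega>. h \<omega> \<partial>?P)"
    if h: "h \<in> borel_measurable ?P" for h :: "_ \<Rightarrow> ennreal"
  proof -
    have z: "(\<lambda>p. \<lambda>k\<in>{..<K}. (fst p k, snd p k)) \<in> measurable (?G \<Otimes>\<^sub>M ?G) ?P" by measurable
    have "(\<integral>\<^sup>+\<omega>. h \<omega> \<partial>?P) = (\<integral>\<^sup>+p. h (\<lambda>k\<in>{..<K}. (fst p k, snd p k)) \<partial>(?G \<Otimes>\<^sub>M ?G))"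
      by (subst distr_pair_PiM_zip[OF prob_space_std_normal, symmetric]) (auto simp: nn_integral_distr[OF z] h)
    also have "\<dots> = (\<integral>\<^sup>+a. \<integral>\<^sup>+b. h (\<lambda>k\<in>{..<K}. (a k, b k)) \<partial>?G \<partial>?G)"
      using G.nn_integral_fst[OF measurable_compose[OF z h]] by simp
    finally show ?thesis ..
  qed
  have \<rho>: "?\<rho> \<in> measurable (?N \<Otimes>\<^sub>M ?N) (?N \<Otimes>\<^sub>M ?N)" by measurable
  have c\<rho>: "compose {..<K} ?\<rho> \<in> measurable ?P ?P" unfolding compose_def by measurable
  have rot: "distr ?P ?P (compose {..<K} ?\<rho>) = ?P"
    using distr_PiM_finite_prob_space'[of "{..<K}" "\<lambda>_. ?N \<Otimes>\<^sub>M ?N" "\<lambda>_. ?N \<Otimes>\<^sub>M ?N" ?\<rho>] \<rho>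
    by (simp add: std_normal_rotation N.P.prob_space_axioms)
  have "(\<integral>\<^sup>+\<omega>. ?f \<omega> \<partial>?P) = (\<integral>\<^sup>+\<omega>. ?f (compose {..<K} ?\<rho> \<omega>) \<partial>?P)"
    using nn_integral_distr[OF c\<rho>, of ?f] f unfolding rot by simp
  also have "\<dots> = (\<integral>\<^sup>+a. \<integral>\<^sup>+b. ?f (compose {..<K} ?\<rho> (\<lambda>k\<in>{..<K}. (a k, b k))) \<partial>?G \<partial>?G)"
    by (rule zip[symmetric]) (rule measurable_compose[OF c\<rho> f])
  also have "\<dots> = (\<integral>\<^sup>+a. \<integral>\<^sup>+b. ennreal (exp (s / 2 * (bilin K D a a - bilin K D b b))) \<partial>?G \<partial>?G)"
  proof -
    have "bilin K D (\<lambda>k. fst (compose {..<K} ?\<rho> (\<lambda>k\<in>{..<K}. (a k, b k)) k)) (\<lambda>k. snd (compose {..<K} ?\<rho> (\<lambda>k\<in>{..<K}. (a k, b k)) k))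
       = bilin K D (\<lambda>k. (a k - b k) / sqrt 2) (\<lambda>k. (a k + b k) / sqrt 2)" for a b
      unfolding bilin_def by (intro sum.cong refl) (auto simp: compose_def)
    then show ?thesis by (simp only: bilin_rotation[OF assms]) simp
  qed
  finally have 1: "(\<integral>\<^sup>+\<omega>. ?f \<omega> \<partial>?P) = \<dots>" .
  have 2: "(\<integral>\<^sup>+\<omega>. ?f \<omega> \<partial>?P) = (\<integral>\<^sup>+a. \<integral>\<^sup>+b. ennreal (exp (s * bilin K D a b)) \<partial>?G \<partial>?G)"
  proof -
    have "bilin K D (\<lambda>k. fst ((\<lambda>k\<in>{..<K}. (a k, b k)) k)) (\<lambda>k. snd ((\<lambda>k\<in>{..<K}. (a k, b k)) k)) = bilin K D a b" for a b
      unfolding bilin_def by (intro sum.cong refl) auto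
    then show ?thesis using zip[OF f] by simp
  qed
  show ?thesis using 1 2 unfolding std_normal_vec_def by simp
qed

section \<open>Quadratic forms of Gaussian vectors\<close>

lemma bilin_self_scale: "bilin K D (\<lambda>k. c * a k) (\<lambda>k. c * a k) = c\<^sup>2 * bilin K D a a"
  unfolding bilin_def by (simp add: sum_distrib_left power2_eq_square mult_ac)

text \<open>Jensen's inequality from the tangent line of \<open>exp\<close> at the mean. In the form
  of a nonnegative integral it also covers an infinite exponential moment, so no integrability of
  the exponential has to be established first.\<close>

lemma (in prob_space) nn_integral_exp_ge:
  fixes Z :: "'a \<Rightarrow> real"
  assumes Z: "integrable M Z"
  shows "ennreal (exp (expectation Z)) \<le> (\<integral>\<^sup>+w. ennreal (exp (Z w)) \<partial>M)"
proof (cases "integrable M (\<lambda>w. exp (Z w))")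
  case True
  have "exp (expectation Z) = expectation (\<lambda>w. exp (expectation Z) * (1 + (Z w - expectation Z)))"
    using Z by (simp add: prob_space)
  also have "\<dots> \<le> expectation (\<lambda>w. exp (Z w))"
  proof (rule integral_mono[OF _ True])
    fix w show "exp (expectation Z) * (1 + (Z w - expectation Z)) \<le> exp (Z w)"
      using mult_left_mono[OF exp_ge_add_one_self, of "exp (expectation Z)" "Z w - expectation Z"]
      by (simp add: exp_add[symmetric])
  qed (use Z in auto)
  also have "ennreal (\<dots>) = (\<integral>\<^sup>+w. ennreal (exp (Z w)) \<partial>M)"
    by (rule nn_integral_eq_integral[symmetric, OF True]) simp
  finally show ?thesis by (simp add: ennreal_leI)
next
  case False
  then have "\<not> (\<integral>\<^sup>+w. ennreal (exp (Z w)) \<partial>M) < \<infinity>"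
    using Z by (auto simp: integrable_iff_bounded)
  then have "(\<integral>\<^sup>+w. ennreal (exp (Z w)) \<partial>M) = \<top>"
    by (metis infinity_ennreal_def top.not_eq_extremum)
  then show ?thesis by simp
qed

text \<open>Gaussianity enters through both transforms of all linear combinations, together with the
  second moments of the coordinates. No joint density appears, so \<open>D\<close> may be singular;
  that it is positive semidefinite is derived below.\<close>

locale gaussian_vector = prob_space P for P :: "'w measure" +
  fixes K :: nat and y :: "nat \<Rightarrow> 'w \<Rightarrow> real" and D :: "nat \<Rightarrow> nat \<Rightarrow> real" and b :: real
  assumes meas: "\<And>k. k < K \<Longrightarrow> y k \<in> borel_measurable P"
    and sym: "\<And>k l. k < K \<Longrightarrow> l < K \<Longrightarrow> D k l = D l k"
    and mgf: "\<And>a. (\<integral>\<^sup>+w. ennreal (exp (\<Sum>k<K. a k * y k w)) \<partial>P) = ennreal (exp (bilin K D a a / 2))"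
    and chf: "\<And>a. (LINT w|P. cis (\<Sum>k<K. a k * y k w)) = of_real (exp (- bilin K D a a / 2))"
    and square_integrable: "\<And>k. k < K \<Longrightarrow> integrable P (\<lambda>w. (y k w)\<^sup>2)"
    and second_moment: "\<And>k. k < K \<Longrightarrow> expectation (\<lambda>w. (y k w)\<^sup>2) = D k k"
    and b_pos: "0 < b"
    and le_b: "\<And>a. bilin K D a a \<le> b * (\<Sum>k<K. (a k)\<^sup>2)"
begin

lemmas [measurable] = meas

sublocale G: prob_space "std_normal_vec K" by (rule prob_space_std_normal_vec)
sublocale PG: pair_prob_space P "std_normal_vec K" ..

text \<open>A characteristic function has modulus at most 1.\<close>

lemma bilin_nonneg: "0 \<le> bilin K D a a"
proof -
  have "norm (LINT w|P. cis (\<Sum>k<K. a k * y k w)) \<le> (LINT w|P. norm (cis (\<Sum>k<K. a k * y k w)))"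
    by (rule integral_norm_bound)
  then have "exp (- bilin K D a a / 2) \<le> 1"
    unfolding chf by (simp add: prob_space del: of_real_exp)
  then show ?thesis by simp
qed

text \<open>The form bounds 0 and \<open>b\<close> give the operator norm bound without
  diagonalising. With \<open>c = D a\<close>, the values of the form at \<open>a + c / b\<close> and
  \<open>a - c / b\<close> differ by \<open>4 |c|^2 / b\<close>; bounding the first above by
  \<open>le_b\<close> and the second below by 0 yields
  \<open>4 |c|^2 / b <= 3 b |a|^2 + |c|^2 / b\<close>.\<close>

lemma image_norm_le: "(\<Sum>l<K. (\<Sum>k<K. D k l * a k)\<^sup>2) \<le> b\<^sup>2 * (\<Sum>k<K. (a k)\<^sup>2)"
proof -
  define c where "c = (\<lambda>l. \<Sum>k<K. D k l * a k)"
  define C where "C = (\<Sum>l<K. (c l)\<^sup>2)"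
  define S where "S = (\<Sum>k<K. (a k)\<^sup>2)"
  have ac: "bilin K D a c = C"
    unfolding bilin_def C_def c_def power2_eq_square
    by (subst sum.swap) (simp add: sum_distrib_right)
  have ca: "bilin K D c a = C"
    unfolding ac[symmetric] bilin_def by (subst sum.swap) (auto intro!: sum.cong simp: sym)
  have q: "bilin K D a a = (\<Sum>l<K. a l * c l)"
    unfolding bilin_def c_def by (subst sum.swap) (simp add: sum_distrib_left mult_ac)
  have bl: "bilin K D (\<lambda>k. a k + t * c k) (\<lambda>k. a k + t * c k) =
      bilin K D a a + 2 * t * C + t\<^sup>2 * bilin K D c c" for t
  proof -
    have "bilin K D (\<lambda>k. a k + t * c k) (\<lambda>k. a k + t * c k) =
      bilin K D a a + t * bilin K D a c + t * bilin K D c a + t\<^sup>2 * bilin K D c c"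
      unfolding bilin_def by (simp add: sum.distrib sum_distrib_left algebra_simps power2_eq_square)
    then show ?thesis using ac ca by simp
  qed
  have "bilin K D (\<lambda>k. a k + 1/b * c k) (\<lambda>k. a k + 1/b * c k) \<le> b * (\<Sum>k<K. (a k + 1/b * c k)\<^sup>2)"
    by (rule le_b)
  also have "(\<Sum>k<K. (a k + 1/b * c k)\<^sup>2) = S + 2 * (1/b) * bilin K D a a + (1/b)\<^sup>2 * C"
    unfolding q S_def C_def power2_sum
    by (simp only: sum.distrib sum_distrib_left power_mult_distrib) (simp add: mult_ac)
  finally have 1: "bilin K D (\<lambda>k. a k + 1/b * c k) (\<lambda>k. a k + 1/b * c k) \<le>
     b * (S + 2 * (1/b) * bilin K D a a + (1/b)\<^sup>2 * C)" .
  have "bilin K D (\<lambda>k. a k + (- 1/b) * c k) (\<lambda>k. a k + (- 1/b) * c k) \<ge> 0"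
    by (rule bilin_nonneg)
  then have "4 * (1/b) * C \<le> b * (S + 2 * (1/b) * bilin K D a a + (1/b)\<^sup>2 * C)"
    using 1 unfolding bl by simp
  also have "\<dots> = b * S + 2 * bilin K D a a + C / b"
    using b_pos by (simp add: field_simps power2_eq_square)
  also have "\<dots> \<le> b * S + 2 * (b * S) + C / b"
    using le_b[of a] unfolding S_def by simp
  finally have "4 * (C / b) \<le> 3 * (b * S) + C / b" by (simp add: mult.commute)
  then have "C / b \<le> b * S" by linarith
  then have "C \<le> b\<^sup>2 * S"
    using b_pos by (simp add: field_simps power2_eq_square)
  then show ?thesis unfolding C_def S_def c_def .
qed

text \<open>For fixed \<open>w\<close> the square is linearised by averaging
  \<open>exp (sqrt s * <y, \<eta>>)\<close> over \<open>\<eta>\<close>. After exchanging the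
  integrals, \<open>mgf\<close> evaluates the average over \<open>w\<close>. All integrands are
  nonnegative, so both sides may be infinite.\<close>

lemma exp_square_eq:
  assumes "0 \<le> s"
  shows "(\<integral>\<^sup>+w. ennreal (exp (s / 2 * (\<Sum>k<K. (y k w)\<^sup>2))) \<partial>P) =
    (\<integral>\<^sup>+\<eta>. ennreal (exp (s / 2 * bilin K D \<eta> \<eta>)) \<partial>std_normal_vec K)"
proof -
  have "(\<integral>\<^sup>+w. ennreal (exp (s / 2 * (\<Sum>k<K. (y k w)\<^sup>2))) \<partial>P) =
      (\<integral>\<^sup>+w. \<integral>\<^sup>+\<eta>. ennreal (exp (\<Sum>k<K. sqrt s * y k w * \<eta> k)) \<partial>std_normal_vec K \<partial>P)"
    using assms by (simp add: std_normal_vec_exp_linear power_mult_distrib sum_distrib_left sum_divide_distrib)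
  also have "\<dots> = (\<integral>\<^sup>+\<eta>. \<integral>\<^sup>+w. ennreal (exp (\<Sum>k<K. sqrt s * y k w * \<eta> k)) \<partial>P \<partial>std_normal_vec K)"
    by (rule PG.Fubini'[symmetric]) measurable
  also have "\<dots> = (\<integral>\<^sup>+\<eta>. \<integral>\<^sup>+w. ennreal (exp (\<Sum>k<K. (sqrt s * \<eta> k) * y k w)) \<partial>P \<partial>std_normal_vec K)"
    by (simp add: mult_ac)
  also have "\<dots> = (\<integral>\<^sup>+\<eta>. ennreal (exp (s / 2 * bilin K D \<eta> \<eta>)) \<partial>std_normal_vec K)"
    using assms by (simp only: mgf bilin_self_scale) simp
  finally show ?thesis .
qed

text \<open>The negative sign calls for an imaginary exponent, so \<open>chf\<close> replaces
  \<open>mgf\<close>. The integrand has modulus 1, which makes it integrable for Fubini on the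
  product of two probability spaces.\<close>

lemma exp_neg_square_eq:
  assumes "0 \<le> s"
  shows "(\<integral>\<^sup>+w. ennreal (exp (- s / 2 * (\<Sum>k<K. (y k w)\<^sup>2))) \<partial>P) =
    (\<integral>\<^sup>+\<eta>. ennreal (exp (- s / 2 * bilin K D \<eta> \<eta>)) \<partial>std_normal_vec K)"
proof -
  have int: "integrable (P \<Otimes>\<^sub>M std_normal_vec K) (\<lambda>(w, \<eta>). cis (\<Sum>k<K. sqrt s * y k w * \<eta> k))"
    by (rule PG.P.integrable_const_bound[where B=1]) (auto simp: split_beta)
  have "complex_of_real (LINT w|P. exp (- s / 2 * (\<Sum>k<K. (y k w)\<^sup>2))) =
      (LINT w|P. LINT \<eta>|std_normal_vec K. cis (\<Sum>k<K. sqrt s * y k w * \<eta> k))"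
    unfolding std_normal_vec_cis_linear integral_complex_of_real[symmetric]
    using assms by (simp add: power_mult_distrib sum_distrib_left sum_divide_distrib sum_negf del: of_real_exp)
  also have "\<dots> = (LINT \<eta>|std_normal_vec K. LINT w|P. cis (\<Sum>k<K. sqrt s * y k w * \<eta> k))"
    by (rule PG.Fubini_integral[symmetric, OF int])
  also have "\<dots> = (LINT \<eta>|std_normal_vec K. LINT w|P. cis (\<Sum>k<K. (sqrt s * \<eta> k) * y k w))"
    by (simp add: mult_ac)
  also have "\<dots> = complex_of_real (LINT \<eta>|std_normal_vec K. exp (- s / 2 * bilin K D \<eta> \<eta>))"
    unfolding chf bilin_self_scale integral_complex_of_real[symmetric] using assms by simp
  finally have eq: "(LINT w|P. exp (- s / 2 * (\<Sum>k<K. (y k w)\<^sup>2))) =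
      (LINT \<eta>|std_normal_vec K. exp (- s / 2 * bilin K D \<eta> \<eta>))"
    by (simp only: of_real_eq_iff)
  have "integrable P (\<lambda>w. exp (- s / 2 * (\<Sum>k<K. (y k w)\<^sup>2)))"
    using assms by (intro integrable_const_bound[where B=1]) (auto intro!: AE_I2 mult_nonneg_nonneg sum_nonneg)
  moreover have "integrable (std_normal_vec K) (\<lambda>\<eta>. exp (- s / 2 * bilin K D \<eta> \<eta>))"
    using assms bilin_nonneg
    by (intro G.integrable_const_bound[where B=1]) (auto intro!: AE_I2 mult_nonneg_nonneg)
  ultimately show ?thesis
    using eq by (simp add: nn_integral_eq_integral)
qed

lemma quadratic_deviation_mgf:
  assumes \<theta>: "0 \<le> \<theta>" "2 * \<theta> * b < 1"
  shows "(\<integral>\<^sup>+w. ennreal (exp (\<theta> * \<bar>(\<Sum>k<K. (y k w)\<^sup>2) - (\<Sum>k<K. D k k)\<bar>)) \<partial>P) \<le>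
    2 * ennreal ((1 / sqrt (1 - (2 * \<theta> * b)\<^sup>2)) ^ K)"
proof -
  let ?G = "std_normal_vec K" let ?T = "\<Sum>k<K. D k k"
  let ?Y = "\<lambda>w. \<Sum>k<K. (y k w)\<^sup>2"
  define s where "s = 2 * \<theta>"
  \<comment> \<open>This is the range in which the Gaussian integral of
    \<open>exp ((s * b)^2 / 2 * |a|^2)\<close> below is finite.\<close>
  have s: "0 \<le> s" "(s * b)\<^sup>2 < 1" using \<theta> b_pos by (auto simp: s_def abs_square_less_1)
  define F where "F = (\<lambda>s. \<integral>\<^sup>+\<eta>. ennreal (exp (s / 2 * bilin K D \<eta> \<eta>)) \<partial>?G)"
  have EY: "integrable P ?Y" "expectation ?Y = ?T"
    using square_integrable second_moment by auto
  have "F s * F (- s) = (\<integral>\<^sup>+a. \<integral>\<^sup>+c. ennreal (exp (s / 2 * (bilin K D a a - bilin K D c c))) \<partial>?G \<partial>?G)"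
    unfolding F_def
    by (subst nn_integral_multc[symmetric], measurable)
       (subst nn_integral_cmult[symmetric], measurable, simp add: ennreal_mult'[symmetric] exp_add[symmetric] algebra_simps)
  also have "\<dots> = (\<integral>\<^sup>+a. \<integral>\<^sup>+c. ennreal (exp (s * bilin K D a c)) \<partial>?G \<partial>?G)"
    by (rule std_normal_vec_decouple[OF sym])
  \<comment> \<open>For fixed \<open>a\<close> the exponent is linear in \<open>c\<close> with
    coefficient vector \<open>s D a\<close>, so integrating out \<open>c\<close> leaves
    \<open>exp (s^2 / 2 * |D a|^2)\<close>.\<close>
  also have "\<dots> = (\<integral>\<^sup>+a. \<integral>\<^sup>+c. ennreal (exp (\<Sum>l<K. (s * (\<Sum>k<K. D k l * a k)) * c l)) \<partial>?G \<partial>?G)"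
    unfolding bilin_def by (subst sum.swap) (simp add: sum_distrib_left sum_distrib_right mult_ac)
  also have "\<dots> = (\<integral>\<^sup>+a. ennreal (exp (s\<^sup>2 / 2 * (\<Sum>l<K. (\<Sum>k<K. D k l * a k)\<^sup>2))) \<partial>?G)"
    by (simp only: std_normal_vec_exp_linear power_mult_distrib sum_distrib_left[symmetric]) simp
  also have "\<dots> \<le> (\<integral>\<^sup>+a. ennreal (exp ((s * b)\<^sup>2 / 2 * (\<Sum>k<K. (a k)\<^sup>2))) \<partial>?G)"
    using mult_left_mono[OF image_norm_le, of "s\<^sup>2 / 2"]
    by (intro nn_integral_mono ennreal_leI) (simp add: power_mult_distrib mult_ac)
  also have "\<dots> = ennreal ((1 / sqrt (1 - (s * b)\<^sup>2)) ^ K)"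
    by (rule std_normal_vec_exp_square[OF s(2)])
  finally have FF: "F s * F (- s) \<le> ennreal ((1 / sqrt (1 - (s * b)\<^sup>2)) ^ K)" .
  have Fp: "F s = (\<integral>\<^sup>+w. ennreal (exp (s / 2 * ?Y w)) \<partial>P)"
    unfolding F_def exp_square_eq[OF s(1)] ..
  have Fm: "F (- s) = (\<integral>\<^sup>+w. ennreal (exp (- s / 2 * ?Y w)) \<partial>P)"
    unfolding F_def exp_neg_square_eq[OF s(1)] by simp
  \<comment> \<open>Jensen lets each centring factor be replaced by the exponential moment of the
    opposite sign. So both one-sided centred moments are at most \<open>F s * F (- s)\<close>, and
    the two signs of the absolute value account for the factor 2.\<close>
  have Jp: "ennreal (exp (s / 2 * ?T)) \<le> F s" and Jm: "ennreal (exp (- s / 2 * ?T)) \<le> F (- s)"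
    using nn_integral_exp_ge[OF integrable_mult_right[OF EY(1), of "s / 2"]]
      nn_integral_exp_ge[OF integrable_mult_right[OF EY(1), of "- s / 2"]]
    unfolding Fp Fm by (simp_all only: integral_mult_right_zero EY(2))
  have p: "(\<integral>\<^sup>+w. ennreal (exp (\<theta> * (?Y w - ?T))) \<partial>P) = F s * ennreal (exp (- s / 2 * ?T))"
    unfolding Fp by (subst nn_integral_multc[symmetric])
      (auto simp: s_def ennreal_mult'[symmetric] exp_add[symmetric] algebra_simps)
  have m: "(\<integral>\<^sup>+w. ennreal (exp (- \<theta> * (?Y w - ?T))) \<partial>P) = F (- s) * ennreal (exp (s / 2 * ?T))"
    unfolding Fm by (subst nn_integral_multc[symmetric])
      (auto simp: s_def ennreal_mult'[symmetric] exp_add[symmetric] algebra_simps)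
  have e: "exp (\<theta> * \<bar>z\<bar>) \<le> exp (\<theta> * z) + exp (- \<theta> * z)" for z
    by (cases "0 \<le> z") (simp_all add: abs_if)
  have "(\<integral>\<^sup>+w. ennreal (exp (\<theta> * \<bar>?Y w - ?T\<bar>)) \<partial>P) \<le>
      (\<integral>\<^sup>+w. ennreal (exp (\<theta> * (?Y w - ?T))) + ennreal (exp (- \<theta> * (?Y w - ?T))) \<partial>P)"
    by (intro nn_integral_mono) (simp only: ennreal_plus[symmetric] exp_ge_zero ennreal_leI e)
  also have "\<dots> = F s * ennreal (exp (- s / 2 * ?T)) + F (- s) * ennreal (exp (s / 2 * ?T))"
    unfolding p[symmetric] m[symmetric] by (rule nn_integral_add) measurable
  also have "\<dots> \<le> F s * F (- s) + F (- s) * F s"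
    by (intro add_mono mult_left_mono Jp Jm) auto
  also have "\<dots> \<le> 2 * ennreal ((1 / sqrt (1 - (s * b)\<^sup>2)) ^ K)"
    using add_mono[OF FF FF] by (simp add: mult.commute[of "F (- s)"] mult_2)
  finally show ?thesis by (simp add: s_def mult_ac)
qed

end

section \<open>Factorization of positive semidefinite matrices\<close>

lemma bilin_Suc:
  assumes "\<And>i. i < n \<Longrightarrow> c n i = c i n"
  shows "bilin (Suc n) c z z = bilin n c z z + 2 * z n * (\<Sum>i<n. c i n * z i) + c n n * (z n)\<^sup>2"
proof -
  have "(\<Sum>i<n. c n i * z n * z i) = z n * (\<Sum>i<n. c i n * z i)"
    using assms by (auto simp: sum_distrib_left intro!: sum.cong)
  moreover have "(\<Sum>i<n. c i n * z i * z n) = z n * (\<Sum>i<n. c i n * z i)"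
    by (auto simp: sum_distrib_left intro!: sum.cong)
  ultimately show ?thesis
    unfolding bilin_def by (simp add: sum.distrib power2_eq_square)
qed

lemma bilin_cong:
  assumes "\<And>i j. i < n \<Longrightarrow> j < n \<Longrightarrow> c i j * x i * y j = d i j * x' i * y' j"
  shows "bilin n c x y = bilin n d x' y'"
  unfolding bilin_def using assms by (intro sum.cong refl) auto

text \<open>Cholesky elimination of the last index, with a case for a zero pivot because the matrix
  may be singular.\<close>

lemma psd_factorization:
  assumes "\<And>i j. i < n \<Longrightarrow> j < n \<Longrightarrow> c i j = c j i" and "\<And>z. 0 \<le> bilin n c z z"
  shows "\<exists>B. \<forall>i<n. \<forall>j<n. c i j = (\<Sum>k<n. B k i * B k j)"
  using assms
proof (induction n arbitrary: c)
  case (Suc n)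
  have expand: "bilin (Suc n) c z z = bilin n c z z + 2 * z n * (\<Sum>i<n. c i n * z i) + c n n * (z n)\<^sup>2" for z
    by (rule bilin_Suc) (use Suc.prems in auto)
  have "0 \<le> c n n"
    using Suc.prems(2)[of "\<lambda>i. if i = n then 1 else 0"] unfolding expand
    by (simp add: bilin_def if_distrib cong: if_cong)
  then consider "c n n = 0" | "0 < c n n" by linarith
  then show ?case
  proof cases
    case 1
    have zero: "c i n = 0" if "i < n" for i
    proof (rule ccontr)
      assume ne: "c i n \<noteq> 0"
      \<comment> \<open>Chosen so that \<open>c i i + 2 * \<tau> * c i n = - 1\<close>: with a zero
        pivot, a nonzero entry in the last column would make the form negative.\<close>
      define \<tau> where "\<tau> = - (c i i + 1) / (2 * c i n)"
      define z where "z = (\<lambda>j. if j = i then 1 else if j = n then \<tau> else 0)"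
      have "bilin n c z z = (\<Sum>k<n. \<Sum>l<n. if l = i then (if k = i then c i i else 0) else 0)"
        unfolding bilin_def by (intro sum.cong refl) (auto simp: z_def)
      moreover have "(\<Sum>j<n. c j n * z j) = (\<Sum>j<n. if j = i then c i n else 0)"
        by (intro sum.cong refl) (auto simp: z_def)
      ultimately have "bilin n c z z = c i i" "(\<Sum>j<n. c j n * z j) = c i n" "z n = \<tau>"
        using that by (simp_all add: z_def)
      then have "bilin (Suc n) c z z = -1"
        unfolding expand using 1 ne by (simp add: \<tau>_def field_simps)
      then show False using Suc.prems(2)[of z] by simp
    qed
    have "0 \<le> bilin n c z z" for z
    proof -
      have "bilin n c (z(n := 0)) (z(n := 0)) = bilin n c z z" by (rule bilin_cong) auto
      then show ?thesis using Suc.prems(2)[of "z(n := 0)"] unfolding expand by simp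
    qed
    then obtain B where B: "\<forall>i<n. \<forall>j<n. c i j = (\<Sum>k<n. B k i * B k j)"
      using Suc.IH[of c] Suc.prems(1) by auto
    show ?thesis
    proof (intro exI[of _ "\<lambda>k i. if i = n \<or> k = n then 0 else B k i"] allI impI)
      fix i j assume "i < Suc n" "j < Suc n"
      then show "c i j = (\<Sum>k<Suc n. (if i = n \<or> k = n then 0 else B k i) * (if j = n \<or> k = n then 0 else B k j))"
        using B zero Suc.prems(1)[of i j] 1 by (cases "i = n"; cases "j = n") (auto simp: less_Suc_eq)
    qed
  next
    case 2
    \<comment> \<open>The Schur complement of the pivot. Its form at \<open>z\<close> is the minimum
      of the full form over the last coordinate, attained at \<open>- S / c n n\<close>, and
      therefore again nonnegative.\<close>
    define c' where "c' = (\<lambda>i j. c i j - c i n * c j n / c n n)"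
    have "0 \<le> bilin n c' z z" for z
    proof -
      define S where "S = (\<Sum>i<n. c i n * z i)"
      define z' where "z' = z(n := - S / c n n)"
      have "(\<Sum>i<n. \<Sum>j<n. c i n * z i * (c j n * z j)) = S * S"
        unfolding S_def by (simp add: sum_product)
      moreover have "bilin n c' z z = bilin n c z z - (\<Sum>i<n. \<Sum>j<n. c i n * z i * (c j n * z j)) / c n n"
        unfolding bilin_def c'_def
        by (simp add: sum_subtractf[symmetric] sum_divide_distrib algebra_simps)
      ultimately have "bilin n c' z z = bilin n c z z - S * S / c n n" by simp
      also have "\<dots> = bilin (Suc n) c z' z'"
      proof -
        have "bilin n c z' z' = bilin n c z z" by (rule bilin_cong) (auto simp: z'_def)
        moreover have "(\<Sum>i<n. c i n * z' i) = S" by (auto simp: z'_def S_def intro!: sum.cong)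
        moreover have "z' n = - S / c n n" by (simp add: z'_def)
        ultimately show ?thesis
          unfolding expand using 2 by (simp add: power2_eq_square field_simps)
      qed
      finally show ?thesis using Suc.prems(2)[of z'] by simp
    qed
    moreover have "c' i j = c' j i" if "i < n" "j < n" for i j
      using Suc.prems(1)[of i j] that by (simp add: c'_def)
    ultimately obtain B where B: "\<forall>i<n. \<forall>j<n. c' i j = (\<Sum>k<n. B k i * B k j)"
      using Suc.IH[of c'] by auto
    show ?thesis
    proof (intro exI[of _ "\<lambda>k i. if k = n then c i n / sqrt (c n n) else if i = n then 0 else B k i"] allI impI)
      fix i j assume ij: "i < Suc n" "j < Suc n"
      have "c i j = c i n * c j n / c n n + (if i = n \<or> j = n then 0 else c' i j)"
        using 2 Suc.prems(1)[of i j] ij by (auto simp: c'_def)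
      moreover have "(if i = n \<or> j = n then 0 else c' i j) =
          (\<Sum>k<n. (if i = n then 0 else B k i) * (if j = n then 0 else B k j))"
        using B ij by (auto simp: less_Suc_eq)
      ultimately show "c i j = (\<Sum>k<Suc n. (if k = n then c i n / sqrt (c n n) else if i = n then 0 else B k i) *
          (if k = n then c j n / sqrt (c n n) else if j = n then 0 else B k j))"
        using 2 by simp
    qed
  qed
qed simp

section \<open>Blackman-Tukey estimates and their means\<close>

lemma nn_integral_pos_neg_eq:
  fixes g :: "'a \<Rightarrow> real"
  assumes "integrable M g" "(LINT x|M. g x) = 0"
  shows "(\<integral>\<^sup>+x. ennreal (g x) \<partial>M) = (\<integral>\<^sup>+x. ennreal (- g x) \<partial>M)"
proof -
  have "(\<integral>\<^sup>+x. ennreal (g x) \<partial>M) \<noteq> \<infinity>" "(\<integral>\<^sup>+x. ennreal (- g x) \<partial>M) \<noteq> \<infinity>"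
    using assms(1) by (simp_all add: real_integrable_def)
  moreover have "enn2real (\<integral>\<^sup>+x. ennreal (g x) \<partial>M) = enn2real (\<integral>\<^sup>+x. ennreal (- g x) \<partial>M)"
    using real_lebesgue_integral_def[OF assms(1)] assms(2) by simp
  ultimately show ?thesis
    by (metis ennreal_enn2real infinity_ennreal_def less_top)
qed

text \<open>The positive and negative parts of the difference \<open>D\<close> are densities of two
  finite measures. They agree on every half-line, because \<open>D\<close> integrates to 0 over the
  whole interval and over each initial segment; hence the measures, and then the densities,
  coincide.\<close>

lemma spectrum_unique:
  assumes F: "spectrum a F" and F': "spectrum a F'"
  shows "AE f in lborel. f \<in> {0..<1} \<longrightarrow> F f = F' f"
proof -
  define D where "D = (\<lambda>f. indicator {0..<1} f * (F f - F' f))"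
  have int: "integrable lborel D"
    using F F' unfolding spectrum_def set_integrable_def D_def
    by (auto simp: right_diff_distrib)
  note [measurable] = borel_measurable_integrable[OF int]
  have null: "null_coeffs (\<lambda>f. of_real (F f) - of_real (F' f))"
    unfolding null_coeffs_def
  proof (intro conjI allI)
    show "set_integrable lborel {0..<1} (\<lambda>f. complex_of_real (F f) - of_real (F' f))"
      using spectrum_integrable[OF F] spectrum_integrable[OF F'] by (rule set_integral_diff)
    fix n :: int
    have "set_integrable lborel {0..<1} (\<lambda>f. of_real (F f) * cis (2 * pi * f * of_int n))"
        "set_integrable lborel {0..<1} (\<lambda>f. of_real (F' f) * cis (2 * pi * f * of_int n))"
      using spectrum_integrable[OF F] spectrum_integrable[OF F']
      by (auto intro!: set_integrable_mult_bounded[where C=1])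
    from set_integral_diff(2)[OF this]
    show "(LINT f:{0..<1}|lborel. (of_real (F f) - of_real (F' f)) * cis (2 * pi * f * of_int n)) = 0"
      using F F' unfolding spectrum_def by (simp add: left_diff_distrib)
  qed
  have of_real: "(LINT f|lborel. indicator S f *\<^sub>R (complex_of_real (F f) - of_real (F' f))) =
      of_real (LINT f|lborel. indicator S f * D f)" if "S \<subseteq> {0..<1}" for S
    unfolding integral_complex_of_real[symmetric]
    by (intro Bochner_Integration.integral_cong refl) (use that in \<open>auto simp: D_def indicator_def\<close>)
  have zero: "(LINT f|lborel. indicator {x<..} f * D f) = 0" for x
  proof -
    have total: "(LINT f|lborel. D f) = 0"
    proof -
      have "(LINT f:{0..<1}|lborel. (complex_of_real (F f) - of_real (F' f)) * cis (2 * pi * f * of_int 0)) = 0"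
        using null unfolding null_coeffs_def by blast
      then have "(LINT f|lborel. indicator {0..<1} f * D f) = 0"
        using of_real[of "{0..<1}"] by (simp add: set_lebesgue_integral_def)
      moreover have "indicator {0..<1} f * D f = D f" for f by (simp add: D_def indicator_def)
      ultimately show ?thesis by simp
    qed
    consider "x < 0" | "0 \<le> x" "x < 1" | "1 \<le> x" by linarith
    then show ?thesis
    proof cases
      case 1
      then have "indicator {x<..} f * D f = D f" for f by (auto simp: D_def indicator_def)
      with total show ?thesis by (simp only:)
    next
      case 2
      have e: "indicator {x<..} f * D f = D f - indicator {0..x} f * D f" for f
        using 2 by (auto simp: D_def indicator_def)
      have i: "integrable lborel (\<lambda>f. indicator {0..x} f * D f)"
        using integrable_mult_indicator[OF _ int, of "{0..x}"] by simp
      have sub: "{0..x} \<subseteq> {0..<1}" using 2 by auto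
      have "(LINT f|lborel. indicator {0..x} f * D f) = 0"
        using null_coeffs_initial[OF null 2] of_real[OF sub] by (simp add: set_lebesgue_integral_def)
      then show ?thesis unfolding e using total int i by simp
    next
      case 3
      then have "indicator {x<..} f * D f = 0" for f by (auto simp: D_def indicator_def)
      then show ?thesis by (simp only: Bochner_Integration.integral_zero)
    qed
  qed
  have eq: "(\<integral>\<^sup>+f. ennreal (D f) * indicator {x<..} f \<partial>lborel) = (\<integral>\<^sup>+f. ennreal (- D f) * indicator {x<..} f \<partial>lborel)" for x
  proof -
    have "integrable lborel (\<lambda>f. indicator {x<..} f * D f)"
      using integrable_mult_indicator[OF _ int, of "{x<..}"] by simp
    from nn_integral_pos_neg_eq[OF this zero]
    have "(\<integral>\<^sup>+f. ennreal (indicator {x<..} f * D f) \<partial>lborel) = (\<integral>\<^sup>+f. ennreal (- (indicator {x<..} f * D f)) \<partial>lborel)" .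
    moreover have "ennreal (indicator {x<..} f * D f) = ennreal (D f) * indicator {x<..} f"
        "ennreal (- (indicator {x<..} f * D f)) = ennreal (- D f) * indicator {x<..} f" for f
      by (auto simp: indicator_def)
    ultimately show ?thesis by (simp only:)
  qed
  \<comment> \<open>\<open>ennreal\<close> maps negative reals to 0, so these densities are the
    positive and the negative part of \<open>D\<close>.\<close>
  have "density lborel (\<lambda>f. ennreal (D f)) = density lborel (\<lambda>f. ennreal (- D f))"
  proof (rule measure_eqI_lessThan)
    fix x :: real
    have "(\<integral>\<^sup>+f. ennreal (D f) * indicator {x<..} f \<partial>lborel) \<le> (\<integral>\<^sup>+f. ennreal (norm (D f)) \<partial>lborel)"
      by (intro nn_integral_mono) (auto simp: indicator_def intro: ennreal_leI)
    also have "\<dots> < \<infinity>" using int by (simp add: integrable_iff_bounded)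
    finally show "emeasure (density lborel (\<lambda>f. ennreal (D f))) {x<..} < \<infinity>"
      by (simp add: emeasure_density)
    show "emeasure (density lborel (\<lambda>f. ennreal (D f))) {x<..} = emeasure (density lborel (\<lambda>f. ennreal (- D f))) {x<..}"
      using eq[of x] by (simp add: emeasure_density)
  qed simp_all
  then have "AE f in lborel. ennreal (D f) = ennreal (- D f)"
    by (subst (asm) sigma_finite_measure.density_unique_iff[OF sigma_finite_lborel]) auto
  then show ?thesis
  proof eventually_elim
    case (elim f)
    then have "D f = 0" by (cases "0 \<le> D f") (auto simp: ennreal_neg ennreal_eq_0_iff)
    then show ?case by (auto simp: D_def)
  qed
qed

section \<open>The estimate as a quadratic form\<close>

definition bt_kernel :: "(int \<Rightarrow> real) \<Rightarrow> nat \<Rightarrow> real \<Rightarrow> nat \<Rightarrow> nat \<Rightarrow> real" where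
  "bt_kernel g M f p q = g (int p - int q) * cos (2 * pi * f * of_int (int p - int q)) / real M"

lemma bt_kernel_sym:
  assumes "\<And>m. g (- m) = g m"
  shows "bt_kernel g M f p q = bt_kernel g M f q p"
proof -
  have "cos (2 * pi * f * of_int (int q - int p)) = cos (2 * pi * f * of_int (int p - int q))"
    using cos_minus[of "2 * pi * f * of_int (int p - int q)"] by (simp add: algebra_simps)
  then show ?thesis
    using assms[of "int p - int q"] by (simp add: bt_kernel_def)
qed

lemma sum_Suc_shift: "(\<Sum>p=1..M. h p) = (\<Sum>p<M. h (Suc p))"
  by (rule sum.reindex_bij_witness[of _ Suc "\<lambda>p. p - 1"]) auto

text \<open>Since \<open>g\<close> is even, the sine part of the double sum changes sign when
  \<open>p\<close> and \<open>q\<close> are exchanged and so cancels; only the cosine kernel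
  remains. Samples are renumbered from 0.\<close>

lemma bt_est_eq:
  assumes even: "\<And>m. g (- m) = g m"
  shows "bt_est g M x f = of_real (bilin M (bt_kernel g M f) (\<lambda>n. x (Suc n)) (\<lambda>n. x (Suc n)))"
proof -
  let ?G = "\<lambda>m. of_real (g m / real M) * cis (- 2 * pi * f * of_int m)"
  have "bt_est g M x f = (\<Sum>m = - int M + 1..int M - 1.
      ?G m * (\<Sum>n=1..M - nat \<bar>m\<bar>. complex_of_real (x (n + nat \<bar>m\<bar>)) * of_real (x n)))"
    unfolding bt_est_def acf_est_def by (intro sum.cong refl) (simp add: mult_ac)
  also have "\<dots> = (\<Sum>p=1..M. \<Sum>q=1..M. ?G (int p - int q) * (of_real (x p) * of_real (x q)))"
    by (rule sum_diagonals)
  also have "\<dots> = (\<Sum>p<M. \<Sum>q<M. ?G (int p - int q) * (of_real (x (Suc p)) * of_real (x (Suc q))))"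
    unfolding sum_Suc_shift by simp
  also have "\<dots> = of_real (bilin M (bt_kernel g M f) (\<lambda>n. x (Suc n)) (\<lambda>n. x (Suc n)))" (is "?S = _")
  proof (rule complex_eqI)
    show "Re ?S = Re (of_real (bilin M (bt_kernel g M f) (\<lambda>n. x (Suc n)) (\<lambda>n. x (Suc n))))"
      unfolding bilin_def bt_kernel_def
      by (simp del: of_real_mult of_real_divide add: of_real_mult[symmetric] mult_ac)
    let ?h = "\<lambda>p q. g (int p - int q) * sin (2 * pi * f * of_int (int p - int q)) * (x (Suc p) * x (Suc q)) / real M"
    have "Im ?S = - (\<Sum>p<M. \<Sum>q<M. ?h p q)"
      by (simp add: sum_negf[symmetric] mult_ac del: of_real_mult of_real_divide add: of_real_mult[symmetric])
    moreover have "(\<Sum>p<M. \<Sum>q<M. ?h p q) = (\<Sum>p<M. \<Sum>q<M. - ?h p q)"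
    proof (subst sum.swap, intro sum.cong refl)
      fix p q
      have "sin (2 * pi * f * of_int (int q - int p)) = - sin (2 * pi * f * of_int (int p - int q))"
        using sin_minus[of "2 * pi * f * of_int (int p - int q)"] by (simp add: algebra_simps)
      moreover have "g (int q - int p) = g (int p - int q)" using even[of "int p - int q"] by simp
      ultimately show "?h q p = - ?h p q" by (simp add: mult_ac)
    qed
    ultimately show "Im ?S = Im (of_real (bilin M (bt_kernel g M f) (\<lambda>n. x (Suc n)) (\<lambda>n. x (Suc n))))"
      by (simp add: sum_negf)
  qed
  finally show ?thesis .
qed

text \<open>The cosine is the real part of a product of phases, one for \<open>p\<close> and one for
  \<open>q\<close>. Thus the kernel at \<open>f\<close> is a Toeplitz form in the modulated vector,
  whose norm does not depend on \<open>f\<close>; this makes the bounds on the kernel uniform in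
  \<open>f\<close>.\<close>

lemma bt_kernel_form:
  "bilin M (bt_kernel g M f) z z =
   Re (\<Sum>p<M. \<Sum>q<M. of_real (g (int p - int q)) * ((z p * cis (2 * pi * f * real p)) * cnj (z q * cis (2 * pi * f * real q)))) / real M"
proof -
  have c: "Re (of_real (g (int p - int q)) * ((z p * cis (2 * pi * f * real p)) * cnj (z q * cis (2 * pi * f * real q)))) =
    g (int p - int q) * (z p * z q) * cos (2 * pi * f * of_int (int p - int q))" for p q
    by (simp add: cos_diff algebra_simps)
  show ?thesis
    unfolding Re_sum c bilin_def bt_kernel_def by (simp add: sum_divide_distrib mult_ac)
qed

lemma bt_kernel_bounds:
  assumes "spectrum g G" and "\<And>f. f \<in> {0..<1} \<Longrightarrow> 0 \<le> G f \<and> G f \<le> A"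
  shows "0 \<le> bilin M (bt_kernel g M f) z z"
    and "bilin M (bt_kernel g M f) z z \<le> A / real M * (\<Sum>p<M. (z p)\<^sup>2)"
proof -
  show "0 \<le> bilin M (bt_kernel g M f) z z"
    unfolding bt_kernel_form using assms
    by (intro divide_nonneg_nonneg toeplitz_form_bounds(2)[OF assms(1)]) auto
  have "(\<Sum>p<M. (cmod (z p * cis (2 * pi * f * real p)))\<^sup>2) = (\<Sum>p<M. (z p)\<^sup>2)"
    by (simp add: norm_mult)
  then show "bilin M (bt_kernel g M f) z z \<le> A / real M * (\<Sum>p<M. (z p)\<^sup>2)"
    using toeplitz_form_bounds(1)[OF assms(1), of "{..<M}" A "\<lambda>p. z p * cis (2 * pi * f * real p)"] assms(2)
    unfolding bt_kernel_form by (auto simp: divide_right_mono)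
qed

lemma acf_form_le:
  assumes "spectrum r s" and "\<And>f. f \<in> {0..<1} \<Longrightarrow> s f \<le> C"
  shows "bilin M (\<lambda>p q. r (int p - int q)) a a \<le> C * (\<Sum>p<M. (a p)\<^sup>2)"
  using toeplitz_form_bounds(1)[OF assms(1), of "{..<M}" C "\<lambda>p. of_real (a p)"] assms(2)
  unfolding bilin_def by (simp add: mult_ac)

text \<open>The coefficients of a nonnegative function are dominated by its integral, here
  \<open>g 0 = 1\<close>. This keeps \<open>h_seq\<close> bounded, so that the series for the bias
  converges.\<close>

lemma spectrum_window_le_1:
  assumes "spectrum g G" and "\<And>f. f \<in> {0..<1} \<Longrightarrow> 0 \<le> G f" and "g 0 = 1"
  shows "\<bar>g m\<bar> \<le> 1"
proof -
  have "complex_of_real (g 0) = (LINT f:{0..<1}|lborel. of_real (G f) * cis (2 * pi * f * of_int 0))"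
    using assms(1) unfolding spectrum_def by blast
  then have "complex_of_real (g 0) = of_real (LINT f:{0..<1}|lborel. G f)"
    unfolding set_lebesgue_integral_def by (subst integral_complex_of_real[symmetric]) (simp add: scaleR_conv_of_real)
  then have 1: "(LINT f:{0..<1}|lborel. G f) = 1" using assms(3) by (simp only: of_real_eq_iff)
  have "norm (complex_of_real (g m)) \<le> (LINT f:{0..<1}|lborel. norm (of_real (G f) * cis (2 * pi * f * of_int m)))"
  proof -
    have "set_integrable lborel {0..<1} (\<lambda>f. of_real (G f) * cis (2 * pi * f * of_int m))"
      by (rule set_integrable_mult_bounded[OF spectrum_integrable[OF assms(1)], where C=1]) auto
    from set_integral_norm_bound[OF this] show ?thesis
      using assms(1) unfolding spectrum_def by simp
  qed
  also have "\<dots> = (LINT f:{0..<1}|lborel. G f)"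
    by (rule set_lebesgue_integral_cong) (use assms(2) in \<open>auto simp: norm_mult\<close>)
  finally show ?thesis using 1 by simp
qed

text \<open>Trace of the kernel times the covariance matrix, that is, the expectation of the
  estimate for samples with ACF \<open>r\<close>.\<close>

definition bt_mean :: "(int \<Rightarrow> real) \<Rightarrow> nat \<Rightarrow> (int \<Rightarrow> real) \<Rightarrow> real \<Rightarrow> real" where
  "bt_mean g M r f = (\<Sum>p<M. \<Sum>q<M. bt_kernel g M f p q * r (int p - int q))"

text \<open>Lag \<open>m\<close> occurs \<open>M - |m|\<close> times among the samples, so the mean
  has coefficients \<open>g m * (1 - |m| / M) * r m\<close>. Subtracting them from
  \<open>r m\<close> leaves \<open>h_seq g M m * r m\<close>, and the triangle inequality for the
  series gives the bound.\<close>

lemma bt_mean_bias: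
  assumes r: "(\<lambda>m. \<bar>r m\<bar>) summable_on UNIV" and s: "spectrum r s"
    and g: "\<And>m. \<bar>g m\<bar> \<le> 1"
  shows "AE f in lborel. f \<in> {0..<1} \<longrightarrow> \<bar>s f - bt_mean g M r f\<bar> \<le> (\<Sum>\<^sub>\<infinity>m\<in>UNIV. \<bar>h_seq g M m\<bar> * \<bar>r m\<bar>)"
proof -
  define e where "e = (\<lambda>f m. cis (- 2 * pi * f * of_int m))"
  \<comment> \<open>The Fourier series of \<open>r\<close>: a version of the PSD whose bias can be
    computed at every \<open>f\<close>. Taking the real part changes nothing, since \<open>r\<close>
    is even.\<close>
  define s' where "s' = (\<lambda>f. Re (\<Sum>\<^sub>\<infinity>m\<in>UNIV. of_real (r m) * e f m))"
  have sum: "(\<lambda>m. of_real (r m) * e f m) summable_on UNIV" for f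
    by (rule abs_summable_summable) (use r in \<open>simp add: norm_mult e_def\<close>)
  have hle: "\<bar>h_seq g M m\<bar> \<le> 2" for m
  proof -
    have "\<bar>1 - \<bar>real_of_int m\<bar> / real M\<bar> \<le> 1" if "\<bar>m\<bar> < int M"
    proof -
      have "\<bar>real_of_int m\<bar> \<le> real M" using that by linarith
      then have "\<bar>real_of_int m\<bar> / real M \<le> 1" "0 \<le> \<bar>real_of_int m\<bar> / real M" by (auto simp: divide_le_eq_1)
      then show ?thesis by linarith
    qed
    then have "\<bar>g m * (1 - \<bar>real_of_int m\<bar> / real M)\<bar> \<le> 1" if "\<bar>m\<bar> < int M"
      using that mult_mono[OF g[of m], of "\<bar>1 - \<bar>real_of_int m\<bar> / real M\<bar>" 1] by (simp add: abs_mult)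
    then show ?thesis unfolding h_seq_def by (auto simp: abs_le_iff)
  qed
  \<comment> \<open>Essential for the bound to carry meaning: \<open>infsum\<close> of a
    non-summable family is 0.\<close>
  have hsum: "(\<lambda>m. \<bar>h_seq g M m\<bar> * \<bar>r m\<bar>) summable_on UNIV"
    by (rule summable_on_comparison_test[OF summable_on_cmult_right[OF r, of 2]])
      (auto intro!: mult_right_mono hle)
  have s': "spectrum r s'"
  proof (rule spectrumI[OF r])
    fix f
    have "cnj (\<Sum>\<^sub>\<infinity>m\<in>UNIV. of_real (r m) * e f m) = (\<Sum>\<^sub>\<infinity>m\<in>UNIV. of_real (r (- m)) * e f (- m))"
      by (simp add: infsum_cnj[symmetric] spectrum_even[OF s] e_def cis_cnj)
    also have "\<dots> = (\<Sum>\<^sub>\<infinity>m\<in>UNIV. of_real (r m) * e f m)"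
      by (rule infsum_reindex_bij_betw[where g=uminus and f="\<lambda>m. of_real (r m) * e f m"]) (rule bij_uminus)
    finally show "complex_of_real (s' f) = (\<Sum>\<^sub>\<infinity>m\<in>UNIV. of_real (r m) * cis (- 2 * pi * f * of_int m))"
      unfolding s'_def e_def by (simp add: complex_eq_iff)
  qed
  have bias: "\<bar>s' f - bt_mean g M r f\<bar> \<le> (\<Sum>\<^sub>\<infinity>m\<in>UNIV. \<bar>h_seq g M m\<bar> * \<bar>r m\<bar>)" for f
  proof -
    define J where "J = {- int M + 1..int M - 1}"
    define t where "t = (\<lambda>m. if m \<in> J then of_real (g m * (1 - \<bar>real_of_int m\<bar> / real M) * r m) * e f m else 0)"
    have "(t has_sum sum t J) J" by (rule has_sum_finite) (simp add: J_def)
    moreover have "(t has_sum sum t J) J \<longleftrightarrow> (t has_sum sum t J) UNIV"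
      by (rule has_sum_cong_neutral) (auto simp: t_def)
    ultimately have "(t has_sum sum t J) UNIV" by blast
    then have tsum: "t summable_on UNIV" and tinf: "infsum t UNIV = sum t J"
      by (auto simp: summable_on_def infsumI)
    have "bt_mean g M r f = Re (\<Sum>p=1..M. \<Sum>q=1..M. (of_real (g (int p - int q) * r (int p - int q) / real M) * e f (int p - int q)) * (1 * 1))"
      unfolding bt_mean_def bt_kernel_def sum_Suc_shift e_def by (simp add: mult_ac del: of_real_mult of_real_divide)
    also have "\<dots> = Re (\<Sum>m\<in>J. (of_real (g m * r m / real M) * e f m) * (\<Sum>n=1..M - nat \<bar>m\<bar>. 1 * 1))"
      unfolding J_def
      by (rule arg_cong[where f=Re], rule sum_diagonals[where x="\<lambda>_. 1" and G="\<lambda>m. of_real (g m * r m / real M) * e f m", symmetric])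
    also have "(\<Sum>m\<in>J. (of_real (g m * r m / real M) * e f m) * (\<Sum>n=1..M - nat \<bar>m\<bar>. 1 * 1)) = sum t J"
    proof (intro sum.cong refl)
      fix m assume m: "m \<in> J"
      then have "real (M - nat \<bar>m\<bar>) = real M - \<bar>real_of_int m\<bar>" "real M \<noteq> 0" by (auto simp: J_def of_nat_diff)
      then have "g m * r m / real M * real (M - nat \<bar>m\<bar>) = g m * (1 - \<bar>real_of_int m\<bar> / real M) * r m"
        by (simp add: field_simps)
      then have "of_real (g m * r m / real M) * of_nat (M - nat \<bar>m\<bar>) = complex_of_real (g m * (1 - \<bar>real_of_int m\<bar> / real M) * r m)"
        by (metis of_real_mult of_real_of_nat_eq)
      then show "(of_real (g m * r m / real M) * e f m) * (\<Sum>n=1..M - nat \<bar>m\<bar>. 1 * 1) = t m"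
        using m by (simp add: t_def mult_ac del: of_real_mult of_real_divide)
    qed
    finally have mean: "bt_mean g M r f = Re (infsum t UNIV)" unfolding tinf .
    have hr: "(\<lambda>m. of_real (h_seq g M m * r m) * e f m) summable_on UNIV"
      by (rule abs_summable_summable) (use hsum in \<open>simp add: norm_mult e_def abs_mult\<close>)
    have diff: "t m + of_real (h_seq g M m * r m) * e f m = of_real (r m) * e f m" for m
      by (auto simp: t_def J_def h_seq_def algebra_simps)
    have "\<bar>s' f - bt_mean g M r f\<bar> \<le> cmod ((\<Sum>\<^sub>\<infinity>m\<in>UNIV. of_real (r m) * e f m) - infsum t UNIV)"
      unfolding s'_def mean minus_complex.sel(1)[symmetric] by (rule abs_Re_le_cmod)
    also have "\<dots> = cmod (\<Sum>\<^sub>\<infinity>m\<in>UNIV. of_real (h_seq g M m * r m) * e f m)"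
      using infsum_add[OF tsum hr] unfolding diff by simp
    also have "\<dots> \<le> (\<Sum>\<^sub>\<infinity>m\<in>UNIV. \<bar>h_seq g M m\<bar> * \<bar>r m\<bar>)"
      using norm_infsum_bound[of "\<lambda>m. of_real (h_seq g M m * r m) * e f m" UNIV] hsum
      by (simp add: norm_mult e_def abs_mult)
    finally show ?thesis .
  qed
  show ?thesis
    using spectrum_unique[OF s s'] by eventually_elim (use bias in auto)
qed

section \<open>Realizations of the data model\<close>

lemma std_normal_cis: "(LINT x|std_normal_distribution. cis (t * x)) = of_real (exp (- t\<^sup>2 / 2))"
  using char_std_normal_distribution by (simp add: char_def cis_conv_exp fun_eq_iff)

context prob_space
begin

text \<open>A zero mean forces the constant of a degenerate variable to be 0. Otherwise the variable
  is a multiple of a standard normal one; both cases obey the same formulas in terms of the second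
  moment.\<close>

lemma centered_gaussian_transforms:
  assumes Z: "gaussian_rv M Z" and mean: "expectation Z = 0"
  shows "integrable M Z" and "integrable M (\<lambda>w. (Z w)\<^sup>2)"
    and "has_bochner_integral M (\<lambda>w. exp (Z w)) (exp (expectation (\<lambda>w. (Z w)\<^sup>2) / 2))"
    and "(LINT w|M. cis (Z w)) = of_real (exp (- expectation (\<lambda>w. (Z w)\<^sup>2) / 2))"
proof -
  have [measurable]: "Z \<in> borel_measurable M" using Z by (simp add: gaussian_rv_def)
  have "\<exists>s U. U \<in> borel_measurable M \<and> distr M borel U = std_normal_distribution \<and> (AE w in M. Z w = s * U w)
      \<or> (AE w in M. Z w = 0)"
  proof -
    consider c where "AE w in M. Z w = c" | m s where "0 < s" "distributed M lborel Z (normal_density m s)"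
      using Z unfolding gaussian_rv_def by auto
    then show ?thesis
    proof cases
      case 1
      have "expectation Z = expectation (\<lambda>_. c)" by (rule integral_cong_AE) (use 1 in auto)
      then have "c = 0" using mean by (simp add: prob_space)
      then show ?thesis using 1 by auto
    next
      case 2
      have "m = 0" using normal_distributed_expectation[OF 2] mean by simp
      then have "distributed M lborel (\<lambda>w. Z w / s) std_normal_density"
        using 2 normal_standard_normal_convert[of s Z 0] by simp
      then have "distr M lborel (\<lambda>w. Z w / s) = std_normal_distribution"
        by (rule distributed_distr_eq_density)
      moreover have "distr M lborel (\<lambda>w. Z w / s) = distr M borel (\<lambda>w. Z w / s)"
        by (rule distr_cong) auto
      ultimately show ?thesis using 2 by (intro exI[of _ s] exI[of _ "\<lambda>w. Z w / s"]) auto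
    qed
  qed
  then have "\<exists>s. integrable M Z \<and> integrable M (\<lambda>w. (Z w)\<^sup>2) \<and> expectation (\<lambda>w. (Z w)\<^sup>2) = s\<^sup>2 \<and>
      has_bochner_integral M (\<lambda>w. exp (Z w)) (exp (s\<^sup>2 / 2)) \<and> (LINT w|M. cis (Z w)) = of_real (exp (- s\<^sup>2 / 2))"
  proof (elim exE disjE conjE)
    fix s U
    assume [measurable]: "U \<in> borel_measurable M" and d: "distr M borel U = std_normal_distribution"
      and ae: "AE w in M. Z w = s * U w"
    have U: "integrable M (\<lambda>w. h (U w)) \<longleftrightarrow> integrable std_normal_distribution h"
        "(LINT w|M. h (U w)) = (LINT x|std_normal_distribution. h x)"
      if [measurable]: "h \<in> borel_measurable borel" for h :: "real \<Rightarrow> 'b::{banach,second_countable_topology}"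
      unfolding d[symmetric] by (simp_all add: integrable_distr_eq integral_distr)
    have i1: "integrable M U"
      using U(1)[of "\<lambda>x. x"] integrable_std_normal_distribution_moment[of 1] by simp
    have i2: "integrable M (\<lambda>w. (U w)\<^sup>2)" "expectation (\<lambda>w. (U w)\<^sup>2) = 1"
      using U[of "\<lambda>x. x\<^sup>2"] integrable_std_normal_distribution_moment[of 2] std_normal_distribution_even_moments(1)[of 1]
      by simp_all
    have e: "has_bochner_integral M (\<lambda>w. exp (s * U w)) (exp (s\<^sup>2 / 2))"
    proof (rule has_bochner_integral_nn_integral)
      have "(\<integral>\<^sup>+w. ennreal (exp (s * U w)) \<partial>M) = (\<integral>\<^sup>+x. ennreal (exp (s * x)) \<partial>distr M borel U)"
        by (subst nn_integral_distr) auto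
      then show "(\<integral>\<^sup>+w. ennreal (exp (s * U w)) \<partial>M) = ennreal (exp (s\<^sup>2 / 2))"
        unfolding d std_normal_exp_linear .
    qed auto
    have c: "(LINT w|M. cis (s * U w)) = of_real (exp (- s\<^sup>2 / 2))"
      using U(2)[of "\<lambda>x. cis (s * x)"] unfolding std_normal_cis by simp
    show ?thesis
    proof (intro exI[of _ s] conjI)
      show "integrable M Z"
        by (rule integrable_cong_AE_imp[OF integrable_mult_right[OF i1, of s]]) (use ae in auto)
      have ae2: "AE w in M. s\<^sup>2 * (U w)\<^sup>2 = (Z w)\<^sup>2"
        using ae by eventually_elim (simp add: power_mult_distrib)
      show "integrable M (\<lambda>w. (Z w)\<^sup>2)"
        by (rule integrable_cong_AE_imp[OF integrable_mult_right[OF i2(1), of "s\<^sup>2"] _ ae2]) simp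
      have "expectation (\<lambda>w. (Z w)\<^sup>2) = expectation (\<lambda>w. s\<^sup>2 * (U w)\<^sup>2)"
        by (rule integral_cong_AE) (use ae2 in auto)
      then show "expectation (\<lambda>w. (Z w)\<^sup>2) = s\<^sup>2" using i2(2) by simp
      show "has_bochner_integral M (\<lambda>w. exp (Z w)) (exp (s\<^sup>2 / 2))"
        by (rule has_bochner_integralI_AE[OF e]) (use ae in auto)
      have "(LINT w|M. cis (Z w)) = (LINT w|M. cis (s * U w))"
        by (rule integral_cong_AE) (use ae in auto)
      then show "(LINT w|M. cis (Z w)) = of_real (exp (- s\<^sup>2 / 2))" unfolding c .
    qed
  next
    assume ae: "AE w in M. Z w = 0"
    show ?thesis
    proof (intro exI[of _ 0] conjI)
      have z: "has_bochner_integral M Z 0"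
        by (rule has_bochner_integralI_AE[OF has_bochner_integral_zero]) (use ae in auto)
      show "integrable M Z" using z by (simp add: has_bochner_integral_iff)
      have z: "has_bochner_integral M (\<lambda>w. (Z w)\<^sup>2) 0"
        by (rule has_bochner_integralI_AE[OF has_bochner_integral_zero]) (use ae in auto)
      then show "integrable M (\<lambda>w. (Z w)\<^sup>2)" "expectation (\<lambda>w. (Z w)\<^sup>2) = 0\<^sup>2"
        by (auto simp: has_bochner_integral_iff)
      have "has_bochner_integral M (\<lambda>w. 1::real) 1"
        by (simp add: has_bochner_integral_iff prob_space)
      then show "has_bochner_integral M (\<lambda>w. exp (Z w)) (exp (0\<^sup>2 / 2))"
        by (auto intro!: has_bochner_integralI_AE[of M "\<lambda>w. 1"] simp: ae)
      have "(LINT w|M. cis (Z w)) = (LINT w|M. 1)"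
        by (rule integral_cong_AE) (use ae in \<open>auto simp: cis_zero\<close>)
      then show "(LINT w|M. cis (Z w)) = of_real (exp (- 0\<^sup>2 / 2))" by (simp add: prob_space)
    qed
  qed
  then show "integrable M Z" and "integrable M (\<lambda>w. (Z w)\<^sup>2)"
    and "has_bochner_integral M (\<lambda>w. exp (Z w)) (exp (expectation (\<lambda>w. (Z w)\<^sup>2) / 2))"
    and "(LINT w|M. cis (Z w)) = of_real (exp (- expectation (\<lambda>w. (Z w)\<^sup>2) / 2))"
    by auto
qed

lemma integrable_product_of_squares:
  fixes X Y :: "'a \<Rightarrow> real"
  assumes [measurable]: "X \<in> borel_measurable M" "Y \<in> borel_measurable M"
    and "integrable M (\<lambda>w. (X w)\<^sup>2)" "integrable M (\<lambda>w. (Y w)\<^sup>2)"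
  shows "integrable M (\<lambda>w. X w * Y w)"
proof (rule Bochner_Integration.integrable_bound)
  show "integrable M (\<lambda>w. (X w)\<^sup>2 + (Y w)\<^sup>2)" using assms by simp
  have "\<bar>a * b\<bar> \<le> a\<^sup>2 + b\<^sup>2" for a b :: real
  proof -
    have "2 * (\<bar>a\<bar> * \<bar>b\<bar>) \<le> a\<^sup>2 + b\<^sup>2" "0 \<le> \<bar>a\<bar> * \<bar>b\<bar>"
      using sum_squares_bound[of "\<bar>a\<bar>" "\<bar>b\<bar>"] by simp_all
    then show ?thesis unfolding abs_mult by linarith
  qed
  then show "AE w in M. norm (X w * Y w) \<le> norm ((X w)\<^sup>2 + (Y w)\<^sup>2)" by (simp add: abs_of_nonneg)
qed measurable

lemma stationary_gaussian_linear:
  fixes t :: int and a :: "nat \<Rightarrow> real" and n :: nat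
  assumes X: "stationary_gaussian M r X"
  defines "Z \<equiv> \<lambda>w. \<Sum>p<n. a p * X (t + int p) w"
  shows "gaussian_rv M Z" and "expectation Z = 0"
    and "expectation (\<lambda>w. (Z w)\<^sup>2) = bilin n (\<lambda>p q. r (int p - int q)) a a"
    and "X m \<in> borel_measurable M"
proof -
  have gauss: "gaussian_rv M (\<lambda>w. \<Sum>m\<in>I. a m * X m w)" if "finite I" for I a
    using X that unfolding stationary_gaussian_def gaussian_process_def by auto
  have mean: "expectation (X m) = 0" and corr: "expectation (\<lambda>w. X (k + m) w * X k w) = r m" for m k
    using X unfolding stationary_gaussian_def by auto
  have gX: "gaussian_rv M (X m)" for m using gauss[of "{m}" "\<lambda>_. 1"] by simp
  then show "X m \<in> borel_measurable M" for m by (simp add: gaussian_rv_def)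
  note [measurable] = this
  \<comment> \<open>The integral of a non-integrable function is 0 by convention, so the prescribed
    correlations can be used only after Gaussianity has supplied integrability of squares and
    products.\<close>
  have int: "integrable M (X m)" "integrable M (\<lambda>w. (X m w)\<^sup>2)" for m
    using centered_gaussian_transforms[OF gX mean] by auto
  have prod: "integrable M (\<lambda>w. X m w * X k w)" for m k
    by (rule integrable_product_of_squares) (use int in auto)
  have Z: "Z = (\<lambda>w. \<Sum>m\<in>(\<lambda>p. t + int p) ` {..<n}. a (nat (m - t)) * X m w)"
    unfolding Z_def by (subst sum.reindex) (auto simp: inj_on_def)
  show "gaussian_rv M Z" unfolding Z by (rule gauss) simp
  show "expectation Z = 0" unfolding Z_def using int mean by simp
  have "expectation (\<lambda>w. (Z w)\<^sup>2) = expectation (\<lambda>w. \<Sum>p<n. \<Sum>q<n. a p * a q * (X (t + int p) w * X (t + int q) w))"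
    unfolding Z_def power2_eq_square sum_product by (simp add: mult_ac)
  also have "\<dots> = (\<Sum>p<n. \<Sum>q<n. a p * a q * expectation (\<lambda>w. X (t + int p) w * X (t + int q) w))"
    using prod by simp
  also have "\<dots> = bilin n (\<lambda>p q. r (int p - int q)) a a"
    unfolding bilin_def
  proof (intro sum.cong refl)
    fix p q
    show "a p * a q * expectation (\<lambda>w. X (t + int p) w * X (t + int q) w) = r (int p - int q) * a p * a q"
      using corr[of "t + int q" "int p - int q"] by (simp add: algebra_simps)
  qed
  finally show "expectation (\<lambda>w. (Z w)\<^sup>2) = bilin n (\<lambda>p q. r (int p - int q)) a a" .
qed

end

definition noisy_acf :: "(int \<Rightarrow> real) \<Rightarrow> real \<Rightarrow> int \<Rightarrow> real" where
  "noisy_acf r v m = r m + (if m = 0 then v else 0)"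

context prob_space
begin

text \<open>Signal and noise parts are independent, so their transforms multiply and the mixed
  second moment vanishes. The sum need not be shown to be Gaussian: these transforms and moments are
  what \<open>gaussian_vector\<close> asks for.\<close>

lemma noisy_realization_linear:
  fixes t :: int and a :: "nat \<Rightarrow> real" and n :: nat
  assumes Y: "noisy_realization M r v Y"
  defines "Z \<equiv> \<lambda>w. \<Sum>p<n. a p * Y (t + int p) w"
  defines "q \<equiv> bilin n (\<lambda>p q. noisy_acf r v (int p - int q)) a a"
  shows "Y m \<in> borel_measurable M"
    and "integrable M (\<lambda>w. (Z w)\<^sup>2)" and "expectation (\<lambda>w. (Z w)\<^sup>2) = q"
    and "(\<integral>\<^sup>+w. ennreal (exp (Z w)) \<partial>M) = ennreal (exp (q / 2))"
    and "(LINT w|M. cis (Z w)) = of_real (exp (- q / 2))"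
proof -
  obtain X W where X: "stationary_gaussian M r X" and W: "stationary_gaussian M (\<lambda>m. if m = 0 then v else 0) W"
    and ind: "indep_var path_space (trajectory X) path_space (trajectory W)"
    and Y_eq: "\<And>m w. w \<in> space M \<Longrightarrow> Y m w = X m w + W m w"
    using Y unfolding noisy_realization_def white_gaussian_noise_def by auto
  note X' = stationary_gaussian_linear[OF X] and W' = stationary_gaussian_linear[OF W]
  have [measurable]: "X m \<in> borel_measurable M" "W m \<in> borel_measurable M" for m
    using X'(4) W'(4) by auto
  have [measurable]: "Y m \<in> borel_measurable M" for m
    by (subst measurable_cong[OF Y_eq]) auto
  then show "Y m \<in> borel_measurable M" .
  define \<phi> where "\<phi> = (\<lambda>x::int \<Rightarrow> real. \<Sum>p<n. a p * x (t + int p))"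
  have \<phi>[measurable]: "\<phi> \<in> borel_measurable path_space" unfolding \<phi>_def by measurable
  define ZX where "ZX = (\<lambda>w. \<Sum>p<n. a p * X (t + int p) w)"
  define ZW where "ZW = (\<lambda>w. \<Sum>p<n. a p * W (t + int p) w)"
  have [measurable]: "ZX \<in> borel_measurable M" "ZW \<in> borel_measurable M"
    unfolding ZX_def ZW_def by measurable
  have ZXW: "ZX = \<phi> \<circ> trajectory X" "ZW = \<phi> \<circ> trajectory W"
    by (auto simp: ZX_def ZW_def \<phi>_def trajectory_def fun_eq_iff)
  have Z: "Z w = ZX w + ZW w" if "w \<in> space M" for w
    using that by (simp add: Z_def ZX_def ZW_def Y_eq distrib_left sum.distrib)
  have ind': "indep_var borel (\<lambda>w. h (ZX w)) borel (\<lambda>w. h (ZW w))" if [measurable]: "h \<in> borel_measurable borel"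
    for h :: "real \<Rightarrow> 'b::topological_space"
  proof -
    have "h \<circ> \<phi> \<in> borel_measurable path_space" by measurable
    from indep_var_compose[OF ind this this] show ?thesis
      by (simp add: ZXW comp_def)
  qed
  define qX where "qX = expectation (\<lambda>w. (ZX w)\<^sup>2)"
  define qW where "qW = expectation (\<lambda>w. (ZW w)\<^sup>2)"
  have "gaussian_rv M ZX" "expectation ZX = 0" "gaussian_rv M ZW" "expectation ZW = 0"
    unfolding ZX_def ZW_def by (rule X' W')+
  note TX = centered_gaussian_transforms[OF this(1,2), folded qX_def]
    and TW = centered_gaussian_transforms[OF this(3,4), folded qW_def]
  have q: "q = qX + qW"
    unfolding q_def qX_def qW_def ZX_def ZW_def X'(3) W'(3) bilin_def noisy_acf_def
    by (simp add: sum.distrib distrib_right)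
  have cross: "integrable M (\<lambda>w. ZX w * ZW w)" "expectation (\<lambda>w. ZX w * ZW w) = 0"
    using indep_var_integrable[OF ind'[of "\<lambda>x. x"] TX(1) TW(1)]
      indep_var_lebesgue_integral[OF ind'[of "\<lambda>x. x"] TX(1) TW(1)]
      \<open>expectation ZX = 0\<close> by auto
  have sq: "(Z w)\<^sup>2 = (ZX w)\<^sup>2 + 2 * (ZX w * ZW w) + (ZW w)\<^sup>2" if "w \<in> space M" for w
    using Z[OF that] by (simp add: power2_sum)
  show "integrable M (\<lambda>w. (Z w)\<^sup>2)"
    by (subst Bochner_Integration.integrable_cong[OF refl sq]) (use TX TW cross in auto)
  have "expectation (\<lambda>w. (Z w)\<^sup>2) = expectation (\<lambda>w. (ZX w)\<^sup>2 + 2 * (ZX w * ZW w) + (ZW w)\<^sup>2)"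
    by (rule Bochner_Integration.integral_cong[OF refl sq])
  then show "expectation (\<lambda>w. (Z w)\<^sup>2) = q"
    using TX(2) TW(2) cross by (simp add: q qX_def qW_def)
  have eX: "integrable M (\<lambda>w. exp (ZX w))" "expectation (\<lambda>w. exp (ZX w)) = exp (qX / 2)"
    and eW: "integrable M (\<lambda>w. exp (ZW w))" "expectation (\<lambda>w. exp (ZW w)) = exp (qW / 2)"
    using TX(3) TW(3) by (auto simp: has_bochner_integral_iff)
  have e: "integrable M (\<lambda>w. exp (ZX w) * exp (ZW w))" "expectation (\<lambda>w. exp (ZX w) * exp (ZW w)) = exp (q / 2)"
    using indep_var_integrable[OF ind'[of exp] eX(1) eW(1)]
      indep_var_lebesgue_integral[OF ind'[of exp] eX(1) eW(1)] eX(2) eW(2)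
    by (auto simp: q exp_add[symmetric] add_divide_distrib)
  have "(\<integral>\<^sup>+w. ennreal (exp (Z w)) \<partial>M) = (\<integral>\<^sup>+w. ennreal (exp (ZX w) * exp (ZW w)) \<partial>M)"
    by (intro nn_integral_cong) (simp add: Z exp_add)
  also have "\<dots> = ennreal (exp (q / 2))"
    using e by (subst nn_integral_eq_integral) auto
  finally show "(\<integral>\<^sup>+w. ennreal (exp (Z w)) \<partial>M) = ennreal (exp (q / 2))" .
  have ic: "complex_integrable M (\<lambda>w. cis (ZX w))" "complex_integrable M (\<lambda>w. cis (ZW w))"
    by (auto intro!: integrable_const_bound[where B=1])
  have "(LINT w|M. cis (Z w)) = (LINT w|M. cis (ZX w) * cis (ZW w))"
    by (intro Bochner_Integration.integral_cong refl) (simp add: Z cis_mult)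
  also have "\<dots> = of_real (exp (- q / 2))"
    unfolding indep_var_lebesgue_integral[OF ind'[of cis] ic, simplified] TX(4) TW(4)
    by (simp add: q exp_add[symmetric] add_divide_distrib of_real_mult[symmetric] del: of_real_mult of_real_exp)
  finally show "(LINT w|M. cis (Z w)) = of_real (exp (- q / 2))" .
qed

end

section \<open>Concentration of the estimates\<close>

lemma sum_swap3: "(\<Sum>k\<in>I. \<Sum>p\<in>J. \<Sum>q\<in>K. f k p q) = (\<Sum>p\<in>J. \<Sum>q\<in>K. \<Sum>k\<in>I. f k p q)"
  by (rule trans[OF sum.swap]) (rule sum.cong[OF refl sum.swap])

lemma sum_combination_square:
  fixes B :: "nat \<Rightarrow> nat \<Rightarrow> real"
  shows "(\<Sum>k<m. (\<Sum>p<n. B k p * z p)\<^sup>2) = bilin n (\<lambda>p q. \<Sum>k<m. B k p * B k q) z z"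
proof -
  have "(\<Sum>k<m. (\<Sum>p<n. B k p * z p)\<^sup>2) = (\<Sum>k<m. \<Sum>p<n. \<Sum>q<n. B k p * B k q * z p * z q)"
    by (simp add: power2_eq_square sum_product mult_ac)
  also have "\<dots> = (\<Sum>p<n. \<Sum>q<n. \<Sum>k<m. B k p * B k q * z p * z q)"
    by (rule sum_swap3)
  also have "\<dots> = bilin n (\<lambda>p q. \<Sum>k<m. B k p * B k q) z z"
    unfolding bilin_def by (simp add: sum_distrib_right)
  finally show ?thesis .
qed

lemma bilin_combination:
  "bilin m (\<lambda>k l. bilin n R (B k) (B l)) a a = bilin n R (\<lambda>p. \<Sum>k<m. B k p * a k) (\<lambda>p. \<Sum>k<m. B k p * a k)"
proof -
  have "bilin m (\<lambda>k l. bilin n R (B k) (B l)) a a =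
      (\<Sum>k<m. \<Sum>l<m. \<Sum>p<n. \<Sum>q<n. R p q * (B k p * a k) * (B l q * a l))"
    unfolding bilin_def by (simp add: sum_distrib_right sum_distrib_left mult_ac)
  also have "\<dots> = (\<Sum>k<m. \<Sum>p<n. \<Sum>q<n. \<Sum>l<m. R p q * (B k p * a k) * (B l q * a l))"
    by (intro sum.cong refl sum_swap3)
  also have "\<dots> = (\<Sum>p<n. \<Sum>q<n. \<Sum>k<m. \<Sum>l<m. R p q * (B k p * a k) * (B l q * a l))"
    by (rule sum_swap3)
  also have "\<dots> = bilin n R (\<lambda>p. \<Sum>k<m. B k p * a k) (\<lambda>p. \<Sum>k<m. B k p * a k)"
    unfolding bilin_def by (intro sum.cong refl) (simp add: sum_product sum_distrib_left mult_ac)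
  finally show ?thesis .
qed

text \<open>A matrix and its transpose have the same norm. With \<open>u\<close> the transpose
  applied to \<open>a\<close>, \<open>2 |u|^2 = 2 <a, B u> <= \<alpha> |a|^2 + |B u|^2 / \<alpha> <=
  \<alpha> |a|^2 + |u|^2\<close>.\<close>

lemma transpose_norm_le:
  assumes \<alpha>: "0 < \<alpha>" and B: "\<And>z. (\<Sum>k<m. (\<Sum>p<n. B k p * z p)\<^sup>2) \<le> \<alpha> * (\<Sum>p<n. (z p)\<^sup>2)"
  shows "(\<Sum>p<n. (\<Sum>k<m. B k p * a k)\<^sup>2) \<le> \<alpha> * (\<Sum>k<m. (a k)\<^sup>2 :: real)"
proof -
  define u where "u = (\<lambda>p. \<Sum>k<m. B k p * a k)"
  define v where "v = (\<lambda>k. \<Sum>p<n. B k p * u p)"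
  let ?U = "\<Sum>p<n. (u p)\<^sup>2"
  have "?U = (\<Sum>p<n. \<Sum>k<m. B k p * a k * u p)"
    unfolding power2_eq_square by (subst (1) u_def) (simp add: sum_distrib_right)
  also have "\<dots> = (\<Sum>k<m. a k * v k)"
    unfolding v_def by (subst sum.swap) (simp add: sum_distrib_left mult_ac)
  finally have U: "?U = (\<Sum>k<m. a k * v k)" .
  have amgm: "2 * (x * y) \<le> \<alpha> * x\<^sup>2 + y\<^sup>2 / \<alpha>" for x y :: real
  proof -
    have "0 \<le> (\<alpha> * x - y)\<^sup>2 / \<alpha>" using \<alpha> by simp
    also have "(\<alpha> * x - y)\<^sup>2 / \<alpha> = \<alpha> * x\<^sup>2 + y\<^sup>2 / \<alpha> - 2 * (x * y)"
      using \<alpha> by (simp add: power2_diff field_simps power2_eq_square)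
    finally show ?thesis by simp
  qed
  have "2 * ?U \<le> (\<Sum>k<m. \<alpha> * (a k)\<^sup>2 + (v k)\<^sup>2 / \<alpha>)"
    unfolding U sum_distrib_left by (intro sum_mono amgm)
  also have "\<dots> = \<alpha> * (\<Sum>k<m. (a k)\<^sup>2) + (\<Sum>k<m. (v k)\<^sup>2) / \<alpha>"
    by (simp add: sum.distrib sum_distrib_left sum_divide_distrib)
  also have "(\<Sum>k<m. (v k)\<^sup>2) / \<alpha> \<le> ?U"
    using B[of u] \<alpha> unfolding v_def by (simp add: field_simps)
  finally show ?thesis unfolding u_def by simp
qed

lemma spectrum_noisy_acf:
  assumes "spectrum r s"
  shows "spectrum (noisy_acf r v) (\<lambda>f. s f + v)"
proof -
  have c: "set_integrable lborel {0..<1} (\<lambda>f. of_real (F f) * cis (2 * pi * f * of_int m))" if "spectrum a F" for a F m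
    by (rule set_integrable_mult_bounded[OF spectrum_integrable[OF that], where C=1]) auto
  have "(LINT f:{0..<1}|lborel. of_real (s f + v) * cis (2 * pi * f * of_int m)) = complex_of_real (noisy_acf r v m)" for m
    using set_integral_add(2)[OF c[OF assms] c[OF spectrum_delta[of v]], of m m]
      assms spectrum_delta[of v] unfolding spectrum_def noisy_acf_def
    by (simp add: distrib_right)
  then show ?thesis
    using assms spectrum_delta[of v] unfolding spectrum_def by (simp add: set_integral_add(1))
qed

context prob_space
begin

text \<open>Factor the kernel as the transpose of \<open>B\<close> times \<open>B\<close>, and let
  \<open>y\<close> be \<open>B\<close> applied to the samples; its covariance \<open>D\<close> is
  \<open>B R\<close> times the transpose of \<open>B\<close>. The covariance \<open>R\<close>
  contributes the bound \<open>C\<close>, the transpose of \<open>B\<close> the bound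
  \<open>A / n\<close>, and the trace of \<open>D\<close> is the trace of kernel times
  \<open>R\<close>.\<close>

lemma bt_est_gaussian_vector:
  assumes Y: "noisy_realization M r v Y" and r: "spectrum r s" and s: "\<And>f. f \<in> {0..<1} \<Longrightarrow> s f + v \<le> C"
    and g: "spectrum g G" "\<And>f. f \<in> {0..<1} \<Longrightarrow> 0 \<le> G f \<and> G f \<le> A"
    and n: "0 < n" and AC: "0 < A" "0 < C"
  obtains B D where "gaussian_vector M n (\<lambda>k w. \<Sum>p<n. B k p * Y (t + int p) w) D (A * C / real n)"
    and "\<And>w. (\<Sum>k<n. (\<Sum>p<n. B k p * Y (t + int p) w)\<^sup>2) =
      bilin n (bt_kernel g n f) (\<lambda>p. Y (t + int p) w) (\<lambda>p. Y (t + int p) w)"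
    and "(\<Sum>k<n. D k k) = bt_mean g n (noisy_acf r v) f"
proof -
  let ?c = "bt_kernel g n f"
  let ?R = "\<lambda>p q. noisy_acf r v (int p - int q)"
  obtain B where B: "\<And>p q. p < n \<Longrightarrow> q < n \<Longrightarrow> ?c p q = (\<Sum>k<n. B k p * B k q)"
    using psd_factorization[of n ?c, OF bt_kernel_sym bt_kernel_bounds(1)[OF g]] spectrum_even[OF g(1)] by blast
  define y where "y = (\<lambda>k w. \<Sum>p<n. B k p * Y (t + int p) w)"
  define D where "D = (\<lambda>k l. bilin n ?R (B k) (B l))"
  have sq: "(\<Sum>k<n. (\<Sum>p<n. B k p * z p)\<^sup>2) = bilin n ?c z z" for z
    unfolding sum_combination_square by (rule bilin_cong) (simp add: B)
  have comb: "(\<Sum>k<n. a k * y k w) = (\<Sum>p<n. (\<Sum>k<n. B k p * a k) * Y (t + int p) w)" for a w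
    unfolding y_def sum_distrib_left sum_distrib_right by (subst sum.swap) (simp add: mult_ac)
  have DR: "bilin n D a a = bilin n ?R (\<lambda>p. \<Sum>k<n. B k p * a k) (\<lambda>p. \<Sum>k<n. B k p * a k)" for a
    unfolding D_def by (rule bilin_combination)
  note Y' = noisy_realization_linear(2-5)[OF Y, where t=t and n=n]
  have gv: "gaussian_vector M n y D (A * C / real n)"
  proof (unfold_locales)
    show "y k \<in> borel_measurable M" for k
      unfolding y_def using noisy_realization_linear(1)[OF Y] by measurable
    show "D k l = D l k" for k l
    proof -
      have "?R p q = ?R q p" for p q
        using spectrum_even[OF spectrum_noisy_acf[OF r, of v], of "int p - int q"] by simp
      then show ?thesis unfolding D_def bilin_def by (subst sum.swap) (simp add: mult_ac)
    qed
    show "(\<integral>\<^sup>+w. ennreal (exp (\<Sum>k<n. a k * y k w)) \<partial>M) = ennreal (exp (bilin n D a a / 2))" for a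
      unfolding comb DR by (rule Y'(3))
    show "(LINT w|M. cis (\<Sum>k<n. a k * y k w)) = of_real (exp (- bilin n D a a / 2))" for a
      unfolding comb DR by (rule Y'(4))
    show "integrable M (\<lambda>w. (y k w)\<^sup>2)" and "expectation (\<lambda>w. (y k w)\<^sup>2) = D k k" for k
      unfolding y_def D_def by (rule Y')+
    show "0 < A * C / real n" using n AC by simp
    show "bilin n D a a \<le> A * C / real n * (\<Sum>k<n. (a k)\<^sup>2)" for a
    proof -
      let ?u = "\<lambda>p. \<Sum>k<n. B k p * a k"
      have "bilin n D a a \<le> C * (\<Sum>p<n. (?u p)\<^sup>2)"
        unfolding DR using s by (intro acf_form_le[OF spectrum_noisy_acf[OF r]])
      also have "(\<Sum>p<n. (?u p)\<^sup>2) \<le> A / real n * (\<Sum>k<n. (a k)\<^sup>2)"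
        by (rule transpose_norm_le) (use n AC bt_kernel_bounds(2)[OF g] in \<open>simp_all add: sq\<close>)
      finally show ?thesis using AC by (simp add: mult_ac)
    qed
  qed
  have tr: "(\<Sum>k<n. D k k) = bt_mean g n (noisy_acf r v) f"
  proof -
    have "(\<Sum>k<n. D k k) = (\<Sum>p<n. \<Sum>q<n. \<Sum>k<n. ?R p q * B k p * B k q)"
      unfolding D_def bilin_def by (rule sum_swap3)
    also have "\<dots> = bt_mean g n (noisy_acf r v) f"
      unfolding bt_mean_def by (intro sum.cong refl) (simp add: B sum_distrib_left mult_ac)
    finally show ?thesis .
  qed
  show thesis by (rule that[OF gv[unfolded y_def] sq tr])
qed

text \<open>The mean is the trace of \<open>D\<close>, a sum of second moments.\<close>

lemma bt_mean_nonneg: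
  assumes Y: "noisy_realization M r v Y" and r: "spectrum r s" and s: "\<And>f. f \<in> {0..<1} \<Longrightarrow> s f + v \<le> C"
    and g: "spectrum g G" "\<And>f. f \<in> {0..<1} \<Longrightarrow> 0 \<le> G f \<and> G f \<le> A"
    and n: "0 < n" and AC: "0 < A" "0 < C"
  shows "0 \<le> bt_mean g n (noisy_acf r v) f"
proof (rule bt_est_gaussian_vector[OF assms, where t=0 and f=f])
  fix B D
  assume gv: "gaussian_vector M n (\<lambda>k w. \<Sum>p<n. B k p * Y (0 + int p) w) D (A * C / real n)"
    and D: "(\<Sum>k<n. D k k) = bt_mean g n (noisy_acf r v) f"
  have "0 \<le> D k k" if "k < n" for k
    unfolding gaussian_vector.second_moment[OF gv that, symmetric]
    by (rule Bochner_Integration.integral_nonneg) simp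
  then show ?thesis unfolding D[symmetric] by (intro sum_nonneg) auto
qed

end

section \<open>Chernoff bound for the integrated deviation\<close>

lemma inverse_sqrt_power_le:
  fixes \<kappa> :: real
  assumes "0 \<le> \<kappa>" "\<kappa> \<le> 1 / 2"
  shows "(1 / sqrt (1 - \<kappa>)) ^ n \<le> exp (\<kappa> * real n)"
proof -
  have "1 \<le> (1 - \<kappa>) * (1 + 2 * \<kappa>)"
    using mult_left_mono[of \<kappa> "1/2" \<kappa>] assms by (simp add: algebra_simps)
  also have "\<dots> \<le> (1 - \<kappa>) * exp (2 * \<kappa>)"
    using assms by (intro mult_left_mono exp_ge_add_one_self) auto
  finally have "sqrt 1 \<le> sqrt ((1 - \<kappa>) * exp (2 * \<kappa>))" by (rule real_sqrt_le_mono)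
  also have "\<dots> = sqrt (1 - \<kappa>) * exp \<kappa>"
    by (simp add: real_sqrt_mult exp_double)
  finally have "1 / sqrt (1 - \<kappa>) \<le> exp \<kappa>"
    using assms by (simp add: field_simps)
  then have "(1 / sqrt (1 - \<kappa>)) ^ n \<le> exp \<kappa> ^ n"
    using assms by (intro power_mono) auto
  then show ?thesis by (simp add: exp_of_nat2_mult)
qed

text \<open>The interval [0,1) as a probability space, so that integration over frequencies is an
  expectation and Jensen's inequality applies to it.\<close>

abbreviation unit_uniform :: "real measure" where
  "unit_uniform \<equiv> density lborel (\<lambda>f. ennreal (indicator {0..<1} f))"

lemma prob_space_unit_uniform: "prob_space unit_uniform"
proof
  have "emeasure unit_uniform (space unit_uniform) = (\<integral>\<^sup>+f. indicator {0..<1::real} f \<partial>lborel)"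
    by (simp add: emeasure_density ennreal_indicator)
  also have "\<dots> = 1" by simp
  finally show "emeasure unit_uniform (space unit_uniform) = 1" .
qed

lemma integral_unit_uniform:
  fixes h :: "real \<Rightarrow> real"
  assumes "h \<in> borel_measurable borel"
  shows "(LINT f|unit_uniform. h f) = (LINT f:{0..<1}|lborel. h f)"
  unfolding set_lebesgue_integral_def using assms by (subst integral_density) auto

lemma continuous_bt_kernel: "continuous_on S (\<lambda>f. bt_kernel g n f p q)"
  unfolding bt_kernel_def divide_inverse by (intro continuous_intros)

lemma measurable_bt_kernel[measurable]: "(\<lambda>f. bt_kernel g n f p q) \<in> borel_measurable borel"
  by (rule borel_measurable_continuous_onI[OF continuous_bt_kernel])

lemma measurable_bt_mean[measurable]: "bt_mean g n r \<in> borel_measurable borel"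
  unfolding bt_mean_def[abs_def] by measurable

lemma continuous_bt_bilin: "continuous_on S (\<lambda>f. bilin n (bt_kernel g n f) z z)"
  unfolding bilin_def by (intro continuous_intros continuous_bt_kernel)

lemma continuous_bt_mean: "continuous_on S (bt_mean g n r)"
  unfolding bt_mean_def[abs_def] by (intro continuous_intros continuous_bt_kernel)

lemma set_integrable_unit_continuous:
  fixes h :: "real \<Rightarrow> real"
  assumes "continuous_on {0..1} h"
  shows "set_integrable lborel {0..<1} h"
  by (rule set_integrable_subset[of lborel "{0..1}"])
    (use borel_integrable_compact[OF compact_Icc assms] in \<open>auto simp: set_integrable_def\<close>)

context prob_space
begin

lemma bt_est_concentration:
  fixes t :: int
  assumes Y: "noisy_realization M r v Y" and r: "spectrum r s" and s: "\<And>f. f \<in> {0..<1} \<Longrightarrow> s f + v \<le> C"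
    and g: "spectrum g G" "\<And>f. f \<in> {0..<1} \<Longrightarrow> 0 \<le> G f \<and> G f \<le> A"
    and n: "0 < n" and AC: "0 < A" "0 < C" and small: "2 * ln (real n) / real n \<le> 1 / 2"
  defines "dev \<equiv> \<lambda>w. LINT f:{0..<1}|lborel.
      \<bar>bilin n (bt_kernel g n f) (\<lambda>p. Y (t + int p) w) (\<lambda>p. Y (t + int p) w) - bt_mean g n (noisy_acf r v) f\<bar>"
  shows "dev \<in> borel_measurable M"
    and "prob {w \<in> space M. 4 * A * C * sqrt (2 * ln (real n) / real n) < dev w} \<le> 2 / (real n)\<^sup>2"
proof -
  interpret U: prob_space unit_uniform by (rule prob_space_unit_uniform)
  interpret PU: pair_prob_space M unit_uniform ..
  have [measurable]: "Y m \<in> borel_measurable M" for m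
    using noisy_realization_linear(1)[OF Y] .
  define h where "h = (\<lambda>w f. \<bar>bilin n (bt_kernel g n f) (\<lambda>p. Y (t + int p) w) (\<lambda>p. Y (t + int p) w) - bt_mean g n (noisy_acf r v) f\<bar>)"
  have [measurable]: "(\<lambda>(w, f). h w f) \<in> borel_measurable (M \<Otimes>\<^sub>M unit_uniform)"
    unfolding h_def bilin_def by measurable
  have hw: "continuous_on S (h w)" for w S
    unfolding h_def by (intro continuous_intros continuous_bt_bilin continuous_bt_mean)
  have [measurable]: "h w \<in> borel_measurable borel" for w
    by (rule borel_measurable_continuous_onI[OF hw])
  have dev: "dev = (\<lambda>w. LINT f|unit_uniform. h w f)"
    by (simp add: fun_eq_iff dev_def integral_unit_uniform) (simp add: h_def)
  show devm[measurable]: "dev \<in> borel_measurable M" unfolding dev by measurable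
  define \<kappa> where "\<kappa> = 2 * ln (real n) / real n"
  define b where "b = A * C / real n"
  \<comment> \<open>Makes \<open>2 * \<theta> * b = sqrt \<kappa>\<close>, so the moment bound is at
    most \<open>2 * exp (\<kappa> * n)\<close>, which equals \<open>2 * n^2\<close>.\<close>
  define \<theta> where "\<theta> = sqrt \<kappa> / (2 * b)"
  have b: "0 < b" using n AC by (simp add: b_def)
  have \<kappa>: "0 \<le> \<kappa>" "\<kappa> \<le> 1 / 2" using small n by (auto simp: \<kappa>_def)
  have "sqrt \<kappa> < 1" using \<kappa> by (simp add: real_sqrt_lt_1_iff)
  then have \<theta>: "0 \<le> \<theta>" "2 * \<theta> * b = sqrt \<kappa>" "2 * \<theta> * b < 1" using b \<kappa> by (auto simp: \<theta>_def)
  have pointwise: "(\<integral>\<^sup>+w. ennreal (exp (\<theta> * h w f)) \<partial>M) \<le> 2 * ennreal ((real n)\<^sup>2)" for f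
  proof (rule bt_est_gaussian_vector[OF Y r s g n AC, where t=t and f=f, folded b_def])
    fix B D
    assume gv: "gaussian_vector M n (\<lambda>k w. \<Sum>p<n. B k p * Y (t + int p) w) D b"
      and sq: "\<And>w. (\<Sum>k<n. (\<Sum>p<n. B k p * Y (t + int p) w)\<^sup>2) =
        bilin n (bt_kernel g n f) (\<lambda>p. Y (t + int p) w) (\<lambda>p. Y (t + int p) w)"
      and tr: "(\<Sum>k<n. D k k) = bt_mean g n (noisy_acf r v) f"
    have "(\<integral>\<^sup>+w. ennreal (exp (\<theta> * h w f)) \<partial>M) \<le> 2 * ennreal ((1 / sqrt (1 - (2 * \<theta> * b)\<^sup>2)) ^ n)"
      using gaussian_vector.quadratic_deviation_mgf[OF gv \<theta>(1,3)] unfolding sq tr h_def .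
    also have "\<dots> \<le> 2 * ennreal (exp (\<kappa> * real n))"
      using inverse_sqrt_power_le[OF \<kappa>] \<kappa> unfolding \<theta>(2) by (intro mult_left_mono ennreal_leI) auto
    also have "exp (\<kappa> * real n) = (real n)\<^sup>2"
      using n by (simp add: \<kappa>_def exp_double)
    finally show "(\<integral>\<^sup>+w. ennreal (exp (\<theta> * h w f)) \<partial>M) \<le> 2 * ennreal ((real n)\<^sup>2)" .
  qed
  have "(\<integral>\<^sup>+w. ennreal (exp (\<theta> * dev w)) \<partial>M) \<le> (\<integral>\<^sup>+w. \<integral>\<^sup>+f. ennreal (exp (\<theta> * h w f)) \<partial>unit_uniform \<partial>M)"
  proof (rule nn_integral_mono)
    fix w
    have "set_integrable lborel {0..<1} (h w)" by (rule set_integrable_unit_continuous[OF hw])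
    then have "integrable unit_uniform (h w)"
      unfolding set_integrable_def by (subst integrable_density) auto
    from U.nn_integral_exp_ge[OF integrable_mult_right[OF this, of \<theta>]]
    show "ennreal (exp (\<theta> * dev w)) \<le> (\<integral>\<^sup>+f. ennreal (exp (\<theta> * h w f)) \<partial>unit_uniform)"
      by (simp add: dev)
  qed
  also have "\<dots> = (\<integral>\<^sup>+f. \<integral>\<^sup>+w. ennreal (exp (\<theta> * h w f)) \<partial>M \<partial>unit_uniform)"
    by (rule PU.Fubini'[symmetric]) measurable
  also have "\<dots> \<le> (\<integral>\<^sup>+f. 2 * ennreal ((real n)\<^sup>2) \<partial>unit_uniform)"
    by (rule nn_integral_mono) (rule pointwise)
  also have "\<dots> = 2 * ennreal ((real n)\<^sup>2)" by (simp add: U.emeasure_space_1 del: space_density)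
  finally have mgf: "(\<integral>\<^sup>+w. ennreal (exp (\<theta> * dev w)) \<partial>M) \<le> 2 * ennreal ((real n)\<^sup>2)" .
  define T where "T = 4 * A * C * sqrt \<kappa>"
  \<comment> \<open>The factor 4 in \<open>T\<close> makes Markov's inequality gain \<open>n\<close>
    to the power -4 against the moment bound \<open>2 * n^2\<close>.\<close>
  have \<theta>T: "\<theta> * T = 4 * ln (real n)"
  proof -
    have "\<theta> * T = 2 * (sqrt \<kappa> * sqrt \<kappa>) * (A * C / b)" by (simp add: \<theta>_def T_def)
    also have "sqrt \<kappa> * sqrt \<kappa> = \<kappa>" using \<kappa> by simp
    also have "2 * \<kappa> * (A * C / b) = 4 * ln (real n)"
      using n AC by (simp add: b_def \<kappa>_def)
    finally show ?thesis .
  qed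
  have e4: "exp (- (\<theta> * T)) = 1 / (real n) ^ 4"
    unfolding \<theta>T using n exp_of_nat_mult[of 4 "ln (real n)"] by (simp add: exp_minus field_simps)
  have "emeasure M {w \<in> space M. T < dev w} \<le> emeasure M {w \<in> space M. 1 \<le> ennreal (exp (- (\<theta> * T))) * ennreal (exp (\<theta> * dev w))}"
  proof (rule emeasure_mono)
    show "{w \<in> space M. T < dev w} \<subseteq> {w \<in> space M. 1 \<le> ennreal (exp (- (\<theta> * T))) * ennreal (exp (\<theta> * dev w))}"
    proof safe
      fix w assume "T < dev w"
      then have "\<theta> * T \<le> \<theta> * dev w" using \<theta>(1) by (intro mult_left_mono) auto
      then have "1 \<le> exp (- (\<theta> * T)) * exp (\<theta> * dev w)" by (simp add: exp_add[symmetric])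
      then show "1 \<le> ennreal (exp (- (\<theta> * T))) * ennreal (exp (\<theta> * dev w))"
        by (simp add: ennreal_mult'[symmetric])
    qed
  qed measurable
  also have "\<dots> \<le> ennreal (exp (- (\<theta> * T))) * (\<integral>\<^sup>+w. ennreal (exp (\<theta> * dev w)) * indicator (space M) w \<partial>M)"
    by (rule nn_integral_Markov_inequality) auto
  also have "(\<integral>\<^sup>+w. ennreal (exp (\<theta> * dev w)) * indicator (space M) w \<partial>M) = (\<integral>\<^sup>+w. ennreal (exp (\<theta> * dev w)) \<partial>M)"
    by (intro nn_integral_cong) auto
  also have "ennreal (exp (- (\<theta> * T))) * \<dots> \<le> ennreal (exp (- (\<theta> * T))) * (2 * ennreal ((real n)\<^sup>2))"
    by (intro mult_left_mono mgf) auto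
  also have "\<dots> = ennreal (1 / (real n) ^ 4 * (2 * (real n)\<^sup>2))"
    unfolding e4 using ennreal_mult'[of 2 "(real n)\<^sup>2"] ennreal_mult'[of "1 / real n ^ 4" "2 * (real n)\<^sup>2"] by simp
  also have "1 / (real n) ^ 4 * (2 * (real n)\<^sup>2) = 2 / (real n)\<^sup>2"
    using n by (simp add: field_simps power2_eq_square power4_eq_xxxx)
  finally show "prob {w \<in> space M. 4 * A * C * sqrt (2 * ln (real n) / real n) < dev w} \<le> 2 / (real n)\<^sup>2"
    unfolding T_def \<kappa>_def by (simp add: emeasure_eq_measure)
qed

end

section \<open>Spectral distances\<close>

lemma bt_mean_noisy:
  assumes "g 0 = 1" "0 < n"
  shows "bt_mean g n (noisy_acf r v) f = bt_mean g n r f + v"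
proof -
  have "(\<Sum>p<n. \<Sum>q<n. bt_kernel g n f p q * (if int p - int q = 0 then v else 0)) =
      (\<Sum>p<n. \<Sum>q<n. if q = p then v / real n else 0)"
    using assms by (intro sum.cong refl) (auto simp: bt_kernel_def)
  also have "\<dots> = v" using assms by simp
  finally show ?thesis
    unfolding bt_mean_def noisy_acf_def by (simp add: distrib_left sum.distrib)
qed

text \<open>Only lag 0 survives integration over a full period. The integral of the mean enters an
  upper bound on the distance between means.\<close>

lemma integral_bt_mean:
  assumes "g 0 = 1" "0 < n"
  shows "(LINT f:{0..<1}|lborel. bt_mean g n r f) = r 0"
proof -
  have cos: "(LINT f:{0..<1}|lborel. cos (2 * pi * f * of_int k)) = (if k = 0 then 1 else 0)" for k :: int
  proof -
    have "(LINT f|lborel. Re (indicator {0..<1} f *\<^sub>R cis (2 * pi * f * of_int k))) = Re (if k = 0 then 1 else 0)"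
      using integral_cis_int[of k] unfolding set_integrable_def set_lebesgue_integral_def
      by (simp only: integral_Re)
    then show ?thesis unfolding set_lebesgue_integral_def by (simp split: if_splits)
  qed
  have kern: "(LINT f:{0..<1}|lborel. bt_kernel g n f p q * r (int p - int q)) = (if q = p then r 0 / real n else 0)" for p q
  proof -
    have "(LINT f:{0..<1}|lborel. bt_kernel g n f p q * r (int p - int q)) =
        (LINT f:{0..<1}|lborel. g (int p - int q) * r (int p - int q) / real n * cos (2 * pi * f * of_int (int p - int q)))"
      unfolding bt_kernel_def by (simp add: mult_ac)
    also have "\<dots> = g (int p - int q) * r (int p - int q) / real n * (if int p - int q = 0 then 1 else 0)"
      by (simp only: set_integral_mult_right cos)
    also have "\<dots> = (if q = p then r 0 / real n else 0)" using assms by auto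
    finally show ?thesis .
  qed
  have int: "integrable lborel (\<lambda>f. indicator {0..<1} f *\<^sub>R (bt_kernel g n f p q * r (int p - int q)))" for p q
    using set_integrable_unit_continuous[of "\<lambda>f. bt_kernel g n f p q * r (int p - int q)"]
    unfolding set_integrable_def by (simp add: continuous_intros continuous_bt_kernel)
  have "(LINT f:{0..<1}|lborel. bt_mean g n r f) = (\<Sum>p<n. \<Sum>q<n. LINT f:{0..<1}|lborel. bt_kernel g n f p q * r (int p - int q))"
    unfolding bt_mean_def set_lebesgue_integral_def scaleR_sum_right
    using int by (simp only: Bochner_Integration.integral_sum Bochner_Integration.integrable_sum)
  also have "\<dots> = r 0" unfolding kern using assms by simp
  finally show ?thesis .
qed

lemma spectrum_0:
  assumes "spectrum a F"
  shows "(LINT f:{0..<1}|lborel. F f) = a 0"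
proof -
  have "complex_of_real (a 0) = (LINT f:{0..<1}|lborel. of_real (F f) * cis (2 * pi * f * of_int 0))"
    using assms unfolding spectrum_def by blast
  also have "\<dots> = of_real (LINT f:{0..<1}|lborel. F f)"
    unfolding set_lebesgue_integral_def by (subst integral_complex_of_real[symmetric]) (simp add: scaleR_conv_of_real)
  finally show ?thesis by simp
qed

lemma set_integral_unit_const [simp]: "(LINT f:{0..<1::real}|lborel. (c::real)) = c"
  by (simp add: set_lebesgue_integral_def)

lemma set_integrable_unit_const: "set_integrable lborel {0..<1::real} (\<lambda>_. c::real)"
  by (rule set_integrable_unit_continuous) simp

lemma spectrum_0_le:
  assumes "spectrum a F" "\<And>f. f \<in> {0..<1} \<Longrightarrow> F f \<le> C"
  shows "a 0 \<le> C"
proof -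
  have "(LINT f:{0..<1}|lborel. F f) \<le> (LINT f:{0..<1::real}|lborel. C)"
    using assms by (intro set_integral_mono set_integrable_unit_const) (auto simp: spectrum_def)
  then show ?thesis using spectrum_0[OF assms(1)] by simp
qed

text \<open>Each bias is at most \<open>\<mu>\<close> almost everywhere, so the integrand grows by
  at most \<open>2 * \<mu>\<close>, which the factor one half reduces to
  \<open>\<mu>\<close>.\<close>

lemma spec_dist_bt_mean:
  assumes r: "(\<lambda>m. \<bar>r m\<bar>) summable_on UNIV" "(\<lambda>m. \<bar>r' m\<bar>) summable_on UNIV"
    and s: "spectrum r s" "spectrum r' s'" and g: "\<And>m. \<bar>g m\<bar> \<le> 1"
    and \<mu>: "(\<Sum>\<^sub>\<infinity>m\<in>UNIV. \<bar>h_seq g n m\<bar> * \<bar>r m\<bar>) \<le> \<mu>" "(\<Sum>\<^sub>\<infinity>m\<in>UNIV. \<bar>h_seq g n m\<bar> * \<bar>r' m\<bar>) \<le> \<mu>"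
  shows "spec_dist s s' \<le> spec_dist (bt_mean g n r) (bt_mean g n r') + \<mu>"
proof -
  let ?m = "bt_mean g n r" and ?m' = "bt_mean g n r'"
  have int_m: "set_integrable lborel {0..<1} (\<lambda>f. \<bar>?m f - ?m' f\<bar>)"
    by (rule set_integrable_unit_continuous) (intro continuous_intros continuous_bt_mean)
  have int_s: "set_integrable lborel {0..<1} (\<lambda>f. \<bar>s f - s' f\<bar>)"
    using s by (intro set_integrable_abs set_integral_diff) (auto simp: spectrum_def)
  have "(LINT f:{0..<1}|lborel. \<bar>s f - s' f\<bar>) \<le> (LINT f:{0..<1}|lborel. \<bar>?m f - ?m' f\<bar> + 2 * \<mu>)"
    unfolding set_lebesgue_integral_def
  proof (rule integral_mono_AE)
    show "integrable lborel (\<lambda>f. indicator {0..<1} f *\<^sub>R \<bar>s f - s' f\<bar>)"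
      using int_s by (simp add: set_integrable_def)
    show "integrable lborel (\<lambda>f. indicator {0..<1} f *\<^sub>R (\<bar>?m f - ?m' f\<bar> + 2 * \<mu>))"
      using set_integral_add(1)[OF int_m set_integrable_unit_const[of "2 * \<mu>"]] by (simp add: set_integrable_def)
    show "AE f in lborel. indicator {0..<1} f *\<^sub>R \<bar>s f - s' f\<bar> \<le> indicator {0..<1} f *\<^sub>R (\<bar>?m f - ?m' f\<bar> + 2 * \<mu>)"
      using bt_mean_bias[OF r(1) s(1), of g n, OF g] bt_mean_bias[OF r(2) s(2), of g n, OF g]
    proof eventually_elim
      case (elim f)
      then show ?case using \<mu> by (cases "f \<in> {0..<1}") auto
    qed
  qed
  also have "\<dots> = (LINT f:{0..<1}|lborel. \<bar>?m f - ?m' f\<bar>) + 2 * \<mu>"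
    by (simp add: set_integral_add(2)[OF int_m set_integrable_unit_const[of "2 * \<mu>"]])
  finally show ?thesis unfolding spec_dist_def by simp
qed

lemma obs_dist_bt_est:
  assumes "\<And>m. g (- m) = g m"
  shows "obs_dist g n x y = spec_dist (\<lambda>f. bilin n (bt_kernel g n f) (\<lambda>p. x (Suc p)) (\<lambda>p. x (Suc p)))
     (\<lambda>f. bilin n (bt_kernel g n f) (\<lambda>p. y (Suc p)) (\<lambda>p. y (Suc p)))"
  unfolding obs_dist_def spec_dist_def bt_est_eq[of g, OF assms] of_real_diff[symmetric] norm_of_real by simp

lemma spec_dist_triangle:
  fixes F G H :: "real \<Rightarrow> real"
  assumes "continuous_on {0..1} F" "continuous_on {0..1} G" "continuous_on {0..1} H"
  shows "spec_dist F H \<le> spec_dist F G + spec_dist G H"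
proof -
  have int: "set_integrable lborel {0..<1} (\<lambda>f. \<bar>F f - G f\<bar>)" "set_integrable lborel {0..<1} (\<lambda>f. \<bar>G f - H f\<bar>)"
      "set_integrable lborel {0..<1} (\<lambda>f. \<bar>F f - H f\<bar>)"
    by (rule set_integrable_unit_continuous, intro continuous_intros assms)+
  have "(LINT f:{0..<1}|lborel. \<bar>F f - H f\<bar>) \<le> (LINT f:{0..<1}|lborel. \<bar>F f - G f\<bar> + \<bar>G f - H f\<bar>)"
    using int by (intro set_integral_mono set_integral_add) auto
  also have "\<dots> = (LINT f:{0..<1}|lborel. \<bar>F f - G f\<bar>) + (LINT f:{0..<1}|lborel. \<bar>G f - H f\<bar>)"
    by (rule set_integral_add(2)[OF int(1,2)])
  finally show ?thesis unfolding spec_dist_def by simp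
qed

lemma spec_dist_commute: "spec_dist F G = spec_dist G F"
  unfolding spec_dist_def by (simp add: norm_minus_commute)


text \<open>Caps the distance between two nonnegative means; combined with the separation this
  forces \<open>ln M / M\<close> to be small.\<close>

lemma spec_dist_nonneg_le:
  fixes F G :: "real \<Rightarrow> real"
  assumes "continuous_on {0..1} F" "continuous_on {0..1} G" "\<And>f. 0 \<le> F f" "\<And>f. 0 \<le> G f"
  shows "spec_dist F G \<le> ((LINT f:{0..<1}|lborel. F f) + (LINT f:{0..<1}|lborel. G f)) / 2"
proof -
  have int: "set_integrable lborel {0..<1} F" "set_integrable lborel {0..<1} G"
      "set_integrable lborel {0..<1} (\<lambda>f. \<bar>F f - G f\<bar>)"
    by (rule set_integrable_unit_continuous, intro continuous_intros assms)+
  have "(LINT f:{0..<1}|lborel. \<bar>F f - G f\<bar>) \<le> (LINT f:{0..<1}|lborel. F f + G f)"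
  proof (rule set_integral_mono[OF int(3) set_integral_add(1)[OF int(1,2)]])
    show "\<bar>F f - G f\<bar> \<le> F f + G f" for f using assms(3,4)[of f] by linarith
  qed
  also have "\<dots> = (LINT f:{0..<1}|lborel. F f) + (LINT f:{0..<1}|lborel. G f)"
    by (rule set_integral_add(2)[OF int(1,2)])
  finally show ?thesis unfolding spec_dist_def by simp
qed

theorem theorem2:
  fixes P :: "'w measure" and M N L :: nat
    and r :: "nat \<Rightarrow> int \<Rightarrow> real" and s :: "nat \<Rightarrow> real \<Rightarrow> real"
    and \<sigma> A :: real
    and g :: "int \<Rightarrow> real" and G :: "real \<Rightarrow> real"
    and lab :: "nat \<Rightarrow> nat" and x :: "'w \<Rightarrow> nat \<Rightarrow> nat \<Rightarrow> real"
  assumes P: "prob_space P"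
    and sizes: "1 \<le> M" "1 \<le> L" "L < N"
    and acf_summable: "\<And>l. l \<in> {1..L} \<Longrightarrow> (\<lambda>m. \<bar>r l m\<bar>) summable_on UNIV"
    and psd: "\<And>l. l \<in> {1..L} \<Longrightarrow> spectrum (r l) (s l)"
    and psd_bounded: "\<And>l. l \<in> {1..L} \<Longrightarrow> bdd_above (s l ` {0..<1})"
    and psd_normalized: "\<And>l. l \<in> {1..L} \<Longrightarrow> (LINT f:{0..<1}|lborel. s l f) = 1"
    and labels: "lab ` {1..N} = {1..L}"
    and observations: "observation_model P M N L r (\<sigma>\<^sup>2) lab x"
    and window_even: "\<And>m. g (- m) = g m"
    and window_0: "g 0 = 1"
    and window_dtft: "spectrum g G"
    and window_bounds: "\<And>f. f \<in> {0..<1} \<Longrightarrow> 0 \<le> G f \<and> G f \<le> A"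
    and separation: "\<And>k l. k \<in> {1..L} \<Longrightarrow> l \<in> {1..L} \<Longrightarrow> k \<noteq> l \<Longrightarrow>
      spec_dist (s k) (s l) >
        8 * A * (B_const L s + \<sigma>\<^sup>2) * sqrt (2 * ln (real M) / real M) + 2 * mu_max g M L r"
  shows "\<exists>E \<in> sets P. measure P E \<ge> 1 - 2 * real N / (real M)\<^sup>2 \<and>
    (\<forall>w\<in>E. \<forall>C. KM_output g M N L (x w) C \<longrightarrow>
       same_partition L C (\<lambda>l. {i\<in>{1..N}. lab i = l}))"
proof -
  interpret prob_space P by (rule P)
  obtain Y t where Y: "\<And>i. i \<in> {1..N} \<Longrightarrow> noisy_realization P (r (lab i)) (\<sigma>\<^sup>2) (Y i)"
    and x: "\<And>i n w. i \<in> {1..N} \<Longrightarrow> n \<in> {1..M} \<Longrightarrow> w \<in> space P \<Longrightarrow> x w i n = Y i (t i + int n) w"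
    using observations unfolding observation_model_def by blast
  define B where "B = B_const L s"
  define C where "C = B + \<sigma>\<^sup>2"
  define \<mu> where "\<mu> = mu_max g M L r"
  define \<rho> where "\<rho> = sqrt (2 * ln (real M) / real M)"
  define T where "T = 4 * A * C * \<rho>"
  have M: "0 < M" using sizes by simp
  have g_le: "\<bar>g m\<bar> \<le> 1" for m
    using spectrum_window_le_1[OF window_dtft] window_bounds window_0 by blast
  have lab_in: "lab i \<in> {1..L}" if "i \<in> {1..N}" for i
    using imageI[OF that, of lab] unfolding labels .
  have s_le: "s l f \<le> B" if "l \<in> {1..L}" "f \<in> {0..<1}" for l f
  proof -
    have "s l f \<le> (SUP f\<in>{0..<1}. s l f)" by (rule cSUP_upper[OF that(2) psd_bounded[OF that(1)]])
    also have "\<dots> \<le> B" unfolding B_def B_const_def using that(1) by (intro Max_ge) auto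
    finally show ?thesis .
  qed
  then have sC: "s l f + \<sigma>\<^sup>2 \<le> C" if "l \<in> {1..L}" "f \<in> {0..<1}" for l f
    using that by (simp add: C_def)
  have r0: "r l 0 = 1" if "l \<in> {1..L}" for l
    using spectrum_0[OF psd[OF that]] psd_normalized[OF that] by simp
  \<comment> \<open>\<open>G\<close> integrates to \<open>g 0 = 1\<close>, so its upper bound is at
    least 1; in the next step the normalised PSDs give the same for \<open>B\<close>.\<close>
  have A1: "1 \<le> A" using spectrum_0_le[OF window_dtft] window_bounds window_0 by auto
  have B1: "1 \<le> B" using spectrum_0_le[OF psd, of 1 B] s_le r0[of 1] sizes by auto
  have AC: "0 < A" "0 < C" using A1 B1 by (auto simp: C_def add_pos_nonneg)
  have \<mu>_ge: "(\<Sum>\<^sub>\<infinity>m\<in>UNIV. \<bar>h_seq g M m\<bar> * \<bar>r l m\<bar>) \<le> \<mu>" if "l \<in> {1..L}" for l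
    unfolding \<mu>_def mu_max_def using that by (intro Max_ge) auto
  have "0 \<le> (\<Sum>\<^sub>\<infinity>m\<in>UNIV. \<bar>h_seq g M m\<bar> * \<bar>r 1 m\<bar>)" by (rule infsum_nonneg) simp
  then have \<mu>_nonneg: "0 \<le> \<mu>" using \<mu>_ge[of 1] sizes by simp
  define mean where "mean = (\<lambda>l. bt_mean g M (noisy_acf (r l) (\<sigma>\<^sup>2)))"
  have mean_cont: "continuous_on S (mean l)" for S l
    unfolding mean_def by (rule continuous_bt_mean)
  have mean_dist: "8 * A * C * \<rho> + \<mu> < spec_dist (mean k) (mean l)"
    if "k \<in> {1..L}" "l \<in> {1..L}" "k \<noteq> l" for k l
  proof -
    have "spec_dist (s k) (s l) \<le> spec_dist (bt_mean g M (r k)) (bt_mean g M (r l)) + \<mu>"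
      by (rule spec_dist_bt_mean) (use that in \<open>auto intro!: acf_summable psd g_le \<mu>_ge\<close>)
    also have "spec_dist (bt_mean g M (r k)) (bt_mean g M (r l)) = spec_dist (mean k) (mean l)"
      unfolding spec_dist_def mean_def by (simp add: bt_mean_noisy[of g M, OF window_0 M])
    finally show ?thesis
      using separation[OF that] unfolding B_def[symmetric] C_def[symmetric] \<mu>_def[symmetric] \<rho>_def[symmetric]
      by linarith
  qed
  \<comment> \<open>The extra 1 aligns samples numbered \<open>1..M\<close> with forms indexed from
    0.\<close>
  define est where "est = (\<lambda>w i f. bilin M (bt_kernel g M f) (\<lambda>p. Y i (t i + 1 + int p) w) (\<lambda>p. Y i (t i + 1 + int p) w))"
  have est_cont: "continuous_on S (est w i)" for S w i
    unfolding est_def by (rule continuous_bt_bilin)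
  have obs: "obs_dist g M (x w i) (x w j) = spec_dist (est w i) (est w j)"
    if "w \<in> space P" "i \<in> {1..N}" "j \<in> {1..N}" for w i j
  proof -
    have "bilin M (bt_kernel g M f) (\<lambda>p. x w i (Suc p)) (\<lambda>p. x w i (Suc p)) = est w i f"
      if "i \<in> {1..N}" for i f
      unfolding est_def using \<open>w \<in> space P\<close> that by (intro bilin_cong) (simp add: x add_ac)
    then show ?thesis
      using that unfolding obs_dist_bt_est[of g, OF window_even] by simp
  qed
  show ?thesis
  proof (cases "L = 1")
    \<comment> \<open>With one model the separation is vacuous and gives no control on
      \<open>ln M / M\<close>. All observations share a label, so the largest observed distance
      serves as threshold and the event is the whole space.\<close>
    case True
    have "same_partition L D (\<lambda>l. {i\<in>{1..N}. lab i = l})" if "KM_output g M N L (x w) D" for w D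
    proof (rule KM_output_correct[OF _ labels _ _ that])
      let ?S = "(\<lambda>(i, j). obs_dist g M (x w i) (x w j)) ` ({1..N} \<times> {1..N})"
      show "obs_dist g M (x w i) (x w j) \<le> Max ?S" if "i \<in> {1..N}" "j \<in> {1..N}" for i j
        using that by (intro Max_ge) auto
      show "Max ?S < obs_dist g M (x w i) (x w j)" if "i \<in> {1..N}" "j \<in> {1..N}" "lab i \<noteq> lab j" for i j
        using lab_in[OF that(1)] lab_in[OF that(2)] that(3) True by simp
    qed (use sizes in simp)
    then show ?thesis
      by (intro bexI[of _ "space P"]) (auto simp: prob_space)
  next
    case False
    then have L: "1 \<in> {1..L}" "2 \<in> {1..L}" using sizes by auto
    have mean_nonneg: "0 \<le> mean l f" if l: "l \<in> {1..L}" for l f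
    proof -
      obtain i where i: "i \<in> {1..N}" "lab i = l" using l unfolding labels[symmetric] by auto
      show ?thesis
        unfolding mean_def
        by (rule bt_mean_nonneg[OF Y[OF i(1), unfolded i(2)] psd[OF l] sC[OF l] window_dtft window_bounds M AC])
    qed
    have mean_int: "(LINT f:{0..<1}|lborel. mean l f) = 1 + \<sigma>\<^sup>2" if "l \<in> {1..L}" for l
      unfolding mean_def integral_bt_mean[of g M, OF window_0 M] using r0[OF that] by (simp add: noisy_acf_def)
    \<comment> \<open>The cap on the distance between two means is at most \<open>A * C\<close>, so
      \<open>8 * \<rho> < 1\<close>, which yields the smallness required by the concentration
      bound.\<close>
    have "8 * A * C * \<rho> + \<mu> < spec_dist (mean 1) (mean 2)" by (rule mean_dist[OF L]) simp
    also have "\<dots> \<le> 1 + \<sigma>\<^sup>2"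
      using spec_dist_nonneg_le[OF mean_cont mean_cont mean_nonneg mean_nonneg, OF L] mean_int L by simp
    also have "\<dots> \<le> C" using B1 by (simp add: C_def)
    also have "\<dots> \<le> A * C" using A1 AC by simp
    finally have "(A * C) * (8 * \<rho>) < (A * C) * 1" using \<mu>_nonneg by (simp add: mult_ac)
    then have "8 * \<rho> < 1" using AC by (simp only: mult_less_cancel_left_pos mult_pos_pos)
    moreover have \<rho>0: "0 \<le> \<rho>" using M by (simp add: \<rho>_def)
    ultimately have "\<rho> * \<rho> \<le> 1 / 2 * 1" by (intro mult_mono) auto
    then have small: "2 * ln (real M) / real M \<le> 1 / 2"
      using M by (simp add: \<rho>_def)
    define dev where "dev = (\<lambda>i w. LINT f:{0..<1}|lborel. \<bar>est w i f - mean (lab i) f\<bar>)"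
    have conc: "dev i \<in> borel_measurable P" "prob {w \<in> space P. T < dev i w} \<le> 2 / (real M)\<^sup>2"
      if i: "i \<in> {1..N}" for i
      using bt_est_concentration[OF Y[OF i] psd[OF lab_in[OF i]] sC[OF lab_in[OF i]] window_dtft window_bounds M AC small, of "t i + 1"]
      unfolding dev_def est_def mean_def T_def \<rho>_def by auto
    define E where "E = space P - (\<Union>i\<in>{1..N}. {w \<in> space P. T < dev i w})"
    have bad: "{w \<in> space P. T < dev i w} \<in> events" if "i \<in> {1..N}" for i
      using conc(1)[OF that] by measurable
    have "prob (\<Union>i\<in>{1..N}. {w \<in> space P. T < dev i w}) \<le> (\<Sum>i\<in>{1..N}. prob {w \<in> space P. T < dev i w})"
      by (rule finite_measure_subadditive_finite) (use bad in auto)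
    also have "\<dots> \<le> (\<Sum>i\<in>{1..N}. 2 / (real M)\<^sup>2)" by (intro sum_mono conc(2))
    finally have "1 - 2 * real N / (real M)\<^sup>2 \<le> prob E"
      unfolding E_def using bad by (subst prob_compl) (auto simp: mult_ac)
    moreover have "E \<in> events" unfolding E_def using bad by auto
    moreover have "same_partition L D (\<lambda>l. {i\<in>{1..N}. lab i = l})"
      if w: "w \<in> E" and KM: "KM_output g M N L (x w) D" for w D
    proof (rule KM_output_correct[OF _ labels _ _ KM])
      have wP: "w \<in> space P" using w by (simp add: E_def)
      \<comment> \<open>\<open>dev\<close> lacks the factor one half of
        \<open>spec_dist\<close>.\<close>
      have near: "spec_dist (est w i) (mean (lab i)) \<le> T / 2" if "i \<in> {1..N}" for i
        using w that by (auto simp: E_def dev_def spec_dist_def not_less)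
      fix i j assume ij: "i \<in> {1..N}" "j \<in> {1..N}"
      show "obs_dist g M (x w i) (x w j) \<le> T" if "lab i = lab j"
        using spec_dist_triangle[where F="est w i" and G="mean (lab i)" and H="est w j", OF est_cont mean_cont est_cont]
          near[OF ij(1)] near[OF ij(2)] that unfolding obs[OF wP ij] by (simp add: spec_dist_commute[of "mean _"])
      \<comment> \<open>The means are more than \<open>2 * T + \<mu>\<close> apart, and replacing
        both by estimates costs at most \<open>T / 2\<close> each.\<close>
      show "T < obs_dist g M (x w i) (x w j)" if "lab i \<noteq> lab j"
        using spec_dist_triangle[where F="mean (lab i)" and G="est w i" and H="mean (lab j)", OF mean_cont est_cont mean_cont]
          spec_dist_triangle[where F="est w i" and G="est w j" and H="mean (lab j)", OF est_cont est_cont mean_cont]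
          near[OF ij(1)] near[OF ij(2)] mean_dist[OF lab_in lab_in that, OF ij] \<mu>_nonneg
        unfolding obs[OF wP ij] T_def by (simp add: spec_dist_commute[of "mean _" "est _ _"])
    qed (use sizes in simp)
    ultimately show ?thesis by blast
  qed
qed

end
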